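(* Let $n\ge 3$, and let $\Sigma'$ be the branching semigroup of the standard embedding $D_n=\mathfrak{so}_{2n}\subset B_n=\mathfrak{so}_{2n+1}$, defined using the ordering of positive roots and the monomial order described in the context. For $k=1,\dots,n$ let $\sigma_{2k-1}=(\omega_k;0)$ be the signature with highest weight $\omega_k$ and all exponents zero, and let $\sigma_{2k}=(\omega_k;\varepsilon_k)$ be the signature with highest weight $\omega_k$ whose only nonzero exponent is the exponent $1$ at the root $\varepsilon_k$. Then $\Sigma'$ is a free (commutative) semigroup generated by $\sigma_1,\dots,\sigma_{2n}$.
   Context: Semigroups of signatures contain the zero signature. General definitions. Let $\mathfrak g$ be a simple complex Lie algebra with a triangular decomposition and positive roots $\{\alpha_1,\dots,\alpha_N\}$ in a fixed order, root vectors $e_{\pm\alpha}$; $V(\lambda)$ is the irreducible module with highest weight $\lambda$ and highest weight vector $v_\lambda$. A signature is $\sigma=(\lambda;p_1,\dots,p_N)$ with $\lambda$ dominant and exponents $p_i\in\mathbb Z_{\ge0}$; $v(\sigma)=e_{-\alpha_1}^{p_1}\cdots e_{-\alpha_N}^{p_N}v_\lambda$. Signatures are added componentwise. Fix a monomial order on exponent tuples; it compares signatures of the same highest weight. For $0\ne\omega\in V(\lambda)^*$, $\operatorname{sign}(\omega)$ is the least signature $\sigma$ of highest weight $\lambda$ with $\langle\omega,v(\sigma)\rangle\neq0$. For a subalgebra $\mathfrak h\subset\mathfrak g$ with $U'^-$ the maximal unipotent subgroup (of the connected subgroup $H$ with Lie algebra $\mathfrak h$) corresponding to the negative roots of $\mathfrak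 h$, the branching semigroup is $\Sigma'=\{\operatorname{sign}(\omega)\mid\lambda\text{ dominant},\ 0\neq\omega\in(V(\lambda)^* )^{U'^-}\}$. The case at hand. $\mathfrak g=B_n$; $\pm\varepsilon_i$ ($1\le i\le n$) are the nonzero weights of the standard representation $\mathbb C^{2n+1}$. The positive roots of $B_n$ are $\varepsilon_i\pm\varepsilon_j$ ($i<j$) and $\varepsilon_i$. The fundamental weights are $\omega_i=\varepsilon_1+\dots+\varepsilon_i$ for $i<n$ and $\omega_n=\frac12(\varepsilon_1+\dots+\varepsilon_n)$. $\mathfrak h=D_n$ is the standard subalgebra, with the same Cartan subalgebra and with positive roots $\varepsilon_i\pm\varepsilon_j$ ($i<j$); as a $D_n$-module, $\mathbb C^{2n+1}=\mathbb C^{2n}\oplus\langle e_0\rangle$ with $e_0$ of weight $0$. Ordering of positive roots of $B_n$: first, for $k=2,3,\dots,n$ successively, the block $\varepsilon_1-\varepsilon_k,\dots,\varepsilon_{k-1}-\varepsilon_k,\ \varepsilon_1+\varepsilon_k,\dots,\varepsilon_{k-1}+\varepsilon_k$; then $\varepsilon_1,\dots,\varepsilon_n$. Monomial order: two signatures of the same highest weight are compared by the following steps, passing to the next step only if the tuples compared so far coincide. First compare the exponents at $\varepsilon_1,\dots,\varepsilon_n$ in the degree lexicographic order. Then, for $k=n,n-1,\dots,2$ successively, compare the exponents at $\varepsilon_1+\varepsilon_k,\dots,\varepsilon_{k-1}+\varepsilon_k$ in the degree lexicographic order, and then the exponents at $\varepsilon_1-\varepsilon_k,\dots,\varepsilon_{k-1}-\varepsilon_k$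 in the degree lexicographic order. (Degree lexicographic: compare total degrees first, then lexicographically in the listed order.) *)

theory Defs
  imports
    Complex_Main
    "HOL-Library.Multiset"
    "HOL-Library.Function_Algebras"
    "HOL-Library.Product_Plus"
    "Jordan_Normal_Form.Matrix"
begin

section \<open>Weights and roots of \<open>B\<^sub>n\<close>\<close>

text \<open>
  A weight is given by its coordinates with respect to \<open>\<epsilon>\<^sub>1, \<dots>, \<epsilon>\<^sub>n\<close>; the coordinates with index
  outside \<open>{1..n}\<close> vanish.  Weights, exponents and signatures are added componentwise
  (Function-Algebras, Product-Plus).
\<close>

type_synonym weight = "nat \<Rightarrow> complex"

definition eps :: "nat \<Rightarrow> weight" where
  "eps i = (\<lambda>j. if j = i then 1 else 0)"

definition weight_form :: "nat \<Rightarrow> weight \<Rightarrow> weight \<Rightarrow> complex" where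
  "weight_form n l m = (\<Sum>i=1..n. l i * m i)"

definition pos_roots :: "nat \<Rightarrow> weight list" where
  "pos_roots n =
     concat (map (\<lambda>k. map (\<lambda>i. eps i - eps k) [1..<k] @ map (\<lambda>i. eps i + eps k) [1..<k]) [2..<Suc n])
     @ map eps [1..<Suc n]"

definition pos_roots_D :: "nat \<Rightarrow> weight set" where
  "pos_roots_D n = {eps i - eps j | i j. 1 \<le> i \<and> i < j \<and> j \<le> n}
                 \<union> {eps i + eps j | i j. 1 \<le> i \<and> i < j \<and> j \<le> n}"

definition dominant :: "nat \<Rightarrow> weight \<Rightarrow> bool" where
  "dominant n l \<longleftrightarrow>
     (\<forall>i. i \<notin> {1..n} \<longrightarrow> l i = 0) \<and>
     (\<forall>\<alpha>\<in>set (pos_roots n). 2 * weight_form n l \<alpha> / weight_form n \<alpha> \<alpha> \<in> \<nat>)"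

definition fund_weight :: "nat \<Rightarrow> nat \<Rightarrow> weight" where
  "fund_weight n k =
     (\<lambda>i. if i \<in> {1..k} then (if k < n then 1 else 1 / 2) else 0)"


section \<open>The Lie algebras \<open>so\<^sub>2\<^sub>n\<^sub>+\<^sub>1\<close> and \<open>so\<^sub>2\<^sub>n\<close>\<close>

text \<open>
  The basis of the standard representation is indexed by \<open>{0..2n}\<close>: the indices \<open>i\<close> and \<open>n + i\<close>
  (\<open>1 \<le> i \<le> n\<close>) carry vectors of weight \<open>\<epsilon>\<^sub>i\<close> and \<open>-\<epsilon>\<^sub>i\<close>, and the index 0 carries \<open>e\<^sub>0\<close>.
\<close>

definition gram :: "nat \<Rightarrow> complex mat" where
  "gram n = mat (2*n+1) (2*n+1)
     (\<lambda>(i, j). if (i = 0 \<and> j = 0) \<or> (1 \<le> i \<and> j = n + i) \<or> (1 \<le> j \<and> i = n + j) then 1 else 0)"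

definition so_odd :: "nat \<Rightarrow> complex mat set" where
  "so_odd n = {X \<in> carrier_mat (2*n+1) (2*n+1).
     transpose_mat X * gram n + gram n * X = 0\<^sub>m (2*n+1) (2*n+1)}"

text \<open>The stabilizer of \<open>e\<^sub>0\<close>; it acts on the orthogonal complement of \<open>e\<^sub>0\<close> as \<open>so\<^sub>2\<^sub>n\<close>.\<close>

definition so_even :: "nat \<Rightarrow> complex mat set" where
  "so_even n = {X \<in> so_odd n. X *\<^sub>v unit_vec (2*n+1) 0 = 0\<^sub>v (2*n+1)}"

definition lie_bracket :: "complex mat \<Rightarrow> complex mat \<Rightarrow> complex mat" where
  "lie_bracket X Y = X * Y - Y * X"

definition cartan :: "nat \<Rightarrow> complex mat set" where
  "cartan n = {H \<in> so_odd n. diagonal_mat H}"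

definition eval_weight :: "nat \<Rightarrow> weight \<Rightarrow> complex mat \<Rightarrow> complex" where
  "eval_weight n l H = (\<Sum>i=1..n. l i * H $$ (i, i))"

definition root_space :: "complex mat set \<Rightarrow> nat \<Rightarrow> weight \<Rightarrow> complex mat set" where
  "root_space L n \<alpha> = {X \<in> L. \<forall>H\<in>cartan n. lie_bracket H X = eval_weight n \<alpha> H \<cdot>\<^sub>m X}"

definition root_vectors :: "nat \<Rightarrow> (weight \<Rightarrow> complex mat) \<Rightarrow> bool" where
  "root_vectors n e \<longleftrightarrow>
     (\<forall>\<alpha> \<in> set (pos_roots n) \<union> uminus ` set (pos_roots n).
        e \<alpha> \<in> root_space (so_odd n) n \<alpha> \<and> e \<alpha> \<noteq> 0\<^sub>m (2*n+1) (2*n+1))"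

text \<open>The sum of the root spaces of \<open>D\<^sub>n\<close> for its negative roots.\<close>

inductive_set neg_nilpotent_D :: "nat \<Rightarrow> complex mat set" for n where
  zero: "0\<^sub>m (2*n+1) (2*n+1) \<in> neg_nilpotent_D n"
| add: "X \<in> neg_nilpotent_D n \<Longrightarrow> \<alpha> \<in> pos_roots_D n \<Longrightarrow> Y \<in> root_space (so_even n) n (- \<alpha>)
        \<Longrightarrow> X + Y \<in> neg_nilpotent_D n"


section \<open>The irreducible modules \<open>V(\<lambda>)\<close>\<close>

definition representation :: "nat \<Rightarrow> nat \<Rightarrow> (complex mat \<Rightarrow> complex mat) \<Rightarrow> bool" where
  "representation n d \<rho> \<longleftrightarrow>
     (\<forall>X\<in>so_odd n. \<rho> X \<in> carrier_mat d d) \<and>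
     (\<forall>X\<in>so_odd n. \<forall>Y\<in>so_odd n. \<rho> (X + Y) = \<rho> X + \<rho> Y) \<and>
     (\<forall>c. \<forall>X\<in>so_odd n. \<rho> (c \<cdot>\<^sub>m X) = c \<cdot>\<^sub>m \<rho> X) \<and>
     (\<forall>X\<in>so_odd n. \<forall>Y\<in>so_odd n. \<rho> (lie_bracket X Y) = lie_bracket (\<rho> X) (\<rho> Y))"

definition submodule :: "nat \<Rightarrow> nat \<Rightarrow> (complex mat \<Rightarrow> complex mat) \<Rightarrow> complex vec set \<Rightarrow> bool" where
  "submodule n d \<rho> W \<longleftrightarrow>
     W \<subseteq> carrier_vec d \<and> 0\<^sub>v d \<in> W \<and>
     (\<forall>u\<in>W. \<forall>w\<in>W. u + w \<in> W) \<and>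
     (\<forall>c. \<forall>w\<in>W. c \<cdot>\<^sub>v w \<in> W) \<and>
     (\<forall>X\<in>so_odd n. \<forall>w\<in>W. \<rho> X *\<^sub>v w \<in> W)"

definition irreducible_rep :: "nat \<Rightarrow> nat \<Rightarrow> (complex mat \<Rightarrow> complex mat) \<Rightarrow> bool" where
  "irreducible_rep n d \<rho> \<longleftrightarrow>
     representation n d \<rho> \<and> d > 0 \<and>
     (\<forall>W. submodule n d \<rho> W \<longrightarrow> W = {0\<^sub>v d} \<or> W = carrier_vec d)"

text \<open>
  \<open>\<complex>\<^sup>d\<close> with the action \<open>\<rho>\<close> is a model of \<open>V(\<lambda>)\<close> with highest weight vector \<open>v\<close>.  For dominant
  \<open>\<lambda>\<close> such a model exists and is unique up to isomorphism.
\<close>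

definition highest_weight_module ::
    "nat \<Rightarrow> weight \<Rightarrow> nat \<Rightarrow> (complex mat \<Rightarrow> complex mat) \<Rightarrow> complex vec \<Rightarrow> bool" where
  "highest_weight_module n l d \<rho> v \<longleftrightarrow>
     irreducible_rep n d \<rho> \<and> v \<in> carrier_vec d \<and> v \<noteq> 0\<^sub>v d \<and>
     (\<forall>H\<in>cartan n. \<rho> H *\<^sub>v v = eval_weight n l H \<cdot>\<^sub>v v) \<and>
     (\<forall>\<alpha>\<in>set (pos_roots n). \<forall>X\<in>root_space (so_odd n) n \<alpha>. \<rho> X *\<^sub>v v = 0\<^sub>v d)"


section \<open>Invariants of the maximal unipotent subgroup of \<open>D\<^sub>n\<close>\<close>

definition mat_exp :: "complex mat \<Rightarrow> complex mat" where
  "mat_exp A = mat (dim_row A) (dim_row A) (\<lambda>(i, j). \<Sum>k. (A ^\<^sub>m k) $$ (i, j) / fact k)"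

text \<open>
  The image in \<open>GL\<^sub>d\<close> of the connected unipotent group with Lie algebra \<open>neg_nilpotent_D n\<close>:
  this group is generated by exponentials.
\<close>

inductive_set neg_unipotent_D :: "nat \<Rightarrow> nat \<Rightarrow> (complex mat \<Rightarrow> complex mat) \<Rightarrow> complex mat set"
  for n d \<rho> where
  one: "1\<^sub>m d \<in> neg_unipotent_D n d \<rho>"
| mult: "g \<in> neg_unipotent_D n d \<rho> \<Longrightarrow> X \<in> neg_nilpotent_D n
         \<Longrightarrow> mat_exp (\<rho> X) * g \<in> neg_unipotent_D n d \<rho>"

text \<open>A linear form on \<open>\<complex>\<^sup>d\<close> is identified with the vector \<open>w\<close> representing it as \<open>u \<mapsto> w \<bullet> u\<close>.\<close>

definition invariant_forms :: "nat \<Rightarrow> nat \<Rightarrow> (complex mat \<Rightarrow> complex mat) \<Rightarrow> complex vec set" where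
  "invariant_forms n d \<rho> = {w \<in> carrier_vec d.
     \<forall>g\<in>neg_unipotent_D n d \<rho>. \<forall>u\<in>carrier_vec d. w \<bullet> (g *\<^sub>v u) = w \<bullet> u}"


section \<open>Signatures\<close>

text \<open>Exponents are indexed by the positive roots and vanish elsewhere.\<close>

type_synonym exponents = "weight \<Rightarrow> nat"
type_synonym signature = "weight \<times> exponents"

definition is_exponents :: "nat \<Rightarrow> exponents \<Rightarrow> bool" where
  "is_exponents n p \<longleftrightarrow> (\<forall>\<alpha>. \<alpha> \<notin> set (pos_roots n) \<longrightarrow> p \<alpha> = 0)"

definition monomial_vec ::
    "nat \<Rightarrow> (weight \<Rightarrow> complex mat) \<Rightarrow> (complex mat \<Rightarrow> complex mat) \<Rightarrow> complex vec \<Rightarrow> exponents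
     \<Rightarrow> complex vec" where
  "monomial_vec n e \<rho> v p = foldr (\<lambda>\<alpha> u. (\<rho> (e (- \<alpha>)) ^\<^sub>m p \<alpha>) *\<^sub>v u) (pos_roots n) v"

definition deglex :: "(nat list \<times> nat list) set" where
  "deglex = sum_list <*mlex*> lex less_than"

definition order_blocks :: "nat \<Rightarrow> weight list list" where
  "order_blocks n =
     map eps [1..<Suc n]
     # concat (map (\<lambda>k. [map (\<lambda>i. eps i + eps k) [1..<k], map (\<lambda>i. eps i - eps k) [1..<k]])
                   (rev [2..<Suc n]))"

definition exponents_less :: "nat \<Rightarrow> exponents \<Rightarrow> exponents \<Rightarrow> bool" where
  "exponents_less n p q \<longleftrightarrow> (map (map p) (order_blocks n), map (map q) (order_blocks n)) \<in> lex deglex"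

definition is_sign ::
    "nat \<Rightarrow> (weight \<Rightarrow> complex mat) \<Rightarrow> weight \<Rightarrow> (complex mat \<Rightarrow> complex mat) \<Rightarrow> complex vec
     \<Rightarrow> complex vec \<Rightarrow> signature \<Rightarrow> bool" where
  "is_sign n e l \<rho> v w s \<longleftrightarrow>
     (\<exists>p. s = (l, p) \<and> is_exponents n p \<and> w \<bullet> monomial_vec n e \<rho> v p \<noteq> 0 \<and>
          (\<forall>q. is_exponents n q \<and> w \<bullet> monomial_vec n e \<rho> v q \<noteq> 0 \<longrightarrow> q = p \<or> exponents_less n p q))"

definition branching_semigroup :: "nat \<Rightarrow> (weight \<Rightarrow> complex mat) \<Rightarrow> signature set" where
  "branching_semigroup n e =
     {s. \<exists>l d \<rho> v w. dominant n l \<and> highest_weight_module n l d \<rho> v \<and>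
           w \<in> invariant_forms n d \<rho> \<and> w \<noteq> 0\<^sub>v d \<and> is_sign n e l \<rho> v w s}"

definition generator :: "nat \<Rightarrow> nat \<Rightarrow> signature" where
  "generator n j =
     (if odd j then (fund_weight n ((j + 1) div 2), (\<lambda>\<alpha>. 0))
      else (fund_weight n (j div 2), (\<lambda>\<alpha>. if \<alpha> = eps (j div 2) then 1 else 0)))"

text \<open>
  The free commutative semigroup with zero on an index set \<open>I\<close> consists of the finite multisets
  over \<open>I\<close>.
\<close>

definition free_commutative_semigroup_on :: "'a::comm_monoid_add set \<Rightarrow> 'i set \<Rightarrow> ('i \<Rightarrow> 'a) \<Rightarrow> bool"
  where
  "free_commutative_semigroup_on S I g \<longleftrightarrow>
     bij_betw (\<lambda>M. \<Sum>i\<in>#M. g i) {M. set_mset M \<subseteq> I} S"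

end

theory Submission
  imports Defs "Jordan_Normal_Form.Char_Poly"
begin

text \<open>
  Let \<open>y\<^sub>i\<close> be a root vector for \<open>-\<epsilon>\<^sub>i\<close>, and let \<open>n'\<close> be the sum of the negative root spaces of \<open>D\<^sub>n\<close>.
  A linear form on \<open>V(\<lambda>)\<close> is invariant under the unipotent group exactly if it vanishes on
  \<open>n' V(\<lambda>)\<close> (\<open>invariant_forms_iff\<close>).  In every monomial the root vectors of \<open>D\<^sub>n\<close> stand on the left,
  so an invariant form vanishes on each monomial in which one of them occurs, and only the vectors
  \<open>y\<^sub>1\<^sup>p\<^sup>1 \<cdots> y\<^sub>n\<^sup>p\<^sup>n v\<close> matter.  On these the order of the factors is irrelevant, because the commutators
  \<open>[y\<^sub>i, y\<^sub>j]\<close> lie in \<open>n'\<close> and are central in the algebra generated by the \<open>y\<^sub>i\<close> (\<open>annihilates_mset\<close>).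

  Write \<open>\<lambda> = \<Sum> m\<^sub>k \<omega>\<^sub>k\<close>.  The sums of generators of highest weight \<open>\<lambda>\<close> are the signatures
  \<open>(\<lambda>; \<Sum> p\<^sub>k \<epsilon>\<^sub>k)\<close> with \<open>0 \<le> p\<^sub>k \<le> m\<^sub>k\<close>, each obtained from exactly one multiset: it contains the
  generator \<open>2k\<close> with multiplicity \<open>p\<^sub>k\<close> and the generator \<open>2k - 1\<close> with multiplicity \<open>m\<^sub>k - p\<^sub>k\<close>.  It
  remains to see that these are the signatures of invariant forms.

  Upper bound (\<open>exponent_bound\<close>).  For \<open>k < n\<close> let \<open>f\<close> be a root vector for \<open>-(\<epsilon>\<^sub>k - \<epsilon>\<^sub>k\<^sub>+\<^sub>1)\<close>.  Then \<open>f\<close>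
  to the power \<open>m\<^sub>k + 1\<close> kills \<open>v\<close>; it commutes with every \<open>y\<^sub>i\<close> except \<open>y\<^sub>k\<^sub>+\<^sub>1\<close>, which it turns into a
  multiple of \<open>y\<^sub>k\<close>; and an invariant form vanishes on its image.  Moving the power of \<open>f\<close> from \<open>v\<close> to
  the far left therefore trades \<open>m\<^sub>k + 1\<close> factors \<open>y\<^sub>k\<^sub>+\<^sub>1\<close> for factors \<open>y\<^sub>k\<close>, and the form vanishes on each
  monomial with \<open>p\<^sub>k > m\<^sub>k\<close>.  For \<open>k = n\<close> the power of \<open>y\<^sub>n\<close> itself kills \<open>v\<close>.

  Lower bound.  In a unitary module the form \<open>\<langle>u, \<cdot>\<rangle>\<close> is invariant if \<open>u\<close> is killed by the positive root
  vectors of \<open>D\<^sub>n\<close>.  A \<^emph>\<open>witness\<close> for \<open>(\<lambda>, p)\<close> consists of a unitary module with a highest weight vector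
  \<open>v\<close> of weight \<open>\<lambda>\<close> and such a vector \<open>u\<close> of weight \<open>\<lambda> - \<Sum> p\<^sub>k \<epsilon>\<^sub>k\<close> that pairs nontrivially with
  \<open>y\<^sup>p v\<close>.  Vectors of different weights are orthogonal, so \<open>y\<^sup>p v\<close> is the only monomial on which
  \<open>\<langle>u, \<cdot>\<rangle>\<close> does not vanish, and \<open>(\<lambda>, p)\<close> is its signature.  Tensor products of witnesses are witnesses (\<open>witness_tensor\<close>): by weights, every nonzero term in the Leibniz
  expansion of \<open>y\<^sup>p\<^sup>+\<^sup>p\<^sup>'\<close> contributes the same number.  A unitary module with a highest weight vector
  \<open>v\<close> of weight \<open>\<omega>\<^sub>k\<close> gives the witnesses \<open>u = v\<close> and \<open>u = y\<^sub>k v\<close> for the two generators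
  (\<open>witness_highest\<close>, \<open>witness_short\<close>).  Such modules are the spin module \<open>S\<close> for \<open>k = n\<close> and, for
  \<open>k < n\<close>, the module \<open>End S\<close> with the product \<open>\<gamma>\<^sub>1 \<cdots> \<gamma>\<^sub>k\<close> of Clifford generators as highest weight
  vector (\<open>fundamental_module\<close>).  Finally, a witness of least dimension is irreducible: a proper
  submodule and its orthogonal complement would split the nonzero pairing into two summands, one of
  which would be a smaller witness (\<open>irreducible_witness\<close>).
\<close>

section \<open>Adjoints and Kronecker products of matrices\<close>

lemma index_mult_sum:
  assumes "A \<in> carrier_mat m k" "B \<in> carrier_mat k l" "i < m" "j < l"
  shows "(A * B) $$ (i, j) = (\<Sum>c<k. A $$ (i, c) * B $$ (c, j))"
  using assms by (auto simp: scalar_prod_def lessThan_atLeast0 intro!: sum.cong)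

lemma index_mult_vec_sum:
  assumes "A \<in> carrier_mat m k" "x \<in> carrier_vec k" "i < m"
  shows "(A *\<^sub>v x) $ i = (\<Sum>c<k. A $$ (i, c) * x $ c)"
  using assms by (auto simp: scalar_prod_def lessThan_atLeast0 intro!: sum.cong)

lemma scalar_prod_sum:
  assumes "x \<in> carrier_vec k"
  shows "w \<bullet> x = (\<Sum>c<k. w $ c * x $ c)"
  using assms by (auto simp: scalar_prod_def lessThan_atLeast0)

definition adj :: "complex mat \<Rightarrow> complex mat" where
  "adj A = mat (dim_col A) (dim_row A) (\<lambda>(i, j). cnj (A $$ (j, i)))"

lemma adj_dim [simp]: "dim_row (adj A) = dim_col A" "dim_col (adj A) = dim_row A"
  by (simp_all add: adj_def)

lemma adj_carrier [simp, intro]: "A \<in> carrier_mat m k \<Longrightarrow> adj A \<in> carrier_mat k m"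
  by (auto simp: adj_def)

lemma adj_index [simp]: "i < dim_col A \<Longrightarrow> j < dim_row A \<Longrightarrow> adj A $$ (i, j) = cnj (A $$ (j, i))"
  by (simp add: adj_def)

lemma adj_adj [simp]: "adj (adj A) = A"
  by (rule eq_matI) auto

lemma adj_mult:
  assumes "A \<in> carrier_mat m k" "B \<in> carrier_mat k l"
  shows "adj (A * B) = adj B * adj A"
proof (rule eq_matI)
  fix i j assume "i < dim_row (adj B * adj A)" "j < dim_col (adj B * adj A)"
  then have ij: "i < l" "j < m" using assms by auto
  have "adj (A * B) $$ (i, j) = cnj ((A * B) $$ (j, i))"
    using ij assms by (intro adj_index) auto
  also have "\<dots> = (\<Sum>c<k. cnj (B $$ (c, i)) * cnj (A $$ (j, c)))"
    using ij assms by (subst index_mult_sum) (auto simp: mult.commute)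
  also have "\<dots> = (\<Sum>c<k. adj B $$ (i, c) * adj A $$ (c, j))"
    using ij assms by (intro sum.cong) auto
  also have "\<dots> = (adj B * adj A) $$ (i, j)"
    using ij assms by (intro index_mult_sum[symmetric]) auto
  finally show "adj (A * B) $$ (i, j) = (adj B * adj A) $$ (i, j)" .
qed (use assms in auto)

lemma adj_add:
  assumes "A \<in> carrier_mat m k" "B \<in> carrier_mat m k"
  shows "adj (A + B) = adj A + adj B"
  by (rule eq_matI) (use assms in auto)

lemma adj_one [simp]: "adj (1\<^sub>m d) = 1\<^sub>m d"
  by (rule eq_matI) auto

lemma conjugate_complex [simp]: "conjugate (x :: complex) = cnj x"
  by (simp add: conjugate_complex_def)

lemma form_adj:
  assumes "A \<in> carrier_mat m k" "u \<in> carrier_vec m" "x \<in> carrier_vec k"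
  shows "conjugate u \<bullet> (A *\<^sub>v x) = conjugate (adj A *\<^sub>v u) \<bullet> x"
proof -
  have "conjugate u \<bullet> (A *\<^sub>v x) = (\<Sum>i<m. cnj (u $ i) * (\<Sum>c<k. A $$ (i, c) * x $ c))"
    using assms by (subst scalar_prod_sum[of _ m])
      (auto simp: index_mult_vec_sum simp del: index_mult_mat_vec intro!: sum.cong)
  also have "\<dots> = (\<Sum>c<k. (\<Sum>i<m. cnj (u $ i) * A $$ (i, c)) * x $ c)"
    by (simp add: sum_distrib_left sum_distrib_right mult.assoc) (rule sum.swap)
  also have "\<dots> = (\<Sum>c<k. cnj ((adj A *\<^sub>v u) $ c) * x $ c)"
    using assms by (intro sum.cong refl) (auto simp: index_mult_vec_sum[of _ k m] mult.commute simp del: index_mult_mat_vec)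
  also have "\<dots> = conjugate (adj A *\<^sub>v u) \<bullet> x"
    using assms by (subst scalar_prod_sum[of _ k]) (auto intro!: sum.cong simp del: index_mult_mat_vec)
  finally show ?thesis .
qed

lemma form_self_eq_0: "u \<in> carrier_vec d \<Longrightarrow> conjugate u \<bullet> u = 0 \<longleftrightarrow> u = 0\<^sub>v d" for u :: "complex vec"
  using conjugate_square_eq_0_vec[of u d] conjugate_vec_sprod_comm[of u d u] by simp

lemma sum_div_mod:
  fixes h :: "nat \<Rightarrow> nat \<Rightarrow> 'a::comm_monoid_add"
  shows "(\<Sum>k<m*d. h (k div d) (k mod d)) = (\<Sum>i<m. \<Sum>j<d. h i j)"
proof (cases "d = 0")
  case False
  have "(\<Sum>k<m*d. h (k div d) (k mod d)) = (\<Sum>(i, j)\<in>{..<m}\<times>{..<d}. h i j)"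
  proof (rule sum.reindex_bij_witness[of _ "\<lambda>(i, j). i * d + j" "\<lambda>k. (k div d, k mod d)"])
    fix k assume "k \<in> {..<m*d}"
    then show "(k div d, k mod d) \<in> {..<m} \<times> {..<d}"
      using False by (auto simp: less_mult_imp_div_less)
  next
    fix p assume "p \<in> {..<m} \<times> {..<d}"
    then obtain i j where p: "p = (i, j)" "i < m" "j < d" by auto
    have "i * d + j < (i + 1) * d" using p by simp
    also have "\<dots> \<le> m * d" using p by (intro mult_right_mono) auto
    finally show "(case p of (i, j) \<Rightarrow> i * d + j) \<in> {..<m*d}" using p by simp
  qed (use False in auto)
  then show ?thesis by (simp add: sum.cartesian_product)
qed simp

text \<open>
  A pair \<open>(i, i')\<close> of row indices is encoded as \<open>i * dim_row B + i'\<close>, and likewise for columns.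
\<close>
definition kron :: "complex mat \<Rightarrow> complex mat \<Rightarrow> complex mat" where
  "kron A B = mat (dim_row A * dim_row B) (dim_col A * dim_col B)
     (\<lambda>(i, j). A $$ (i div dim_row B, j div dim_col B) * B $$ (i mod dim_row B, j mod dim_col B))"

text \<open>
  The element of \<open>\<complex>\<^sup>m \<otimes> \<complex>\<^sup>k\<close> that a matrix stands for under \<open>V \<otimes> W\<^sup>* \<cong> Hom W V\<close>, read row by row.
\<close>
definition tensor_vec :: "complex mat \<Rightarrow> complex vec" where
  "tensor_vec T = vec (dim_row T * dim_col T) (\<lambda>i. T $$ (i div dim_col T, i mod dim_col T))"

lemma kron_carrier [simp, intro]:
  "A \<in> carrier_mat m k \<Longrightarrow> B \<in> carrier_mat p l \<Longrightarrow> kron A B \<in> carrier_mat (m * p) (k * l)"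
  by (auto simp: kron_def)

lemma tensor_vec_carrier [simp, intro]:
  "T \<in> carrier_mat m k \<Longrightarrow> tensor_vec T \<in> carrier_vec (m * k)"
  by (auto simp: tensor_vec_def)

lemma div_less: "i < m * d \<Longrightarrow> i div d < (m::nat)"
  by (simp add: less_mult_imp_div_less)

lemma mod_less: "i < m * d \<Longrightarrow> i mod d < (d::nat)"
  by (cases "d = 0") auto

lemma kron_mult:
  assumes "A \<in> carrier_mat m m" "C \<in> carrier_mat m m" "B \<in> carrier_mat d d" "D \<in> carrier_mat d d"
  shows "kron A B * kron C D = kron (A * C) (B * D)"
proof (rule eq_matI)
  fix i j assume "i < dim_row (kron (A * C) (B * D))" "j < dim_col (kron (A * C) (B * D))"
  then have ij: "i < m * d" "j < m * d" using assms by (auto simp: kron_def)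
  have "(kron A B * kron C D) $$ (i, j) = (\<Sum>k<m*d. kron A B $$ (i, k) * kron C D $$ (k, j))"
    using ij assms by (intro index_mult_sum) auto
  also have "\<dots> = (\<Sum>k<m*d. (A $$ (i div d, k div d) * C $$ (k div d, j div d)) *
                            (B $$ (i mod d, k mod d) * D $$ (k mod d, j mod d)))"
    using ij assms by (intro sum.cong) (auto simp: kron_def)
  also have "\<dots> = (\<Sum>p<m. \<Sum>q<d. (A $$ (i div d, p) * C $$ (p, j div d)) *
                            (B $$ (i mod d, q) * D $$ (q, j mod d)))"
    by (rule sum_div_mod)
  also have "\<dots> = (\<Sum>p<m. A $$ (i div d, p) * C $$ (p, j div d)) * (\<Sum>q<d. B $$ (i mod d, q) * D $$ (q, j mod d))"
    by (simp add: sum_product)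
  also have "(\<Sum>p<m. A $$ (i div d, p) * C $$ (p, j div d)) = (A * C) $$ (i div d, j div d)"
    using ij assms by (intro index_mult_sum[symmetric]) (auto simp: div_less)
  also have "(\<Sum>q<d. B $$ (i mod d, q) * D $$ (q, j mod d)) = (B * D) $$ (i mod d, j mod d)"
    using ij assms by (intro index_mult_sum[symmetric]) (auto simp: mod_less)
  also have "(A * C) $$ (i div d, j div d) * (B * D) $$ (i mod d, j mod d) = kron (A * C) (B * D) $$ (i, j)"
    using ij assms by (simp add: kron_def)
  finally show "(kron A B * kron C D) $$ (i, j) = kron (A * C) (B * D) $$ (i, j)" .
qed (use assms in \<open>auto simp: kron_def\<close>)

lemma kron_tensor_vec:
  assumes "A \<in> carrier_mat m m" "B \<in> carrier_mat d d" "T \<in> carrier_mat m d"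
  shows "kron A B *\<^sub>v tensor_vec T = tensor_vec (A * T * transpose_mat B)"
proof (rule eq_vecI)
  have AT: "A * T \<in> carrier_mat m d" using assms by simp
  fix i assume "i < dim_vec (tensor_vec (A * T * transpose_mat B))"
  then have i: "i < m * d" using assms by (auto simp: tensor_vec_def)
  have "(kron A B *\<^sub>v tensor_vec T) $ i = (\<Sum>k<m*d. kron A B $$ (i, k) * tensor_vec T $ k)"
    using i assms by (intro index_mult_vec_sum) auto
  also have "\<dots> = (\<Sum>k<m*d. A $$ (i div d, k div d) * T $$ (k div d, k mod d) * B $$ (i mod d, k mod d))"
    using i assms by (intro sum.cong) (auto simp: kron_def tensor_vec_def)
  also have "\<dots> = (\<Sum>p<m. \<Sum>q<d. A $$ (i div d, p) * T $$ (p, q) * B $$ (i mod d, q))"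
    by (rule sum_div_mod)
  also have "\<dots> = (\<Sum>q<d. (\<Sum>p<m. A $$ (i div d, p) * T $$ (p, q)) * B $$ (i mod d, q))"
    by (subst sum.swap) (simp add: sum_distrib_right)
  also have "\<dots> = (\<Sum>q<d. (A * T) $$ (i div d, q) * transpose_mat B $$ (q, i mod d))"
    using i assms by (intro sum.cong refl) (auto simp: index_mult_sum[of A m m T d] div_less mod_less simp del: index_mult_mat(1))
  also have "\<dots> = (A * T * transpose_mat B) $$ (i div d, i mod d)"
    using i assms AT by (intro index_mult_sum[symmetric]) (auto simp: div_less mod_less)
  also have "\<dots> = tensor_vec (A * T * transpose_mat B) $ i"
    using i assms by (simp add: tensor_vec_def)
  finally show "(kron A B *\<^sub>v tensor_vec T) $ i = tensor_vec (A * T * transpose_mat B) $ i" .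
qed (use assms in \<open>auto simp: kron_def tensor_vec_def\<close>)

lemma kron_add_left:
  "A \<in> carrier_mat m k \<Longrightarrow> C \<in> carrier_mat m k \<Longrightarrow> kron (A + C) B = kron A B + kron C B"
  by (rule eq_matI) (auto simp: kron_def div_less algebra_simps)

lemma kron_add_right:
  "B \<in> carrier_mat m k \<Longrightarrow> D \<in> carrier_mat m k \<Longrightarrow> kron A (B + D) = kron A B + kron A D"
  by (rule eq_matI) (auto simp: kron_def mod_less algebra_simps)

lemma kron_minus_left:
  "A \<in> carrier_mat m k \<Longrightarrow> C \<in> carrier_mat m k \<Longrightarrow> kron (A - C) B = kron A B - kron C B"
  by (rule eq_matI) (auto simp: kron_def div_less algebra_simps)

lemma kron_minus_right:
  "B \<in> carrier_mat m k \<Longrightarrow> D \<in> carrier_mat m k \<Longrightarrow> kron A (B - D) = kron A B - kron A D"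
  by (rule eq_matI) (auto simp: kron_def mod_less algebra_simps)

lemma kron_smult_left: "kron (c \<cdot>\<^sub>m A) B = c \<cdot>\<^sub>m kron A B"
  by (rule eq_matI) (auto simp: kron_def div_less)

lemma kron_smult_right: "kron A (c \<cdot>\<^sub>m B) = c \<cdot>\<^sub>m kron A B"
  by (rule eq_matI) (auto simp: kron_def mod_less)

lemma kron_one: "kron (1\<^sub>m m) (1\<^sub>m d) = 1\<^sub>m (m * d)"
proof (rule eq_matI)
  fix i j assume "i < dim_row (1\<^sub>m (m * d) :: complex mat)" "j < dim_col (1\<^sub>m (m * d) :: complex mat)"
  then have ij: "i < m * d" "j < m * d" by auto
  have "i div d = j div d \<Longrightarrow> i mod d = j mod d \<Longrightarrow> i = j"
    by (metis div_mult_mod_eq)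
  then show "kron (1\<^sub>m m) (1\<^sub>m d) $$ (i, j) = 1\<^sub>m (m * d) $$ (i, j)"
    using ij by (auto simp: kron_def div_less mod_less)
qed (auto simp: kron_def)

lemma adj_kron: "adj (kron A B) = kron (adj A) (adj B)"
  by (rule eq_matI) (auto simp: kron_def div_less mod_less)

definition vkron :: "complex vec \<Rightarrow> complex vec \<Rightarrow> complex vec" where
  "vkron x y = vec (dim_vec x * dim_vec y) (\<lambda>i. x $ (i div dim_vec y) * y $ (i mod dim_vec y))"

lemma vkron_carrier [simp, intro]:
  "x \<in> carrier_vec m \<Longrightarrow> y \<in> carrier_vec d \<Longrightarrow> vkron x y \<in> carrier_vec (m * d)"
  by (auto simp: vkron_def)

lemma kron_mult_vkron:
  assumes "A \<in> carrier_mat m m" "B \<in> carrier_mat d d" "x \<in> carrier_vec m" "y \<in> carrier_vec d"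
  shows "kron A B *\<^sub>v vkron x y = vkron (A *\<^sub>v x) (B *\<^sub>v y)"
proof (rule eq_vecI)
  fix i assume "i < dim_vec (vkron (A *\<^sub>v x) (B *\<^sub>v y))"
  then have i: "i < m * d" using assms by (auto simp: vkron_def)
  have "(kron A B *\<^sub>v vkron x y) $ i = (\<Sum>k<m*d. kron A B $$ (i, k) * vkron x y $ k)"
    using i assms by (intro index_mult_vec_sum) auto
  also have "\<dots> = (\<Sum>k<m*d. (A $$ (i div d, k div d) * x $ (k div d)) * (B $$ (i mod d, k mod d) * y $ (k mod d)))"
    using i assms by (intro sum.cong) (auto simp: kron_def vkron_def)
  also have "\<dots> = (\<Sum>p<m. \<Sum>q<d. (A $$ (i div d, p) * x $ p) * (B $$ (i mod d, q) * y $ q))"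
    by (rule sum_div_mod)
  also have "\<dots> = (\<Sum>p<m. A $$ (i div d, p) * x $ p) * (\<Sum>q<d. B $$ (i mod d, q) * y $ q)"
    by (simp add: sum_product)
  also have "(\<Sum>p<m. A $$ (i div d, p) * x $ p) = (A *\<^sub>v x) $ (i div d)"
    using i assms by (intro index_mult_vec_sum[symmetric]) (auto simp: div_less)
  also have "(\<Sum>q<d. B $$ (i mod d, q) * y $ q) = (B *\<^sub>v y) $ (i mod d)"
    using i assms by (intro index_mult_vec_sum[symmetric]) (auto simp: mod_less)
  finally show "(kron A B *\<^sub>v vkron x y) $ i = vkron (A *\<^sub>v x) (B *\<^sub>v y) $ i"
    using i assms by (simp add: vkron_def)
qed (use assms in \<open>auto simp: kron_def vkron_def\<close>)

lemma form_vkron: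
  assumes "u \<in> carrier_vec m" "u' \<in> carrier_vec d" "x \<in> carrier_vec m" "x' \<in> carrier_vec d"
  shows "conjugate (vkron u u') \<bullet> vkron x x' = (conjugate u \<bullet> x) * (conjugate u' \<bullet> x')"
proof -
  have "conjugate (vkron u u') \<bullet> vkron x x'
      = (\<Sum>k<m*d. cnj (u $ (k div d)) * x $ (k div d) * (cnj (u' $ (k mod d)) * x' $ (k mod d)))"
    using assms by (subst scalar_prod_sum[of _ "m*d"]) (auto simp: vkron_def intro!: sum.cong)
  also have "\<dots> = (\<Sum>p<m. \<Sum>q<d. cnj (u $ p) * x $ p * (cnj (u' $ q) * x' $ q))"
    by (rule sum_div_mod)
  also have "\<dots> = (conjugate u \<bullet> x) * (conjugate u' \<bullet> x')"
    using assms by (simp add: sum_product scalar_prod_sum[of _ m] scalar_prod_sum[of _ d])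
  finally show ?thesis .
qed

section \<open>The matrices and root spaces of \<open>so\<^sub>2\<^sub>n\<^sub>+\<^sub>1\<close>\<close>

text \<open>
  The invariant form pairs the basis vectors with indices \<open>a\<close> and \<open>dual n a\<close>; their weights are
  opposite.
\<close>
definition dual :: "nat \<Rightarrow> nat \<Rightarrow> nat" where
  "dual n a = (if a = 0 then 0 else if a \<le> n then n + a else a - n)"

definition wt :: "nat \<Rightarrow> nat \<Rightarrow> weight" where
  "wt n a = (if a = 0 then 0 else if a \<le> n then eps a else - eps (a - n))"

lemma dual_le: "a \<le> 2 * n \<Longrightarrow> dual n a \<le> 2 * n"
  by (auto simp: dual_def)

lemma dual_dual [simp]: "a \<le> 2 * n \<Longrightarrow> dual n (dual n a) = a"
  by (auto simp: dual_def)

lemma dual_eq_iff: "a \<le> 2 * n \<Longrightarrow> b \<le> 2 * n \<Longrightarrow> dual n a = dual n b \<longleftrightarrow> a = b"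
  by (metis dual_dual)

lemma wt_dual: "a \<le> 2 * n \<Longrightarrow> wt n (dual n a) = - wt n a"
  by (auto simp: wt_def dual_def)

lemma gram_entry:
  "i \<le> 2 * n \<Longrightarrow> j \<le> 2 * n \<Longrightarrow> gram n $$ (i, j) = (if j = dual n i then 1 else 0)"
  by (auto simp: gram_def dual_def)

lemma gram_dim [simp]: "dim_row (gram n) = Suc (2 * n)" "dim_col (gram n) = Suc (2 * n)"
  by (simp_all add: gram_def)

lemma sum_dual:
  fixes f :: "nat \<Rightarrow> 'a::comm_monoid_add"
  shows "(\<Sum>a\<le>2*n. f (dual n a)) = (\<Sum>a\<le>2*n. f a)"
  by (rule sum.reindex_bij_witness[of _ "dual n" "dual n"]) (auto simp: dual_le)

text \<open>
  Multiplication by the Gram matrix permutes rows or columns by \<open>dual n\<close>, which turns the defining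
  equation into a skew symmetry of the entries.
\<close>
lemma so_odd_iff:
  "X \<in> so_odd n \<longleftrightarrow> X \<in> carrier_mat (2*n+1) (2*n+1) \<and>
     (\<forall>a\<le>2*n. \<forall>b\<le>2*n. X $$ (dual n b, dual n a) = - X $$ (a, b))"
proof (cases "X \<in> carrier_mat (2*n+1) (2*n+1)")
  case X: True
  have e: "(transpose_mat X * gram n + gram n * X) $$ (i, j) = X $$ (dual n j, i) + X $$ (dual n i, j)"
    if ij: "i \<le> 2 * n" "j \<le> 2 * n" for i j
  proof -
    have 1: "(transpose_mat X * gram n) $$ (i, j) = X $$ (dual n j, i)"
    proof -
      have "(transpose_mat X * gram n) $$ (i, j)
          = (\<Sum>c<2*n+1. transpose_mat X $$ (i, c) * gram n $$ (c, j))"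
        using X ij by (intro index_mult_sum[of _ _ "2*n+1"]) auto
      also have "\<dots> = (\<Sum>c<2*n+1. if c = dual n j then X $$ (dual n j, i) else 0)"
        using X ij by (intro sum.cong) (auto simp: gram_entry dual_le)
      finally show ?thesis using ij dual_le[of j n] by simp
    qed
    have 2: "(gram n * X) $$ (i, j) = X $$ (dual n i, j)"
    proof -
      have "(gram n * X) $$ (i, j) = (\<Sum>c<2*n+1. gram n $$ (i, c) * X $$ (c, j))"
        using X ij by (intro index_mult_sum[of _ _ "2*n+1"]) auto
      also have "\<dots> = (\<Sum>c<2*n+1. if c = dual n i then X $$ (dual n i, j) else 0)"
        using X ij by (intro sum.cong) (auto simp: gram_entry)
      finally show ?thesis using ij dual_le[of i n] by simp
    qed
    show ?thesis using 1 2 X ij by (subst index_add_mat) auto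
  qed
  have "X \<in> so_odd n \<longleftrightarrow> (\<forall>i\<le>2*n. \<forall>j\<le>2*n. X $$ (dual n j, i) + X $$ (dual n i, j) = 0)"
  proof -
    have "X \<in> so_odd n \<longleftrightarrow> (\<forall>i\<le>2*n. \<forall>j\<le>2*n. (transpose_mat X * gram n + gram n * X) $$ (i, j) = 0)"
      using X by (auto simp: so_odd_def mat_eq_iff less_Suc_eq_le)
    then show ?thesis using e by simp
  qed
  also have "\<dots> \<longleftrightarrow> (\<forall>a\<le>2*n. \<forall>b\<le>2*n. X $$ (dual n b, dual n a) = - X $$ (a, b))"
  proof safe
    fix a b assume h: "\<forall>i\<le>2*n. \<forall>j\<le>2*n. X $$ (dual n j, i) + X $$ (dual n i, j) = 0"
      and ab: "a \<le> 2*n" "b \<le> 2*n"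
    from h[rule_format, of "dual n a" b] ab show "X $$ (dual n b, dual n a) = - X $$ (a, b)"
      by (simp add: dual_le add_eq_0_iff2)
  next
    fix i j assume h: "\<forall>a\<le>2*n. \<forall>b\<le>2*n. X $$ (dual n b, dual n a) = - X $$ (a, b)"
      and ab: "i \<le> 2*n" "j \<le> 2*n"
    from h[rule_format, of "dual n i" j] ab show "X $$ (dual n j, i) + X $$ (dual n i, j) = 0"
      by (simp add: dual_le)
  qed
  finally show ?thesis using X by simp
qed (auto simp: so_odd_def)

lemma so_oddD:
  assumes "X \<in> so_odd n"
  shows "X \<in> carrier_mat (2*n+1) (2*n+1)"
    and "a \<le> 2*n \<Longrightarrow> b \<le> 2*n \<Longrightarrow> X $$ (dual n b, dual n a) = - X $$ (a, b)"
  using assms by (auto simp: so_odd_iff)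

lemma so_odd_add: "X \<in> so_odd n \<Longrightarrow> Y \<in> so_odd n \<Longrightarrow> X + Y \<in> so_odd n"
  by (auto simp: so_odd_iff dual_le less_Suc_eq_le)

lemma so_odd_smult: "X \<in> so_odd n \<Longrightarrow> c \<cdot>\<^sub>m X \<in> so_odd n"
  by (auto simp: so_odd_iff dual_le less_Suc_eq_le)

lemma so_odd_zero: "0\<^sub>m (2*n+1) (2*n+1) \<in> so_odd n"
  by (auto simp: so_odd_iff dual_le less_Suc_eq_le)

lemma lie_bracket_entry:
  assumes "X \<in> carrier_mat (2*n+1) (2*n+1)" "Y \<in> carrier_mat (2*n+1) (2*n+1)" "a \<le> 2*n" "b \<le> 2*n"
  shows "lie_bracket X Y $$ (a, b)
    = (\<Sum>c\<le>2*n. X $$ (a, c) * Y $$ (c, b)) - (\<Sum>c\<le>2*n. Y $$ (a, c) * X $$ (c, b))"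
proof -
  have "lie_bracket X Y $$ (a, b) = (X * Y) $$ (a, b) - (Y * X) $$ (a, b)"
    using assms unfolding lie_bracket_def by (subst index_minus_mat) (auto simp del: index_mult_mat(1))
  moreover have "(X * Y) $$ (a, b) = (\<Sum>c<2*n+1. X $$ (a, c) * Y $$ (c, b))"
    using assms by (intro index_mult_sum[of _ "2*n+1"]) auto
  moreover have "(Y * X) $$ (a, b) = (\<Sum>c<2*n+1. Y $$ (a, c) * X $$ (c, b))"
    using assms by (intro index_mult_sum[of _ "2*n+1"]) auto
  ultimately show ?thesis by (simp only: Suc_eq_plus1[symmetric] lessThan_Suc_atMost)
qed

text \<open>
  The element of the Cartan subalgebra at which each weight \<open>l\<close> takes the value \<open>\<Sum>\<^sub>i l i * h i\<close>.
\<close>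
definition cartan_diag :: "nat \<Rightarrow> weight \<Rightarrow> complex mat" where
  "cartan_diag n h = mat (2*n+1) (2*n+1) (\<lambda>(a, b). if a = b then \<Sum>i=1..n. wt n a i * h i else 0)"

lemma cartan_entry:
  assumes "H \<in> cartan n" "a \<le> 2*n" "b \<le> 2*n"
  shows "H $$ (a, b) = (if a = b then eval_weight n (wt n a) H else 0)"
proof -
  have H: "H \<in> so_odd n" "diagonal_mat H" using assms(1) by (auto simp: cartan_def)
  note s = so_oddD[OF H(1)]
  have d: "H $$ (a, b) = 0" if "a \<noteq> b" 
    using H(2) s(1) assms(2,3) that by (auto simp: diagonal_mat_def)
  have ev: "eval_weight n (eps i) H = H $$ (i, i)" if "1 \<le> i" "i \<le> n" for i
  proof -
    have "eval_weight n (eps i) H = (\<Sum>j=1..n. if j = i then H $$ (i, i) else 0)"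
      unfolding eval_weight_def by (rule sum.cong) (auto simp: eps_def)
    then show ?thesis using that by simp
  qed
  have m: "eval_weight n (- l) H = - eval_weight n l H" for l
    by (simp add: eval_weight_def sum_negf)
  have "H $$ (a, a) = eval_weight n (wt n a) H"
  proof -
    consider "a = 0" | "1 \<le> a" "a \<le> n" | "n < a" by linarith
    then show ?thesis
    proof cases
      case 1
      have "H $$ (0, 0) = 0" using s(2)[of 0 0] by (simp add: dual_def)
      then show ?thesis using 1 by (simp add: wt_def eval_weight_def)
    next
      case 2
      then show ?thesis using ev[of a] by (simp add: wt_def)
    next
      case 3
      then have "dual n (a - n) = a" using assms(2) by (auto simp: dual_def)
      then have "H $$ (a, a) = - H $$ (a - n, a - n)"
        using s(2)[of "a - n" "a - n"] assms(2) by simp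
      then show ?thesis using 3 ev[of "a - n"] assms(2) by (auto simp: wt_def m)
    qed
  qed
  then show ?thesis using d by auto
qed

lemma eps_apply: "eps i j = (if j = i then 1 else 0)" by (simp add: eps_def)

lemma eval_weight_wt_eps: "(\<Sum>i=1..n. eps k i * h i) = (if 1 \<le> k \<and> k \<le> n then h k else (0::complex))"
proof -
  have "(\<Sum>i=1..n. eps k i * h i) = (\<Sum>i=1..n. if i = k then h k else 0)"
    by (rule sum.cong) (auto simp: eps_def)
  then show ?thesis by simp
qed

lemma cartan_diag_in: "cartan_diag n h \<in> cartan n"
proof -
  have "cartan_diag n h \<in> so_odd n"
    by (auto simp: so_odd_iff cartan_diag_def dual_le dual_eq_iff less_Suc_eq_le wt_dual sum_negf)
  then show ?thesis by (auto simp: cartan_def diagonal_mat_def cartan_diag_def)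
qed

lemma eval_weight_cartan_diag: "eval_weight n l (cartan_diag n h) = (\<Sum>i=1..n. l i * h i)"
  unfolding eval_weight_def cartan_diag_def
  by (rule sum.cong) (auto simp: wt_def eval_weight_wt_eps[simplified])

lemma bracket_cartan_entry:
  assumes H: "H \<in> cartan n" and X: "X \<in> carrier_mat (2*n+1) (2*n+1)" and ab: "a \<le> 2*n" "b \<le> 2*n"
  shows "lie_bracket H X $$ (a, b) = eval_weight n (wt n a - wt n b) H * X $$ (a, b)"
proof -
  have Hc: "H \<in> carrier_mat (2*n+1) (2*n+1)" using H by (auto simp: cartan_def so_odd_def)
  have "(\<Sum>c\<le>2*n. H $$ (a, c) * X $$ (c, b)) = (\<Sum>c\<le>2*n. if c = a then eval_weight n (wt n a) H * X $$ (a, b) else 0)"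
    using ab by (intro sum.cong) (auto simp: cartan_entry[OF H])
  moreover have "(\<Sum>c\<le>2*n. X $$ (a, c) * H $$ (c, b)) = (\<Sum>c\<le>2*n. if c = b then eval_weight n (wt n b) H * X $$ (a, b) else 0)"
    using ab by (intro sum.cong) (auto simp: cartan_entry[OF H])
  ultimately show ?thesis using ab
    by (simp add: lie_bracket_entry[OF Hc X ab] eval_weight_def left_diff_distrib sum_subtractf)
qed

lemma wt_support: "a \<le> 2*n \<Longrightarrow> i \<notin> {1..n} \<Longrightarrow> wt n a i = 0"
  by (auto simp: wt_def eps_def)

text \<open>
  The matrix units are weight vectors for the adjoint action: a Cartan element \<open>H\<close> multiplies the entry
  with index \<open>(a, b)\<close> by the value of \<open>wt n a - wt n b\<close> at \<open>H\<close>.  Cartan elements with a single nonzero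
  coordinate separate the weights.
\<close>
lemma root_space_iff:
  assumes supp: "\<And>i. i \<notin> {1..n} \<Longrightarrow> \<alpha> i = 0"
  shows "X \<in> root_space (so_odd n) n \<alpha> \<longleftrightarrow> X \<in> so_odd n \<and>
    (\<forall>a\<le>2*n. \<forall>b\<le>2*n. X $$ (a, b) \<noteq> 0 \<longrightarrow> wt n a - wt n b = \<alpha>)"
proof (intro iffI conjI allI impI)
  assume h: "X \<in> root_space (so_odd n) n \<alpha>"
  then show X: "X \<in> so_odd n" by (simp add: root_space_def)
  note Xc = so_oddD(1)[OF X]
  fix a b assume ab: "a \<le> 2*n" "b \<le> 2*n" and nz: "X $$ (a, b) \<noteq> 0"
  show "wt n a - wt n b = \<alpha>"
  proof
    fix i
    show "(wt n a - wt n b) i = \<alpha> i"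
    proof (cases "i \<in> {1..n}")
      case True
      let ?H = "cartan_diag n (eps i)"
      have "lie_bracket ?H X $$ (a, b) = eval_weight n \<alpha> ?H * X $$ (a, b)"
        using h cartan_diag_in[of n "eps i"] Xc ab by (auto simp: root_space_def)
      then have "eval_weight n (wt n a - wt n b) ?H = eval_weight n \<alpha> ?H"
        using bracket_cartan_entry[OF cartan_diag_in Xc ab, of "eps i"] nz by simp
      moreover have "eval_weight n l ?H = l i" for l
      proof -
        have "eval_weight n l ?H = (\<Sum>j=1..n. eps i j * l j)"
          by (simp add: eval_weight_cartan_diag mult.commute)
        then show ?thesis using True by (simp add: eval_weight_wt_eps[simplified])
      qed
      ultimately show ?thesis by simp
    next
      case False
      then show ?thesis using supp wt_support ab by simp
    qed
  qed
next
  assume h: "X \<in> so_odd n \<and> (\<forall>a\<le>2*n. \<forall>b\<le>2*n. X $$ (a, b) \<noteq> 0 \<longrightarrow> wt n a - wt n b = \<alpha>)"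
  then have Xc: "X \<in> carrier_mat (2*n+1) (2*n+1)" by (simp add: so_odd_iff)
  have "lie_bracket H X = eval_weight n \<alpha> H \<cdot>\<^sub>m X" if H: "H \<in> cartan n" for H
  proof (rule eq_matI)
    have Hc: "H \<in> carrier_mat (2*n+1) (2*n+1)" using H by (auto simp: cartan_def so_odd_def)
    then show "dim_row (lie_bracket H X) = dim_row (eval_weight n \<alpha> H \<cdot>\<^sub>m X)"
      "dim_col (lie_bracket H X) = dim_col (eval_weight n \<alpha> H \<cdot>\<^sub>m X)" 
      using Xc by (auto simp: lie_bracket_def)
    fix a b assume "a < dim_row (eval_weight n \<alpha> H \<cdot>\<^sub>m X)" "b < dim_col (eval_weight n \<alpha> H \<cdot>\<^sub>m X)"
    then have ab: "a \<le> 2*n" "b \<le> 2*n" using Xc by auto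
    show "lie_bracket H X $$ (a, b) = (eval_weight n \<alpha> H \<cdot>\<^sub>m X) $$ (a, b)"
      using h ab Xc by (cases "X $$ (a, b) = 0") (simp_all add: bracket_cartan_entry[OF H Xc ab])
  qed
  then show "X \<in> root_space (so_odd n) n \<alpha>" using h by (auto simp: root_space_def)
qed

text \<open>
  These elements span the Lie algebra, and for \<open>b \<noteq> a, dual n a\<close> they are root vectors.  In
  particular \<open>so_unit n 0 i\<close> belongs to the root \<open>-\<epsilon>\<^sub>i\<close>.
\<close>
definition so_unit :: "nat \<Rightarrow> nat \<Rightarrow> nat \<Rightarrow> complex mat" where
  "so_unit n a b = mat (2*n+1) (2*n+1) (\<lambda>(i, j). (if i = a \<and> j = b then 1 else 0)
     - (if i = dual n b \<and> j = dual n a then 1 else 0))"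

lemma so_unit_carrier: "so_unit n a b \<in> carrier_mat (2*n+1) (2*n+1)"
  by (simp add: so_unit_def)

lemma so_unit_carrier_Suc [simp]: "so_unit n a b \<in> carrier_mat (Suc (2*n)) (Suc (2*n))"
  by (simp add: so_unit_def)

lemma so_unit_entry:
  "i \<le> 2*n \<Longrightarrow> j \<le> 2*n \<Longrightarrow> so_unit n a b $$ (i, j) =
     (if i = a \<and> j = b then 1 else 0) - (if i = dual n b \<and> j = dual n a then 1 else 0)"
  by (simp add: so_unit_def)

lemma so_unit_entry_0:
  assumes "i \<le> 2*n" "j \<le> 2*n" "\<not> (i = a \<and> j = b)" "\<not> (i = dual n b \<and> j = dual n a)"
  shows "so_unit n a b $$ (i, j) = 0"
  using assms by (simp only: so_unit_entry if_False diff_self)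

lemma so_unit_in [simp]: "a \<le> 2*n \<Longrightarrow> b \<le> 2*n \<Longrightarrow> so_unit n a b \<in> so_odd n"
proof -
  assume ab: "a \<le> 2*n" "b \<le> 2*n"
  have "so_unit n a b $$ (dual n q, dual n p) = - so_unit n a b $$ (p, q)" if "p \<le> 2*n" "q \<le> 2*n" for p q
  proof -
    have "dual n q = a \<longleftrightarrow> q = dual n a" "dual n p = b \<longleftrightarrow> p = dual n b"
      "dual n q = dual n b \<longleftrightarrow> q = b" "dual n p = dual n a \<longleftrightarrow> p = a"
      using ab that by (auto simp: dual_eq_iff)
    then show ?thesis using ab that by (simp add: so_unit_entry dual_le conj_commute)
  qed
  then show ?thesis by (auto simp: so_odd_iff)
qed

lemma sum_delta_left:
  fixes g :: "nat \<Rightarrow> complex"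
  shows "a \<le> m \<Longrightarrow> (\<Sum>k\<le>m. (if P \<and> k = a then 1 else 0) * g k) = (if P then g a else 0)"
  by (cases P) (simp_all add: if_distrib[of "\<lambda>x. x * _"] cong: if_cong)

lemma sum_delta_right:
  fixes g :: "nat \<Rightarrow> complex"
  shows "a \<le> m \<Longrightarrow> (\<Sum>k\<le>m. g k * (if k = a \<and> P then 1 else 0)) = (if P then g a else 0)"
  by (cases P) (simp_all add: if_distrib[of "\<lambda>x. _ * x"] cong: if_cong)

lemma bracket_so_unit_entry:
  assumes ab: "a \<le> 2*n" "b \<le> 2*n" and Y: "Y \<in> carrier_mat (2*n+1) (2*n+1)" and ij: "i \<le> 2*n" "j \<le> 2*n"
  shows "lie_bracket (so_unit n a b) Y $$ (i, j) =
     (if i = a then Y $$ (b, j) else 0) - (if i = dual n b then Y $$ (dual n a, j) else 0)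
     - ((if j = b then Y $$ (i, a) else 0) - (if j = dual n a then Y $$ (i, dual n b) else 0))"
  unfolding lie_bracket_entry[OF so_unit_carrier Y ij]
  using ab ij
  by (simp add: so_unit_entry left_diff_distrib right_diff_distrib sum_subtractf sum_delta_left sum_delta_right dual_le)

text \<open>
  With \<open>\<theta>\<close> the automorphism \<open>X \<mapsto> - G X\<^sup>T G\<close> of the matrix Lie algebra, \<open>so_unit n a b\<close> is
  \<open>E\<^sub>a\<^sub>b + \<theta>(E\<^sub>a\<^sub>b)\<close>, so the bracket is \<open>1 + \<theta>\<close> applied to \<open>[E\<^sub>a\<^sub>b, E\<^sub>c\<^sub>d + \<theta>(E\<^sub>c\<^sub>d)]\<close>; this accounts for the
  four terms.
\<close>
lemma bracket_so_unit:
  assumes le: "a \<le> 2*n" "b \<le> 2*n" "c \<le> 2*n" "d \<le> 2*n" and ij: "i \<le> 2*n" "j \<le> 2*n"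
  shows "lie_bracket (so_unit n a b) (so_unit n c d) $$ (i, j) =
     of_bool (b = c) * so_unit n a d $$ (i, j) - of_bool (d = a) * so_unit n c b $$ (i, j)
     - of_bool (b = dual n d) * so_unit n a (dual n c) $$ (i, j)
     + of_bool (a = dual n c) * so_unit n (dual n d) b $$ (i, j)"
proof -
  have ob: "(if P then x else 0) = of_bool P * x" for P and x :: complex
    by simp
  have ob2: "(if P \<and> Q then 1 else 0) = of_bool P * (of_bool Q :: complex)" for P Q
    by simp
  have sym: "dual n a = c \<longleftrightarrow> a = dual n c" "dual n a = dual n d \<longleftrightarrow> d = a"
    "dual n b = d \<longleftrightarrow> b = dual n d" "dual n b = dual n c \<longleftrightarrow> b = c"
    "a = d \<longleftrightarrow> d = a"
    using le by (metis dual_dual)+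
  have e: "so_unit n p q $$ (r, s) = of_bool (r = p) * of_bool (s = q) - of_bool (r = dual n q) * of_bool (s = dual n p)"
    if "r \<le> 2*n" "s \<le> 2*n" for p q r s
    using that by (simp only: so_unit_entry ob2)
  show ?thesis
    unfolding bracket_so_unit_entry[OF le(1,2) so_unit_carrier ij] ob
    using le ij by (simp only: e dual_le dual_dual sym) (simp only: algebra_simps)
qed

lemma eq_mat_soI:
  assumes "X \<in> carrier_mat (2*n+1) (2*n+1)" "Y \<in> carrier_mat (2*n+1) (2*n+1)"
    and "\<And>i j. i \<le> 2*n \<Longrightarrow> j \<le> 2*n \<Longrightarrow> X $$ (i, j) = Y $$ (i, j)"
  shows "X = Y"
  by (rule eq_matI) (use assms in auto)

lemma bracket_carrier [simp]:
  "X \<in> carrier_mat d d \<Longrightarrow> Y \<in> carrier_mat d d \<Longrightarrow> lie_bracket X Y \<in> carrier_mat d d"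
  unfolding lie_bracket_def by (intro minus_carrier_mat mult_carrier_mat)

lemma wt_coord:
  assumes "1 \<le> i" "i \<le> n" "a \<le> 2*n"
  shows "wt n a i = (if a = i then 1 else if a = n + i then -1 else 0)"
  using assms by (auto simp: wt_def eps_def)

lemma wt_inj:
  assumes "a \<le> 2*n" "b \<le> 2*n" "wt n a = wt n b"
  shows "a = b"
proof (rule ccontr)
  assume ne: "a \<noteq> b"
  have *: False if "x \<le> 2*n" "y \<le> 2*n" "wt n x = wt n y" "x \<noteq> 0" "x \<noteq> y" for x y
  proof -
    define i where "i = (if x \<le> n then x else x - n)"
    have i: "1 \<le> i" "i \<le> n" "x = i \<or> x = n + i" using that by (auto simp: i_def)
    have "wt n x i = wt n y i" using that by simp
    then show False using that(1,2,5) i by (auto simp: wt_coord split: if_splits)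
  qed
  show False using *[of a b] *[of b a] assms ne by auto
qed

text \<open>
  Look at the coordinate in which the weight of \<open>a\<close> does not vanish.  The conditions on \<open>b\<close> exclude the
  sums \<open>2\<epsilon>\<^sub>i\<close> and \<open>0\<close>.
\<close>
lemma wt_sum_unique:
  assumes "a \<le> 2*n" "b \<le> 2*n" "c \<le> 2*n" "d \<le> 2*n" "a \<noteq> 0" "a \<noteq> b" "a \<noteq> dual n b"
    and eq: "wt n a + wt n b = wt n c + wt n d"
  shows "(c = a \<and> d = b) \<or> (c = b \<and> d = a)"
proof -
  define i where "i = (if a \<le> n then a else a - n)"
  have i: "1 \<le> i" "i \<le> n" "a = i \<or> a = n + i" using assms by (auto simp: i_def)
  have b: "wt n b i = 0"
    using i assms by (auto simp: wt_coord dual_def split: if_splits)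
  have "wt n a i + wt n b i = wt n c i + wt n d i" using fun_cong[OF eq, of i] by simp
  then have "wt n a i = wt n c i + wt n d i" using b by simp
  then have "c = a \<or> d = a"
    using i assms by (auto simp: wt_coord split: if_splits)
  then show ?thesis
  proof
    assume "c = a"
    then have "wt n b = wt n d" using eq by simp
    then show ?thesis using wt_inj assms \<open>c = a\<close> by auto
  next
    assume "d = a"
    then have "wt n b = wt n c" using eq by (simp add: add.commute)
    then show ?thesis using wt_inj assms \<open>d = a\<close> by auto
  qed
qed

lemma wt_diff_unique:
  assumes le: "a \<le> 2*n" "b \<le> 2*n" "c \<le> 2*n" "d \<le> 2*n" and ne: "a \<noteq> b" "a \<noteq> dual n b"
    and eq: "wt n c - wt n d = wt n a - wt n b"
  shows "(c = a \<and> d = b) \<or> (c = dual n b \<and> d = dual n a)"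
proof -
  have e: "wt n a + wt n (dual n b) = wt n c + wt n (dual n d)"
    using eq le by (simp add: wt_dual algebra_simps)
  show ?thesis
  proof (cases "a = 0")
    case False
    have "(c = a \<and> dual n d = dual n b) \<or> (c = dual n b \<and> dual n d = a)"
      by (rule wt_sum_unique) (use le ne e False in \<open>auto simp: dual_le\<close>)
    then show ?thesis using le by (metis dual_dual)
  next
    case True
    then have b: "dual n b \<noteq> 0" using ne le by (auto simp: dual_def split: if_splits)
    have "(c = dual n b \<and> dual n d = a) \<or> (c = a \<and> dual n d = dual n b)"
      by (rule wt_sum_unique) (use le ne e b in \<open>auto simp: dual_le add.commute dual_eq_iff\<close>)
    then show ?thesis using le by (metis dual_dual)
  qed
qed

lemma so_unit_root_space:
  assumes "a \<le> 2*n" "b \<le> 2*n"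
  shows "so_unit n a b \<in> root_space (so_odd n) n (wt n a - wt n b)"
proof -
  have supp: "(wt n a - wt n b) i = 0" if "i \<notin> {1..n}" for i
    using that wt_support assms by simp
  have "wt n p - wt n q = wt n a - wt n b" if "p \<le> 2*n" "q \<le> 2*n" "so_unit n a b $$ (p, q) \<noteq> 0" for p q
  proof -
    have "(p = a \<and> q = b) \<or> (p = dual n b \<and> q = dual n a)"
      using that so_unit_entry_0[of p n q a b] by blast
    then show ?thesis using wt_dual[OF assms(1)] wt_dual[OF assms(2)] by (elim disjE conjE) simp_all
  qed
  then show ?thesis
    using root_space_iff[of n "wt n a - wt n b" "so_unit n a b", OF supp] so_unit_in[OF assms] by blast
qed

text \<open>
  Root spaces are one-dimensional.  This makes the arbitrary root vectors of the theorem multiples of the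
  explicit ones.
\<close>
lemma root_space_unit:
  assumes X: "X \<in> root_space (so_odd n) n (wt n a - wt n b)"
    and ab: "a \<le> 2*n" "b \<le> 2*n" "a \<noteq> b" "a \<noteq> dual n b"
  shows "X = X $$ (a, b) \<cdot>\<^sub>m so_unit n a b"
proof -
  have supp: "(wt n a - wt n b) i = 0" if "i \<notin> {1..n}" for i
    using that wt_support ab by simp
  have X': "X \<in> so_odd n" "\<And>c d. c \<le> 2*n \<Longrightarrow> d \<le> 2*n \<Longrightarrow> X $$ (c, d) \<noteq> 0 \<Longrightarrow> wt n c - wt n d = wt n a - wt n b"
    using X root_space_iff[of n "wt n a - wt n b" X, OF supp] by blast+
  note s = so_oddD[OF X'(1)]
  show ?thesis
  proof (rule eq_mat_soI)
    fix c d assume cd: "c \<le> 2*n" "d \<le> 2*n"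
    have r: "(X $$ (a, b) \<cdot>\<^sub>m so_unit n a b) $$ (c, d) = X $$ (a, b) * so_unit n a b $$ (c, d)"
      using cd by (intro index_smult_mat(1)) (auto simp: so_unit_def)
    show "X $$ (c, d) = (X $$ (a, b) \<cdot>\<^sub>m so_unit n a b) $$ (c, d)"
    proof -
      consider "c = a" "d = b" | "c = dual n b" "d = dual n a"
        | "\<not> ((c = a \<and> d = b) \<or> (c = dual n b \<and> d = dual n a))" by blast
      then show ?thesis
      proof cases
      case 1
      then show ?thesis using r ab by (simp add: so_unit_entry)
    next
      case 2
      have "so_unit n a b $$ (dual n b, dual n a) = -1"
        using ab(4) so_unit_in[OF ab(1,2)] so_oddD(2)[OF so_unit_in[OF ab(1,2)], OF ab(1,2)] 
        by (simp add: so_unit_entry ab)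
      then show ?thesis using r 2 s(2)[OF ab(1,2)] by simp
    next
      case False: 3
      then have "X $$ (c, d) = 0" using X'(2)[OF cd] wt_diff_unique[OF ab(1,2) cd ab(3,4)] by blast
      moreover have "so_unit n a b $$ (c, d) = 0" using False cd by (intro so_unit_entry_0) auto
      ultimately show ?thesis using r by simp
    qed
    qed
  qed (use s in auto)
qed

lemma adj_so_odd:
  assumes "X \<in> so_odd n" shows "adj X \<in> so_odd n"
proof -
  note s = so_oddD[OF assms]
  show ?thesis unfolding so_odd_iff
  proof (intro conjI allI impI)
    fix a b assume ab: "a \<le> 2*n" "b \<le> 2*n"
    have "adj X $$ (p, q) = cnj (X $$ (q, p))" if "p \<le> 2*n" "q \<le> 2*n" for p q
      using s(1) that by (intro adj_index) auto
    then show "adj X $$ (dual n b, dual n a) = - adj X $$ (a, b)"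
      using ab s(2)[of b a] by (simp add: dual_le)
  qed (use s in auto)
qed

lemma adj_so_unit:
  assumes "a \<le> 2*n" "b \<le> 2*n" shows "adj (so_unit n a b) = so_unit n b a"
proof (rule eq_mat_soI)
  have cnj_if: "cnj (if P then 1 else 0) = (if P then 1 else 0)" for P by simp
  fix i j assume "i \<le> 2*n" "j \<le> 2*n"
  then show "adj (so_unit n a b) $$ (i, j) = so_unit n b a $$ (i, j)"
    by (simp add: so_unit_def conj_commute cnj_if split del: if_split) 
qed (auto simp: so_unit_def)

lemma so_unit_dual:
  assumes "a \<le> 2*n" "b \<le> 2*n" shows "so_unit n (dual n b) (dual n a) = (-1) \<cdot>\<^sub>m so_unit n a b"
proof (rule eq_mat_soI)
  fix i j assume "i \<le> 2*n" "j \<le> 2*n"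
  then show "so_unit n (dual n b) (dual n a) $$ (i, j) = ((-1) \<cdot>\<^sub>m so_unit n a b) $$ (i, j)"
    using assms by (simp add: so_unit_def split del: if_split) 
qed (auto simp: so_unit_def)

definition pos_list_D :: "nat \<Rightarrow> weight list" where
  "pos_list_D n =
     concat (map (\<lambda>k. map (\<lambda>i. eps i - eps k) [1..<k] @ map (\<lambda>i. eps i + eps k) [1..<k]) [2..<Suc n])"

lemma pos_roots_eq: "pos_roots n = pos_list_D n @ map eps [1..<Suc n]"
  by (simp only: pos_roots_def pos_list_D_def)

lemma set_pos_list_D: "set (pos_list_D n) = pos_roots_D n"
proof -
  have "set (pos_list_D n) = (\<Union>k\<in>{2..n}. (\<lambda>i. eps i - eps k) ` {1..<k} \<union> (\<lambda>i. eps i + eps k) ` {1..<k})"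
    unfolding pos_list_D_def set_append set_concat set_map set_upt atLeastLessThanSuc_atLeastAtMost
    by (simp add: image_image)
  also have "(\<Union>k\<in>{2..n}. (\<lambda>i. eps i - eps k) ` {1..<k} \<union> (\<lambda>i. eps i + eps k) ` {1..<k}) = pos_roots_D n"
  proof (intro equalityI subsetI)
    fix x assume "x \<in> pos_roots_D n"
    then obtain i j where "1 \<le> i" "i < j" "j \<le> n" "x = eps i - eps j \<or> x = eps i + eps j"
      unfolding pos_roots_D_def by blast
    then have "j \<in> {2..n}" "i \<in> {1..<j}" "x = eps i - eps j \<or> x = eps i + eps j" by auto
    then show "x \<in> (\<Union>k\<in>{2..n}. (\<lambda>i. eps i - eps k) ` {1..<k} \<union> (\<lambda>i. eps i + eps k) ` {1..<k})"
      by blast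
  qed (unfold pos_roots_D_def, fastforce)
  finally show ?thesis .
qed

lemma set_pos_roots: "set (pos_roots n) = pos_roots_D n \<union> eps ` {1..n}"
  unfolding pos_roots_eq set_append set_map set_upt atLeastLessThanSuc_atLeastAtMost set_pos_list_D ..

text \<open>
  A functional that is positive on the positive roots and decreasing along the basis vectors \<open>e\<^sub>1, \<dots>, e\<^sub>n\<close>;
  it replaces a case distinction over the roots.
\<close>
definition height :: "nat \<Rightarrow> weight \<Rightarrow> real" where
  "height n l = (\<Sum>i=1..n. Re (l i) * real (n + 1 - i))"

lemma height_add: "height n (l + m) = height n l + height n m"
  by (simp add: height_def distrib_right sum.distrib)

lemma height_diff: "height n (l - m) = height n l - height n m"
  by (simp add: height_def left_diff_distrib sum_subtractf)

lemma height_minus: "height n (- l) = - height n l"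
  by (simp add: height_def sum_negf)

lemma height_eps: "1 \<le> i \<Longrightarrow> i \<le> n \<Longrightarrow> height n (eps i) = real (n + 1 - i)"
proof -
  assume i: "1 \<le> i" "i \<le> n"
  have "height n (eps i) = (\<Sum>j=1..n. if j = i then real (n + 1 - i) else 0)"
    unfolding height_def by (rule sum.cong) (auto simp: eps_def)
  then show ?thesis using i by simp
qed

lemma height_pos_root: "\<alpha> \<in> set (pos_roots n) \<Longrightarrow> height n \<alpha> > 0"
  by (auto simp: set_pos_roots pos_roots_D_def height_add height_diff height_eps)

lemma pos_root_support: "\<alpha> \<in> set (pos_roots n) \<Longrightarrow> i \<notin> {1..n} \<Longrightarrow> \<alpha> i = 0"
  by (auto simp: set_pos_roots pos_roots_D_def eps_def)

lemma height_wt: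
  assumes "a \<le> 2*n"
  shows "height n (wt n a) = (if a = 0 then 0 else if a \<le> n then real (n + 1 - a) else - real (2*n + 1 - a))"
proof -
  consider "a = 0" | "1 \<le> a" "a \<le> n" | "n < a" by linarith
  then show ?thesis
  proof cases
    case 3
    then have "1 \<le> a - n" "a - n \<le> n" "n + 1 - (a - n) = 2*n + 1 - a" using assms by auto
    then show ?thesis using 3 height_eps[of "a - n" n] by (simp add: wt_def height_minus)
  qed (auto simp: wt_def height_eps, simp add: height_def)
qed

text \<open>
  The weight of the row index is higher than that of the column index.
\<close>
lemma pos_root_space_upper:
  assumes "\<alpha> \<in> set (pos_roots n)" "X \<in> root_space (so_odd n) n \<alpha>" "X $$ (a, b) \<noteq> 0"
    and ab: "a \<le> 2*n" "b \<le> n"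
  shows "1 \<le> a" "a \<le> n" "b \<noteq> 0 \<Longrightarrow> a < b"
proof -
  have b: "b \<le> 2*n" using ab by simp
  have "wt n a - wt n b = \<alpha>"
    using assms(2,3) ab b root_space_iff[of n \<alpha> X, OF pos_root_support[OF assms(1)]] by simp
  then have "height n (wt n a) > height n (wt n b)"
    using height_pos_root[OF assms(1)] by (metis height_diff diff_gt_0_iff_gt)
  then show "1 \<le> a" "a \<le> n" "b \<noteq> 0 \<Longrightarrow> a < b"
    using ab b by (auto simp: height_wt split: if_splits)
qed

lemma pos_roots_D_cases:
  assumes "\<alpha> \<in> pos_roots_D n"
  obtains i j where "1 \<le> i" "i < j" "j \<le> n" "\<alpha> = wt n i - wt n j"
  | i j where "1 \<le> i" "i < j" "j \<le> n" "\<alpha> = wt n i - wt n (n + j)"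
proof -
  obtain i j where ij: "1 \<le> i" "i < j" "j \<le> n" "\<alpha> = eps i - eps j \<or> \<alpha> = eps i + eps j"
    using assms unfolding pos_roots_D_def by blast
  then have "\<alpha> = wt n i - wt n j \<or> \<alpha> = wt n i - wt n (n + j)" by (auto simp: wt_def)
  then show thesis using ij that by blast
qed

lemma eps_wt: "1 \<le> i \<Longrightarrow> i \<le> n \<Longrightarrow> eps i = wt n i - wt n 0"
  by (auto simp: wt_def)

section \<open>Representations\<close>

lemma rep_carrier: "representation n d \<rho> \<Longrightarrow> X \<in> so_odd n \<Longrightarrow> \<rho> X \<in> carrier_mat d d"
  by (simp add: representation_def)

lemma rep_add: "representation n d \<rho> \<Longrightarrow> X \<in> so_odd n \<Longrightarrow> Y \<in> so_odd n \<Longrightarrow> \<rho> (X + Y) = \<rho> X + \<rho> Y"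
  by (simp add: representation_def)

lemma rep_smult: "representation n d \<rho> \<Longrightarrow> X \<in> so_odd n \<Longrightarrow> \<rho> (c \<cdot>\<^sub>m X) = c \<cdot>\<^sub>m \<rho> X"
  by (simp add: representation_def)

lemma rep_bracket: "representation n d \<rho> \<Longrightarrow> X \<in> so_odd n \<Longrightarrow> Y \<in> so_odd n \<Longrightarrow>
    \<rho> (lie_bracket X Y) = \<rho> X * \<rho> Y - \<rho> Y * \<rho> X"
  by (simp add: representation_def lie_bracket_def)

lemma smult_mat_vec: "A \<in> carrier_mat m k \<Longrightarrow> x \<in> carrier_vec k \<Longrightarrow> (c \<cdot>\<^sub>m A) *\<^sub>v x = c \<cdot>\<^sub>v (A *\<^sub>v x)"
  for A :: "complex mat"
  by (rule eq_vecI) auto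

lemma rep_commute:
  assumes "representation n d \<rho>" "X \<in> so_odd n" "Y \<in> so_odd n" "x \<in> carrier_vec d"
  shows "\<rho> X *\<^sub>v (\<rho> Y *\<^sub>v x) = \<rho> Y *\<^sub>v (\<rho> X *\<^sub>v x) + \<rho> (lie_bracket X Y) *\<^sub>v x"
proof -
  have c: "\<rho> X \<in> carrier_mat d d" "\<rho> Y \<in> carrier_mat d d" using assms rep_carrier by auto
  have "\<rho> (lie_bracket X Y) *\<^sub>v x = (\<rho> X * \<rho> Y) *\<^sub>v x - (\<rho> Y * \<rho> X) *\<^sub>v x"
    using c assms by (subst rep_bracket[OF assms(1-3)], subst minus_mult_distrib_mat_vec[of _ d d]) auto
  also have "\<dots> = \<rho> X *\<^sub>v (\<rho> Y *\<^sub>v x) - \<rho> Y *\<^sub>v (\<rho> X *\<^sub>v x)"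
    using c assms by simp
  finally show ?thesis using c assms by auto
qed

lemma rep_zero:
  assumes "representation n d \<rho>"
  shows "\<rho> (0\<^sub>m (2*n+1) (2*n+1)) = 0\<^sub>m d d"
proof -
  have "\<rho> (0 \<cdot>\<^sub>m 0\<^sub>m (2*n+1) (2*n+1)) = 0 \<cdot>\<^sub>m \<rho> (0\<^sub>m (2*n+1) (2*n+1))"
    using assms so_odd_zero by (rule rep_smult)
  moreover have "0 \<cdot>\<^sub>m 0\<^sub>m (2*n+1) (2*n+1) = (0\<^sub>m (2*n+1) (2*n+1) :: complex mat)" by simp
  moreover have "0 \<cdot>\<^sub>m A = 0\<^sub>m d d" if "A \<in> carrier_mat d d" for A :: "complex mat"
    by (rule eq_matI) (use that in auto)
  ultimately show ?thesis using rep_carrier[OF assms so_odd_zero] by metis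
qed

lemma zero_mat_vec: "x \<in> carrier_vec k \<Longrightarrow> 0\<^sub>m m k *\<^sub>v x = 0\<^sub>v m" for x :: "complex vec"
  by (rule eq_vecI) auto

section \<open>Monomials in the short negative roots\<close>

text \<open>
  Monomials in the root vectors for \<open>-\<epsilon>\<^sub>1, \<dots>, -\<epsilon>\<^sub>n\<close> are written as words, since the arguments below move
  single letters.
\<close>
definition yword :: "nat \<Rightarrow> (complex mat \<Rightarrow> complex mat) \<Rightarrow> nat list \<Rightarrow> complex vec \<Rightarrow> complex vec" where
  "yword n \<rho> ws x = foldr (\<lambda>i u. \<rho> (so_unit n 0 i) *\<^sub>v u) ws x"

lemma yword_simps [simp]:
  "yword n \<rho> [] x = x" "yword n \<rho> (i # ws) x = \<rho> (so_unit n 0 i) *\<^sub>v yword n \<rho> ws x"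
  "yword n \<rho> (us @ ws) x = yword n \<rho> us (yword n \<rho> ws x)"
  by (simp_all add: yword_def)

locale so_rep =
  fixes n d :: nat and \<rho> :: "complex mat \<Rightarrow> complex mat"
  assumes rep: "representation n d \<rho>"
begin

abbreviation "y i \<equiv> \<rho> (so_unit n 0 i)"

lemma y_carrier [simp]: "i \<le> 2*n \<Longrightarrow> y i \<in> carrier_mat d d"
  by (rule rep_carrier[OF rep]) simp

lemma y_vec [simp]: "i \<le> 2*n \<Longrightarrow> x \<in> carrier_vec d \<Longrightarrow> y i *\<^sub>v x \<in> carrier_vec d"
  by (rule mult_mat_vec_carrier[OF y_carrier])

lemma yword_carrier [simp]:
  "set ws \<subseteq> {1..n} \<Longrightarrow> x \<in> carrier_vec d \<Longrightarrow> yword n \<rho> ws x \<in> carrier_vec d"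
  by (induction ws) auto

lemma yword_add:
  assumes "set ws \<subseteq> {1..n}" "x \<in> carrier_vec d" "x' \<in> carrier_vec d"
  shows "yword n \<rho> ws (x + x') = yword n \<rho> ws x + yword n \<rho> ws x'"
  using assms(1)
proof (induction ws)
  case (Cons i ws)
  then have "y i \<in> carrier_mat d d" by simp
  then show ?case using Cons assms by (simp add: mult_add_distrib_mat_vec[of _ d d])
qed simp

lemma yword_smult:
  assumes "set ws \<subseteq> {1..n}" "x \<in> carrier_vec d"
  shows "yword n \<rho> ws (c \<cdot>\<^sub>v x) = c \<cdot>\<^sub>v yword n \<rho> ws x"
  using assms(1)
proof (induction ws)
  case (Cons i ws)
  then have "y i \<in> carrier_mat d d" by simp
  then show ?case using Cons assms by (simp add: mult_mat_vec[of _ d d])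
qed simp

lemma yword_zero:
  assumes "set ws \<subseteq> {1..n}"
  shows "yword n \<rho> ws (0\<^sub>v d) = 0\<^sub>v d"
proof -
  have z: "0 \<cdot>\<^sub>v x = 0\<^sub>v d" if "x \<in> carrier_vec d" for x :: "complex vec"
    by (rule eq_vecI) (use that in auto)
  have "yword n \<rho> ws (0\<^sub>v d) = 0 \<cdot>\<^sub>v yword n \<rho> ws (0\<^sub>v d)"
    using yword_smult[OF assms, of "0\<^sub>v d" 0] z[of "0\<^sub>v d"] by simp
  then show ?thesis using z[of "yword n \<rho> ws (0\<^sub>v d)"] assms by simp
qed

lemma commute_vec:
  assumes "X \<in> so_odd n" "Y \<in> so_odd n" "x \<in> carrier_vec d" "lie_bracket X Y = 0\<^sub>m (2*n+1) (2*n+1)"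
  shows "\<rho> X *\<^sub>v (\<rho> Y *\<^sub>v x) = \<rho> Y *\<^sub>v (\<rho> X *\<^sub>v x)"
proof -
  have "\<rho> Y *\<^sub>v (\<rho> X *\<^sub>v x) \<in> carrier_vec d"
    using rep_carrier[OF rep] assms by (meson mult_mat_vec_carrier)
  then show ?thesis
    using rep_commute[OF rep assms(1-3)] assms(3) unfolding assms(4) rep_zero[OF rep]
    by (simp add: zero_mat_vec)
qed

lemma commute_yword:
  assumes Z: "Z \<in> so_odd n" and ws: "set ws \<subseteq> {1..n}" and x: "x \<in> carrier_vec d"
    and br: "\<And>k. k \<in> set ws \<Longrightarrow> lie_bracket Z (so_unit n 0 k) = 0\<^sub>m (2*n+1) (2*n+1)"
  shows "\<rho> Z *\<^sub>v yword n \<rho> ws x = yword n \<rho> ws (\<rho> Z *\<^sub>v x)"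
  using ws br
proof (induction ws)
  case (Cons i ws)
  have "\<rho> Z *\<^sub>v (y i *\<^sub>v yword n \<rho> ws x) = y i *\<^sub>v (\<rho> Z *\<^sub>v yword n \<rho> ws x)"
    using Cons x Z by (intro commute_vec) auto
  then show ?case using Cons by simp
qed simp

end

lemma bracket_short_short:
  assumes "i \<in> {1..n}" "j \<in> {1..n}" "i \<noteq> j"
  shows "lie_bracket (so_unit n 0 i) (so_unit n 0 j) = so_unit n (n + j) i"
proof (rule eq_mat_soI)
  fix a b assume ab: "a \<le> 2*n" "b \<le> 2*n"
  have "dual n j = n + j" "dual n 0 = 0" using assms by (auto simp: dual_def)
  then show "lie_bracket (so_unit n 0 i) (so_unit n 0 j) $$ (a, b) = so_unit n (n + j) i $$ (a, b)"
    using assms by (subst bracket_so_unit[OF _ _ _ _ ab]) auto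
qed (auto intro: so_unit_carrier)

lemma bracket_long_short:
  assumes "i \<in> {1..n}" "j \<in> {1..n}" "k \<in> {1..n}"
  shows "lie_bracket (so_unit n (n + j) i) (so_unit n 0 k) = 0\<^sub>m (2*n+1) (2*n+1)"
proof (rule eq_mat_soI)
  fix a b assume ab: "a \<le> 2*n" "b \<le> 2*n"
  have "dual n k = n + k" "dual n 0 = 0" using assms by (auto simp: dual_def)
  then show "lie_bracket (so_unit n (n + j) i) (so_unit n 0 k) $$ (a, b) = 0\<^sub>m (2*n+1) (2*n+1) $$ (a, b)"
    using assms ab by (subst bracket_so_unit[OF _ _ _ _ ab]) auto
qed (auto intro: so_unit_carrier)

lemma bracket_lower_short:
  assumes "k \<in> {1..n}" "l \<in> {1..n}" "i \<in> {1..n}"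
  shows "lie_bracket (so_unit n l k) (so_unit n 0 i) =
    (if i = l then (-1) \<cdot>\<^sub>m so_unit n 0 k else 0\<^sub>m (2*n+1) (2*n+1))"
proof (rule eq_mat_soI)
  fix a b assume ab: "a \<le> 2*n" "b \<le> 2*n"
  have d: "dual n i = n + i" "dual n 0 = 0" using assms by (auto simp: dual_def)
  have s: "((-1) \<cdot>\<^sub>m so_unit n 0 k) $$ (a, b) = - so_unit n 0 k $$ (a, b)"
    using ab by (subst index_smult_mat) (auto simp: so_unit_def)
  show "lie_bracket (so_unit n l k) (so_unit n 0 i) $$ (a, b) =
    (if i = l then (-1) \<cdot>\<^sub>m so_unit n 0 k else 0\<^sub>m (2*n+1) (2*n+1)) $$ (a, b)"
    using assms ab d s by (subst bracket_so_unit[OF _ _ _ _ ab]) auto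
qed (auto intro: so_unit_carrier)

section \<open>Forms killing the image of the negative roots of \<open>D\<^sub>n\<close>\<close>

text \<open>
  The infinitesimal form of invariance under the unipotent group; see \<open>invariant_forms_iff\<close>.
\<close>
definition annihilates_D :: "nat \<Rightarrow> nat \<Rightarrow> (complex mat \<Rightarrow> complex mat) \<Rightarrow> complex vec \<Rightarrow> bool" where
  "annihilates_D n d \<rho> w \<longleftrightarrow> w \<in> carrier_vec d \<and>
     (\<forall>\<alpha>\<in>pos_roots_D n. \<forall>X\<in>root_space (so_odd n) n (- \<alpha>). \<forall>x\<in>carrier_vec d. w \<bullet> (\<rho> X *\<^sub>v x) = 0)"

lemma annihilates_unit:
  assumes "annihilates_D n d \<rho> w" "x \<in> carrier_vec d" "i \<in> {1..n}" "j \<in> {1..n}"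
  shows "i < j \<Longrightarrow> w \<bullet> (\<rho> (so_unit n j i) *\<^sub>v x) = 0"
    and "i \<noteq> j \<Longrightarrow> w \<bullet> (\<rho> (so_unit n (n + j) i) *\<^sub>v x) = 0"
proof -
  assume "i < j"
  moreover have "1 \<le> i" "j \<le> n" using assms by auto
  ultimately have "eps i - eps j \<in> pos_roots_D n" unfolding pos_roots_D_def by blast
  moreover have "- (eps i - eps j) = wt n j - wt n i" using assms by (auto simp: wt_def)
  ultimately show "w \<bullet> (\<rho> (so_unit n j i) *\<^sub>v x) = 0"
    using assms so_unit_root_space[of j n i] unfolding annihilates_D_def by auto
next
  assume ne: "i \<noteq> j"
  have r: "eps p + eps q \<in> pos_roots_D n" if "p < q" "p \<in> {1..n}" "q \<in> {1..n}" for p q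
  proof -
    have "1 \<le> p" "q \<le> n" using that by auto
    then show ?thesis using that(1) unfolding pos_roots_D_def by blast
  qed
  have "eps i + eps j \<in> pos_roots_D n"
    using r[of i j] r[of j i] ne assms(3,4) by (cases "i < j") (simp_all add: add.commute)
  moreover have "- (eps i + eps j) = wt n (n + j) - wt n i" using assms by (auto simp: wt_def)
  ultimately show "w \<bullet> (\<rho> (so_unit n (n + j) i) *\<^sub>v x) = 0"
    using assms so_unit_root_space[of "n + j" n i] unfolding annihilates_D_def by auto
qed

context so_rep
begin

text \<open>
  The commutator of the two letters is a root vector for \<open>-\<epsilon>\<^sub>i - \<epsilon>\<^sub>j\<close>.  It commutes with all letters, so it
  can be moved to the left of \<open>A\<close>, where the form kills it.
\<close>
lemma annihilates_swap:
  assumes w: "annihilates_D n d \<rho> w" and A: "set A \<subseteq> {1..n}" and ij: "i \<in> {1..n}" "j \<in> {1..n}" 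
    and x: "x \<in> carrier_vec d"
  shows "w \<bullet> yword n \<rho> A (y i *\<^sub>v (y j *\<^sub>v x)) = w \<bullet> yword n \<rho> A (y j *\<^sub>v (y i *\<^sub>v x))"
proof (cases "i = j")
  case False
  let ?z = "\<rho> (so_unit n (n + j) i)"
  have so: "so_unit n (n + j) i \<in> so_odd n" "so_unit n 0 i \<in> so_odd n" "so_unit n 0 j \<in> so_odd n" 
    using ij by auto
  have wc: "w \<in> carrier_vec d" using w by (simp add: annihilates_D_def)
  have c: "y j *\<^sub>v (y i *\<^sub>v x) \<in> carrier_vec d" "?z *\<^sub>v x \<in> carrier_vec d"
    using rep_carrier[OF rep] so x by (meson mult_mat_vec_carrier)+
  have "y i *\<^sub>v (y j *\<^sub>v x) = y j *\<^sub>v (y i *\<^sub>v x) + ?z *\<^sub>v x"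
    using rep_commute[OF rep so(2,3) x] bracket_short_short[OF ij False] by simp
  then have "yword n \<rho> A (y i *\<^sub>v (y j *\<^sub>v x)) = yword n \<rho> A (y j *\<^sub>v (y i *\<^sub>v x)) + yword n \<rho> A (?z *\<^sub>v x)"
    using yword_add[OF A c] by simp
  moreover have "yword n \<rho> A (?z *\<^sub>v x) = ?z *\<^sub>v yword n \<rho> A x"
    by (rule commute_yword[symmetric]) (use so A x ij bracket_long_short in auto)
  moreover have "w \<bullet> (?z *\<^sub>v yword n \<rho> A x) = 0"
    using annihilates_unit(2)[OF w _ ij False] A x by simp
  moreover have "yword n \<rho> A (y j *\<^sub>v (y i *\<^sub>v x)) \<in> carrier_vec d" "yword n \<rho> A (?z *\<^sub>v x) \<in> carrier_vec d"
    using A c by auto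
  ultimately show ?thesis using wc by (simp add: scalar_prod_add_distrib[of _ d])
qed simp

lemma annihilates_move:
  assumes w: "annihilates_D n d \<rho> w" and "i \<in> {1..n}" and x: "x \<in> carrier_vec d"
    and "set A \<subseteq> {1..n}" "set a \<subseteq> {1..n}" "set b \<subseteq> {1..n}"
  shows "w \<bullet> yword n \<rho> (A @ a @ i # b) x = w \<bullet> yword n \<rho> (A @ i # a @ b) x"
  using assms(4,5)
proof (induction a arbitrary: A)
  case (Cons j a)
  have "w \<bullet> yword n \<rho> (A @ (j # a) @ i # b) x = w \<bullet> yword n \<rho> ((A @ [j]) @ a @ i # b) x" by simp
  also have "\<dots> = w \<bullet> yword n \<rho> ((A @ [j]) @ i # a @ b) x"
    using Cons.prems by (intro Cons.IH) auto
  also have "\<dots> = w \<bullet> yword n \<rho> A (y j *\<^sub>v (y i *\<^sub>v yword n \<rho> (a @ b) x))" by simp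
  also have "\<dots> = w \<bullet> yword n \<rho> A (y i *\<^sub>v (y j *\<^sub>v yword n \<rho> (a @ b) x))"
    using Cons.prems assms by (intro annihilates_swap) auto
  finally show ?case by simp
qed simp

lemma annihilates_mset:
  assumes w: "annihilates_D n d \<rho> w" and x: "x \<in> carrier_vec d"
    and "set A \<subseteq> {1..n}" "set us \<subseteq> {1..n}" "mset us = mset ws"
  shows "w \<bullet> yword n \<rho> (A @ us) x = w \<bullet> yword n \<rho> (A @ ws) x"
  using assms(3-5)
proof (induction us arbitrary: A ws)
  case (Cons i us)
  have "i \<in> set ws" using Cons.prems(3) by (metis list.set_intros(1) mset_eq_setD)
  then obtain a b where ws: "ws = a @ i # b" by (meson split_list)
  have s: "set ws \<subseteq> {1..n}" using Cons.prems by (metis mset_eq_setD)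
  have "w \<bullet> yword n \<rho> (A @ i # us) x = w \<bullet> yword n \<rho> ((A @ [i]) @ us) x" by simp
  also have "\<dots> = w \<bullet> yword n \<rho> ((A @ [i]) @ (a @ b)) x"
    using Cons.prems ws by (intro Cons.IH) auto
  also have "\<dots> = w \<bullet> yword n \<rho> (A @ i # a @ b) x" by simp
  also have "\<dots> = w \<bullet> yword n \<rho> (A @ a @ i # b) x"
    using Cons.prems s ws by (intro annihilates_move[symmetric] w x) auto
  finally show ?case using ws by simp
qed simp

text \<open>
  Let \<open>f\<close> be the root vector for \<open>-(\<epsilon>\<^sub>k - \<epsilon>\<^sub>k\<^sub>+\<^sub>1)\<close>.  Its commutator with the letter \<open>Suc k\<close> is minus the letter
  \<open>k\<close>, it commutes with all other letters, and the form kills its image.  Moving \<open>f\<close> to the far left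
  thus replaces each of the \<open>q\<close> letters \<open>Suc k\<close> in turn by \<open>k\<close>.
\<close>
lemma lowering_step:
  assumes w: "annihilates_D n d \<rho> w" and k: "1 \<le> k" "Suc k \<le> n"
    and A: "set A \<subseteq> {1..n} - {Suc k}" and x: "x \<in> carrier_vec d"
  shows "w \<bullet> yword n \<rho> (A @ replicate q (Suc k)) (\<rho> (so_unit n (Suc k) k) *\<^sub>v x) =
    of_nat q * (w \<bullet> yword n \<rho> (A @ k # replicate (q - 1) (Suc k)) x)"
  using x
proof (induction q arbitrary: x)
  case 0
  have "yword n \<rho> A (\<rho> (so_unit n (Suc k) k) *\<^sub>v x) = \<rho> (so_unit n (Suc k) k) *\<^sub>v yword n \<rho> A x"
    by (rule commute_yword[symmetric]) (use k A 0 in \<open>auto simp: bracket_lower_short subset_iff\<close>)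
  moreover have "set A \<subseteq> {1..n}" using A by blast
  then have "yword n \<rho> A x \<in> carrier_vec d" using 0 by (rule yword_carrier)
  ultimately show ?case using annihilates_unit(1)[OF w _ _ _ , of "yword n \<rho> A x" k "Suc k"] k by simp
next
  case (Suc q)
  let ?f = "\<rho> (so_unit n (Suc k) k)" and ?R = "\<lambda>q. replicate q (Suc k)"
  have fc: "?f \<in> carrier_mat d d" using k by (intro rep_carrier[OF rep]) auto
  have A': "set (A @ ?R q) \<subseteq> {1..n}" using A k by auto
  have wc: "w \<in> carrier_vec d" using w by (simp add: annihilates_D_def)
  have yc: "y (Suc k) \<in> carrier_mat d d" "y k \<in> carrier_mat d d" using k by auto
  have c: "?f *\<^sub>v (y (Suc k) *\<^sub>v x) \<in> carrier_vec d" "y (Suc k) *\<^sub>v x \<in> carrier_vec d" "y k *\<^sub>v x \<in> carrier_vec d"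
    using fc yc Suc.prems by (meson mult_mat_vec_carrier)+
  have "?f *\<^sub>v (y (Suc k) *\<^sub>v x) = y (Suc k) *\<^sub>v (?f *\<^sub>v x) + \<rho> ((-1) \<cdot>\<^sub>m so_unit n 0 k) *\<^sub>v x"
    using rep_commute[OF rep, of "so_unit n (Suc k) k" "so_unit n 0 (Suc k)" x] k Suc.prems 
    by (simp add: bracket_lower_short)
  also have "\<rho> ((-1) \<cdot>\<^sub>m so_unit n 0 k) = (-1) \<cdot>\<^sub>m y k"
    using k by (intro rep_smult[OF rep]) auto
  also have "((-1) \<cdot>\<^sub>m y k) *\<^sub>v x = (-1) \<cdot>\<^sub>v (y k *\<^sub>v x)"
    by (rule smult_mat_vec[OF yc(2) Suc.prems])
  finally have e: "y (Suc k) *\<^sub>v (?f *\<^sub>v x) = ?f *\<^sub>v (y (Suc k) *\<^sub>v x) + y k *\<^sub>v x"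
    using c fc yc Suc.prems by (intro eq_vecI) auto
  have "yword n \<rho> (A @ ?R (Suc q)) (?f *\<^sub>v x) = yword n \<rho> (A @ ?R q) (y (Suc k) *\<^sub>v (?f *\<^sub>v x))"
    unfolding replicate_Suc replicate_append_same[symmetric] by simp
  also have "\<dots> = yword n \<rho> (A @ ?R q) (?f *\<^sub>v (y (Suc k) *\<^sub>v x)) + yword n \<rho> (A @ ?R q) (y k *\<^sub>v x)"
    unfolding e by (rule yword_add[OF A' c(1,3)])
  finally have "w \<bullet> yword n \<rho> (A @ ?R (Suc q)) (?f *\<^sub>v x) =
      w \<bullet> yword n \<rho> (A @ ?R q) (?f *\<^sub>v (y (Suc k) *\<^sub>v x)) + w \<bullet> yword n \<rho> (A @ ?R q) (y k *\<^sub>v x)"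
    using yword_carrier[OF A' c(1)] yword_carrier[OF A' c(3)] wc by (simp add: scalar_prod_add_distrib[of _ d])
  also have "w \<bullet> yword n \<rho> (A @ ?R q) (?f *\<^sub>v (y (Suc k) *\<^sub>v x)) =
      of_nat q * (w \<bullet> yword n \<rho> (A @ k # ?R (q - 1)) (y (Suc k) *\<^sub>v x))"
    by (rule Suc.IH[OF c(2)])
  also have "\<dots> = of_nat q * (w \<bullet> yword n \<rho> (A @ k # ?R q) x)"
  proof (cases q)
    case (Suc q')
    have "yword n \<rho> (A @ k # ?R q) x = yword n \<rho> (A @ k # ?R q') (y (Suc k) *\<^sub>v x)"
      unfolding Suc replicate_Suc replicate_append_same[symmetric] by simp
    then show ?thesis using Suc by simp
  qed simp
  also have "w \<bullet> yword n \<rho> (A @ ?R q) (y k *\<^sub>v x) = w \<bullet> yword n \<rho> (A @ k # ?R q) x"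
  proof -
    have "set A \<subseteq> {1..n}" "set (?R q @ [k]) \<subseteq> {1..n}" using A k by auto
    from annihilates_mset[OF w Suc.prems this, of "k # ?R q"] show ?thesis by simp
  qed
  finally show ?case by (simp add: algebra_simps)
qed

text \<open>
  Applying the preceding lemma \<open>r\<close> times to \<open>q + r\<close> letters \<open>Suc k\<close> produces the word of the conclusion
  with the nonzero factor \<open>(q + r) \<cdots> (q + 1)\<close>.
\<close>
lemma lowering_power:
  assumes w: "annihilates_D n d \<rho> w" and k: "1 \<le> k" "Suc k \<le> n"
    and A: "set A \<subseteq> {1..n} - {Suc k}" and x: "x \<in> carrier_vec d"
    and z: "(((*\<^sub>v) (\<rho> (so_unit n (Suc k) k))) ^^ r) x = 0\<^sub>v d"
  shows "w \<bullet> yword n \<rho> (A @ replicate r k @ replicate q (Suc k)) x = 0"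
proof -
  let ?f = "\<rho> (so_unit n (Suc k) k)"
  have fc: "?f \<in> carrier_mat d d" using k by (intro rep_carrier[OF rep]) auto
  have fp: "(((*\<^sub>v) ?f) ^^ r) x \<in> carrier_vec d" for r
    using x fc by (induction r) auto
  have "\<exists>c. c \<noteq> 0 \<and> w \<bullet> yword n \<rho> (A @ replicate (q + r) (Suc k)) ((((*\<^sub>v) ?f) ^^ r) x) =
      c * (w \<bullet> yword n \<rho> (A @ replicate r k @ replicate q (Suc k)) x)"
    using A
  proof (induction r arbitrary: A)
    case 0
    then show ?case by (intro exI[of _ 1]) simp
  next
    case (Suc r)
    have "w \<bullet> yword n \<rho> (A @ replicate (q + Suc r) (Suc k)) (?f *\<^sub>v ((((*\<^sub>v) ?f) ^^ r) x)) =
      of_nat (q + Suc r) * (w \<bullet> yword n \<rho> (A @ k # replicate (q + Suc r - 1) (Suc k)) ((((*\<^sub>v) ?f) ^^ r) x))"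
      by (rule lowering_step[OF w k Suc.prems fp])
    moreover obtain c where "c \<noteq> 0" "w \<bullet> yword n \<rho> ((A @ [k]) @ replicate (q + r) (Suc k)) ((((*\<^sub>v) ?f) ^^ r) x) =
      c * (w \<bullet> yword n \<rho> ((A @ [k]) @ replicate r k @ replicate q (Suc k)) x)"
      using Suc.IH[of "A @ [k]"] Suc.prems k by auto
    ultimately show ?case by (intro exI[of _ "of_nat (q + Suc r) * c"]) (simp del: of_nat_Suc)
  qed
  moreover have "yword n \<rho> (A @ replicate (q + r) (Suc k)) (0\<^sub>v d) = 0\<^sub>v d"
    using A k by (intro yword_zero) auto
  ultimately show ?thesis using z w by (auto simp: annihilates_D_def)
qed

end

section \<open>Highest weight vectors of \<open>sl\<^sub>2\<close>\<close>

lemma finite_eigenvalues: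
  fixes A :: "complex mat"
  assumes "A \<in> carrier_mat d d"
  shows "finite {k. \<exists>x\<in>carrier_vec d. x \<noteq> 0\<^sub>v d \<and> A *\<^sub>v x = k \<cdot>\<^sub>v x}"
proof (rule finite_subset)
  show "{k. \<exists>x\<in>carrier_vec d. x \<noteq> 0\<^sub>v d \<and> A *\<^sub>v x = k \<cdot>\<^sub>v x} \<subseteq> {k. poly (char_poly A) k = 0}"
    using assms eigenvalue_root_char_poly[OF assms] by (auto simp: eigenvalue_def eigenvector_def)
  have "char_poly A \<noteq> 0" using degree_monic_char_poly[OF assms] by auto
  then show "finite {k. poly (char_poly A) k = 0}" by (rule poly_roots_finite)
qed

text \<open>
  The vectors \<open>F\<^sup>k v\<close> have pairwise different \<open>H\<close>-eigenvalues \<open>m - 2k\<close>, so one of them vanishes.  For the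
  first such \<open>k\<close>, the equation \<open>E F\<^sup>k v = k (m - k + 1) F\<^sup>k\<^sup>-\<^sup>1 v\<close> gives \<open>k = 0\<close> or \<open>k = m + 1\<close>.
\<close>
lemma sl2_lowering_power_zero:
  fixes E F H :: "complex mat" and m :: nat
  assumes c: "E \<in> carrier_mat d d" "F \<in> carrier_mat d d" "H \<in> carrier_mat d d" and v: "v \<in> carrier_vec d"
    and EF: "\<And>x. x \<in> carrier_vec d \<Longrightarrow> E *\<^sub>v (F *\<^sub>v x) = F *\<^sub>v (E *\<^sub>v x) + H *\<^sub>v x"
    and HF: "\<And>x. x \<in> carrier_vec d \<Longrightarrow> H *\<^sub>v (F *\<^sub>v x) = F *\<^sub>v (H *\<^sub>v x) + (-2) \<cdot>\<^sub>v (F *\<^sub>v x)"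
    and Ev: "E *\<^sub>v v = 0\<^sub>v d" and Hv: "H *\<^sub>v v = of_nat m \<cdot>\<^sub>v v"
  shows "(((*\<^sub>v) F) ^^ (m + 1)) v = 0\<^sub>v d"
proof -
  define x where "x k = (((*\<^sub>v) F) ^^ k) v" for k
  have xS: "x (Suc k) = F *\<^sub>v x k" for k by (simp add: x_def)
  have x0: "x 0 = v" by (simp add: x_def)
  have xc [simp]: "x k \<in> carrier_vec d" for k
    by (induction k) (use c v in \<open>auto simp: x0 xS intro!: mult_mat_vec_carrier\<close>)
  have Fz: "F *\<^sub>v 0\<^sub>v d = 0\<^sub>v d" using c by (intro eq_vecI) auto
  have Hx: "H *\<^sub>v x k = (of_nat m - 2 * of_nat k) \<cdot>\<^sub>v x k" for k
  proof (induction k)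
    case (Suc k)
    have "H *\<^sub>v x (Suc k) = F *\<^sub>v ((of_nat m - 2 * of_nat k) \<cdot>\<^sub>v x k) + (-2) \<cdot>\<^sub>v (F *\<^sub>v x k)"
      using HF[OF xc[of k]] Suc by (simp add: xS)
    also have "\<dots> = (of_nat m - 2 * of_nat k) \<cdot>\<^sub>v x (Suc k) + (-2) \<cdot>\<^sub>v x (Suc k)"
      using c by (simp add: xS mult_mat_vec[OF c(2) xc])
    also have "\<dots> = (of_nat m - 2 * of_nat (Suc k)) \<cdot>\<^sub>v x (Suc k)"
      by (rule eq_vecI) (simp_all add: algebra_simps)
    finally show ?case .
  qed (simp add: x0 Hv)
  have Ex: "E *\<^sub>v x (Suc k) = (of_nat (Suc k) * (of_nat m - of_nat k)) \<cdot>\<^sub>v x k" for k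
  proof (induction k)
    case 0
    show ?case using EF[OF v] Hv v by (simp add: xS x0 Ev Fz)
  next
    case (Suc k)
    have "E *\<^sub>v x (Suc (Suc k)) = F *\<^sub>v ((of_nat (Suc k) * (of_nat m - of_nat k)) \<cdot>\<^sub>v x k) + H *\<^sub>v x (Suc k)"
      using EF[OF xc[of "Suc k"]] Suc by (simp add: xS[of "Suc k"])
    also have "\<dots> = (of_nat (Suc k) * (of_nat m - of_nat k)) \<cdot>\<^sub>v x (Suc k) + (of_nat m - 2 * of_nat (Suc k)) \<cdot>\<^sub>v x (Suc k)"
      by (simp only: Hx mult_mat_vec[OF c(2) xc] xS[of k, symmetric])
    also have "\<dots> = (of_nat (Suc (Suc k)) * (of_nat m - of_nat (Suc k))) \<cdot>\<^sub>v x (Suc k)"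
      by (rule eq_vecI) (simp_all add: algebra_simps)
    finally show ?case .
  qed
  have "\<exists>k. x k = 0\<^sub>v d"
  proof (rule ccontr)
    assume "\<nexists>k. x k = 0\<^sub>v d"
    then have "range (\<lambda>k. of_nat m - 2 * of_nat k :: complex) \<subseteq> {k. \<exists>x\<in>carrier_vec d. x \<noteq> 0\<^sub>v d \<and> H *\<^sub>v x = k \<cdot>\<^sub>v x}"
      using Hx xc by blast
    then have "finite (range (\<lambda>k::nat. of_nat m - 2 * of_nat k :: complex))"
      using finite_eigenvalues[OF c(3)] finite_subset by blast
    moreover have "inj (\<lambda>k::nat. of_nat m - 2 * of_nat k :: complex)"
      by (auto simp: inj_def)
    ultimately show False using finite_imageD infinite_UNIV_nat by blast
  qed
  define K where "K = (LEAST k. x k = 0\<^sub>v d)"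
  have K: "x K = 0\<^sub>v d" unfolding K_def using \<open>\<exists>k. x k = 0\<^sub>v d\<close> by (rule LeastI_ex)
  have Kl: "x k \<noteq> 0\<^sub>v d" if "k < K" for k using that not_less_Least unfolding K_def by blast
  have Kle: "x k = 0\<^sub>v d" if "K \<le> k" for k
    using that by (induction k rule: dec_induct) (simp_all add: K xS Fz)
  have "K \<le> m + 1"
  proof (cases K)
    case (Suc k)
    have "E *\<^sub>v 0\<^sub>v d = 0\<^sub>v d" using c by (intro eq_vecI) auto
    then have z: "(of_nat (Suc k) * (of_nat m - of_nat k)) \<cdot>\<^sub>v x k = 0\<^sub>v d"
      using Ex[of k] K Suc by simp
    obtain i where i: "i < d" "x k $ i \<noteq> 0"
      using Kl[of k] Suc xc[of k] by (metis eq_vecI carrier_vecD index_zero_vec lessI)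
    have "((of_nat (Suc k) * (of_nat m - of_nat k)) \<cdot>\<^sub>v x k) $ i = 0" using z i by simp
    then have "of_nat (Suc k) * (of_nat m - of_nat k) * x k $ i = 0" 
      using i carrier_vecD[OF xc[of k]] by simp
    then have "(of_nat m :: complex) = of_nat k" using i by (simp del: of_nat_Suc)
    then show ?thesis using Suc by simp
  qed simp
  then have "x (m + 1) = 0\<^sub>v d" by (rule Kle)
  then show ?thesis unfolding x_def .
qed

section \<open>Invariance under exponentials\<close>

lemma pow_mat_bound:
  fixes A :: "complex mat"
  assumes A: "A \<in> carrier_mat d d" and "i < d" "j < d"
  shows "cmod ((A ^\<^sub>m k) $$ (i, j)) \<le> (1 + (\<Sum>p<d. \<Sum>q<d. cmod (A $$ (p, q)))) ^ k"
  using assms(2,3)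
proof (induction k arbitrary: j)
  case 0
  then show ?case using A by auto
next
  case (Suc k)
  let ?K = "1 + (\<Sum>p<d. \<Sum>q<d. cmod (A $$ (p, q)))"
  have "(A ^\<^sub>m Suc k) $$ (i, j) = (\<Sum>c<d. (A ^\<^sub>m k) $$ (i, c) * A $$ (c, j))"
    using A Suc by (simp add: index_mult_sum[of _ d d] pow_carrier_mat del: index_mult_mat(1))
  also have "cmod \<dots> \<le> (\<Sum>c<d. ?K ^ k * cmod (A $$ (c, j)))"
    using Suc by (intro sum_norm_le) (auto simp: norm_mult intro!: mult_right_mono)
  also have "\<dots> = ?K ^ k * (\<Sum>c<d. cmod (A $$ (c, j)))" by (simp add: sum_distrib_left)
  also have "\<dots> \<le> ?K ^ k * ?K"
  proof (rule mult_left_mono)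
    have "(\<Sum>c<d. cmod (A $$ (c, j))) \<le> (\<Sum>p<d. \<Sum>q<d. cmod (A $$ (p, q)))"
      using Suc.prems by (intro sum_mono member_le_sum) auto
    then show "(\<Sum>c<d. cmod (A $$ (c, j))) \<le> ?K" by simp
    show "0 \<le> ?K ^ k" by (intro zero_le_power add_nonneg_nonneg sum_nonneg) auto
  qed
  finally show ?case by (simp add: mult.commute)
qed

lemma mat_exp_entry_summable:
  fixes A :: "complex mat"
  assumes A: "A \<in> carrier_mat d d" and "i < d" "j < d"
  shows "summable (\<lambda>k. (A ^\<^sub>m k) $$ (i, j) / fact k)"
proof (rule summable_comparison_test')
  let ?K = "1 + (\<Sum>p<d. \<Sum>q<d. cmod (A $$ (p, q)))"
  show "summable (\<lambda>k. inverse (fact k) * ?K ^ k)" by (rule summable_exp)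
  show "norm ((A ^\<^sub>m k) $$ (i, j) / fact k) \<le> inverse (fact k) * ?K ^ k" if "k \<ge> 0" for k
    using pow_mat_bound[OF assms, of k] by (simp add: norm_divide divide_simps mult.commute)
qed

lemma form_mat_exp:
  fixes A :: "complex mat"
  assumes A: "A \<in> carrier_mat d d" and w: "w \<in> carrier_vec d" and u: "u \<in> carrier_vec d"
  shows "(\<lambda>k. (w \<bullet> ((A ^\<^sub>m k) *\<^sub>v u)) / fact k) sums (w \<bullet> (mat_exp A *\<^sub>v u))"
proof -
  have e: "w \<bullet> (B *\<^sub>v u) = (\<Sum>i<d. \<Sum>j<d. w $ i * (B $$ (i, j) * u $ j))" if "B \<in> carrier_mat d d" for B
    using that u by (subst scalar_prod_sum[of _ d])
      (auto simp: index_mult_vec_sum sum_distrib_left simp del: index_mult_mat_vec intro!: sum.cong mult_mat_vec_carrier)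
  have mc: "mat_exp A \<in> carrier_mat d d" using A by (auto simp: mat_exp_def)
  have "(\<lambda>k. \<Sum>i<d. \<Sum>j<d. w $ i * ((A ^\<^sub>m k) $$ (i, j) / fact k * u $ j)) sums
        (\<Sum>i<d. \<Sum>j<d. w $ i * (mat_exp A $$ (i, j) * u $ j))"
  proof (intro sums_sum sums_mult sums_mult2)
    fix i j assume "i \<in> {..<d}" "j \<in> {..<d}"
    then show "(\<lambda>k. (A ^\<^sub>m k) $$ (i, j) / fact k) sums mat_exp A $$ (i, j)"
      using A mat_exp_entry_summable[OF A, of i j] by (simp add: mat_exp_def summable_sums)
  qed
  moreover have "(\<Sum>i<d. \<Sum>j<d. w $ i * ((A ^\<^sub>m k) $$ (i, j) / fact k * u $ j)) = (w \<bullet> ((A ^\<^sub>m k) *\<^sub>v u)) / fact k" for k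
    using A by (simp add: e pow_carrier_mat sum_divide_distrib)
  ultimately show ?thesis by (simp add: e[OF mc])
qed

lemma pow_mat_smult:
  fixes A :: "complex mat"
  assumes "A \<in> carrier_mat d d"
  shows "(t \<cdot>\<^sub>m A) ^\<^sub>m k = t ^ k \<cdot>\<^sub>m A ^\<^sub>m k"
proof (induction k)
  case (Suc k)
  have p: "A ^\<^sub>m k \<in> carrier_mat d d" using assms by (rule pow_carrier_mat)
  have "(t ^ k \<cdot>\<^sub>m A ^\<^sub>m k) * (t \<cdot>\<^sub>m A) = t \<cdot>\<^sub>m (t ^ k \<cdot>\<^sub>m (A ^\<^sub>m k * A))"
    using p assms by (simp add: mult_smult_assoc_mat[of _ d d _ d] mult_smult_distrib[of _ d d _ d])
  also have "\<dots> = t ^ Suc k \<cdot>\<^sub>m (A ^\<^sub>m k * A)" by (rule eq_matI) auto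
  finally show ?case using Suc by simp
next
  case 0
  show ?case using assms by (auto intro!: eq_matI)
qed

text \<open>
  As a function of \<open>t\<close>, the left-hand side of the hypothesis is a power series that is constant; its
  coefficient of \<open>t\<close> is the value in question.
\<close>
lemma form_exp_invariant_imp:
  fixes A :: "complex mat"
  assumes A: "A \<in> carrier_mat d d" and w: "w \<in> carrier_vec d" and u: "u \<in> carrier_vec d"
    and inv: "\<And>t. w \<bullet> (mat_exp (t \<cdot>\<^sub>m A) *\<^sub>v u) = w \<bullet> u"
  shows "w \<bullet> (A *\<^sub>v u) = 0"
proof -
  define c where "c k = (w \<bullet> ((A ^\<^sub>m k) *\<^sub>v u)) / fact k" for k
  have s: "(\<lambda>k. c k * t ^ k) sums (w \<bullet> u)" for t
  proof -
    have "w \<bullet> (((t \<cdot>\<^sub>m A) ^\<^sub>m k) *\<^sub>v u) / fact k = c k * t ^ k" for k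
      unfolding pow_mat_smult[OF A] using w u pow_carrier_mat[OF A, of k]
      by (simp add: c_def smult_mat_vec[of _ d d] mult_mat_vec_carrier[of _ d d])
    then show ?thesis using form_mat_exp[of "t \<cdot>\<^sub>m A" d w u] A w u inv by simp
  qed
  have c0: "c 0 = w \<bullet> u" using u A by (simp add: c_def)
  have s': "(\<lambda>k. c (Suc k) * t ^ k) sums 0" if "t \<noteq> 0" for t
  proof -
    have "(\<lambda>k. c (Suc k) * t ^ Suc k) sums 0"
      using s[of t] c0 by (subst sums_Suc_iff) simp
    then have "(\<lambda>k. inverse t * (c (Suc k) * t ^ Suc k)) sums (inverse t * 0)" by (rule sums_mult)
    then show ?thesis using that by (simp add: field_simps)
  qed
  have "((\<lambda>_::complex. 0) \<longlongrightarrow> c (Suc 0)) (at 0)"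
    by (rule powser_limit_0_strong[of 1 "\<lambda>k. c (Suc k)"]) (use s' in auto)
  then have "c 1 = 0" using LIM_const_eq by fastforce
  then have "w \<bullet> ((1\<^sub>m d * A) *\<^sub>v u) = 0" using A by (simp add: c_def)
  then show ?thesis using A by simp
qed

lemma pos_roots_D_root:
  assumes "\<alpha> \<in> pos_roots_D n"
  obtains i b where "1 \<le> i" "i \<le> n" "1 \<le> b" "b \<le> 2*n" "b \<noteq> i" "i \<noteq> dual n b" "\<alpha> = wt n i - wt n b"
  using assms
proof (cases rule: pos_roots_D_cases)
  case (1 i j)
  then show ?thesis by (intro that[of i j]) (auto simp: dual_def)
next
  case (2 i j)
  then show ?thesis by (intro that[of i "n + j"]) (auto simp: dual_def)
qed

text \<open>
  No weight of the standard representation is a root of \<open>D\<^sub>n\<close>, so the column of \<open>X\<close> that belongs to \<open>e\<^sub>0\<close>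
  vanishes.
\<close>
lemma root_space_D_even:
  assumes \<alpha>: "\<alpha> \<in> pos_roots_D n" and X: "X \<in> root_space (so_odd n) n (- \<alpha>)"
  shows "X \<in> root_space (so_even n) n (- \<alpha>)"
proof -
  obtain i b where ib: "1 \<le> i" "i \<le> n" "1 \<le> b" "b \<le> 2*n" "b \<noteq> i" "i \<noteq> dual n b" "\<alpha> = wt n i - wt n b"
    using \<alpha> by (rule pos_roots_D_root)
  have supp: "(- \<alpha>) j = 0" if "j \<notin> {1..n}" for j
    using that wt_support ib by simp
  have X': "X \<in> so_odd n" "\<And>p q. p \<le> 2*n \<Longrightarrow> q \<le> 2*n \<Longrightarrow> X $$ (p, q) \<noteq> 0 \<Longrightarrow> wt n p - wt n q = - \<alpha>"
    using X root_space_iff[of n "- \<alpha>" X, OF supp] by blast+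
  have Xc: "X \<in> carrier_mat (2*n+1) (2*n+1)" using so_oddD(1)[OF X'(1)] .
  have z: "X $$ (p, 0) = 0" if "p \<le> 2*n" for p
  proof (rule ccontr)
    assume "X $$ (p, 0) \<noteq> 0"
    then have "wt n p - wt n 0 = wt n b - wt n i" using X'(2)[OF that, of 0] ib by simp
    then have "(p = b \<and> 0 = i) \<or> (p = dual n i \<and> 0 = dual n b)"
      by (intro wt_diff_unique) (use ib that in \<open>auto simp: dual_def\<close>)
    then show False using ib by (auto simp: dual_def split: if_splits)
  qed
  have "X *\<^sub>v unit_vec (2*n+1) 0 = 0\<^sub>v (2*n+1)"
  proof (rule eq_vecI)
    fix p assume "p < dim_vec (0\<^sub>v (2*n+1) :: complex vec)"
    then have p: "p < 2*n+1" by simp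
    have "(X *\<^sub>v unit_vec (2*n+1) 0) $ p = (\<Sum>c<2*n+1. X $$ (p, c) * unit_vec (2*n+1) 0 $ c)"
      by (rule index_mult_vec_sum[OF Xc _ p]) simp
    also have "\<dots> = (\<Sum>c<2*n+1. if c = 0 then X $$ (p, 0) else 0)"
      by (rule sum.cong) auto
    also have "\<dots> = X $$ (p, 0)" by (subst sum.delta) auto
    finally show "(X *\<^sub>v unit_vec (2*n+1) 0) $ p = 0\<^sub>v (2*n+1) $ p" using z[of p] p by simp
  qed (use Xc in auto)
  then show ?thesis using X by (auto simp: root_space_def so_even_def)
qed

lemma root_space_smult:
  assumes "X \<in> root_space (so_odd n) n \<alpha>" 
  shows "c \<cdot>\<^sub>m X \<in> root_space (so_odd n) n \<alpha>"
proof -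
  have X: "X \<in> so_odd n" "\<And>H. H \<in> cartan n \<Longrightarrow> lie_bracket H X = eval_weight n \<alpha> H \<cdot>\<^sub>m X"
    using assms by (auto simp: root_space_def)
  note Xc = so_oddD(1)[OF X(1)]
  have "lie_bracket H (c \<cdot>\<^sub>m X) = eval_weight n \<alpha> H \<cdot>\<^sub>m (c \<cdot>\<^sub>m X)" if H: "H \<in> cartan n" for H
  proof -
    have Hc: "H \<in> carrier_mat (2*n+1) (2*n+1)" using H by (auto simp: cartan_def so_odd_def)
    have "lie_bracket H (c \<cdot>\<^sub>m X) = c \<cdot>\<^sub>m lie_bracket H X"
      unfolding lie_bracket_def mult_smult_distrib[OF Hc Xc] mult_smult_assoc_mat[OF Xc Hc]
      by (rule eq_matI) (use Hc Xc in \<open>auto simp: algebra_simps\<close>)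
    also have "\<dots> = eval_weight n \<alpha> H \<cdot>\<^sub>m (c \<cdot>\<^sub>m X)"
      unfolding X(2)[OF H] by (rule eq_matI) auto
    finally show ?thesis .
  qed
  then show ?thesis using so_odd_smult[OF X(1)] by (simp add: root_space_def)
qed

lemma neg_nilpotent_so_odd: "X \<in> neg_nilpotent_D n \<Longrightarrow> X \<in> so_odd n"
proof (induction rule: neg_nilpotent_D.induct)
  case zero
  show ?case by (rule so_odd_zero)
next
  case (add X \<alpha> Y)
  then show ?case by (auto simp: root_space_def so_even_def so_odd_add)
qed

lemma pow_mat_Suc_left:
  fixes A :: "complex mat"
  assumes A: "A \<in> carrier_mat d d"
  shows "A ^\<^sub>m Suc k = A * A ^\<^sub>m k"
proof (induction k)
  case (Suc k)
  have "A ^\<^sub>m k \<in> carrier_mat d d" using A by (rule pow_carrier_mat)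
  then have "A * (A ^\<^sub>m k * A) = A * A ^\<^sub>m k * A" using A by (simp add: assoc_mult_mat[of _ d d _ d _ d])
  then show ?case using Suc by simp
qed (use A in simp)

context so_rep
begin

lemma annihilates_neg_nilpotent:
  assumes w: "annihilates_D n d \<rho> w" and X: "X \<in> neg_nilpotent_D n" and x: "x \<in> carrier_vec d"
  shows "w \<bullet> (\<rho> X *\<^sub>v x) = 0"
  using X
proof (induction rule: neg_nilpotent_D.induct)
  case zero
  show ?case using w x unfolding rep_zero[OF rep] by (simp add: zero_mat_vec annihilates_D_def)
next
  case (add X \<alpha> Y)
  have Y: "Y \<in> root_space (so_odd n) n (- \<alpha>)" "Y \<in> so_odd n"
    using add.hyps(3) by (auto simp: root_space_def so_even_def)
  have Xs: "X \<in> so_odd n" using add.hyps(1) by (rule neg_nilpotent_so_odd)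
  have c: "\<rho> X \<in> carrier_mat d d" "\<rho> Y \<in> carrier_mat d d" using rep_carrier[OF rep] Xs Y by auto
  have wc: "w \<in> carrier_vec d" and "w \<bullet> (\<rho> Y *\<^sub>v x) = 0"
    using w Y(1) add.hyps(2) x by (auto simp: annihilates_D_def)
  moreover have "w \<bullet> (\<rho> (X + Y) *\<^sub>v x) = w \<bullet> (\<rho> X *\<^sub>v x) + w \<bullet> (\<rho> Y *\<^sub>v x)"
    unfolding rep_add[OF rep Xs Y(2)] add_mult_distrib_mat_vec[OF c x]
    by (rule scalar_prod_add_distrib[OF wc]) (use c x in \<open>auto intro: mult_mat_vec_carrier\<close>)
  ultimately show ?case using add.IH by simp
qed

lemma mat_exp_carrier: "A \<in> carrier_mat d d \<Longrightarrow> mat_exp A \<in> carrier_mat d d"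
  by (auto simp: mat_exp_def)

text \<open>
  Differentiating at the identity gives one direction.  Conversely, all terms of the exponential series
  but the constant one are in the image of \<open>\<rho> X\<close>.
\<close>
lemma invariant_forms_iff: "w \<in> invariant_forms n d \<rho> \<longleftrightarrow> annihilates_D n d \<rho> w"
proof
  assume w: "w \<in> invariant_forms n d \<rho>"
  then have wc: "w \<in> carrier_vec d" by (simp add: invariant_forms_def)
  have "w \<bullet> (\<rho> X *\<^sub>v x) = 0"
    if \<alpha>: "\<alpha> \<in> pos_roots_D n" and X: "X \<in> root_space (so_odd n) n (- \<alpha>)" and x: "x \<in> carrier_vec d" for \<alpha> X x
  proof -
    have Xs: "X \<in> so_odd n" using X by (simp add: root_space_def)
    have Xc: "\<rho> X \<in> carrier_mat d d" using rep_carrier[OF rep Xs] .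
    show ?thesis
    proof (rule form_exp_invariant_imp[OF Xc wc x])
      fix t
      have tX: "t \<cdot>\<^sub>m X \<in> root_space (so_even n) n (- \<alpha>)"
        using root_space_D_even[OF \<alpha> root_space_smult[OF X]] .
      have "0\<^sub>m (2*n+1) (2*n+1) + t \<cdot>\<^sub>m X \<in> neg_nilpotent_D n"
        by (rule neg_nilpotent_D.add[OF neg_nilpotent_D.zero \<alpha> tX])
      moreover have "0\<^sub>m (2*n+1) (2*n+1) + t \<cdot>\<^sub>m X = t \<cdot>\<^sub>m X"
        using so_oddD(1)[OF Xs] by (intro left_add_zero_mat) auto
      ultimately have "t \<cdot>\<^sub>m X \<in> neg_nilpotent_D n" by simp
      then have "mat_exp (\<rho> (t \<cdot>\<^sub>m X)) * 1\<^sub>m d \<in> neg_unipotent_D n d \<rho>"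
        by (intro neg_unipotent_D.mult neg_unipotent_D.one)
      moreover have "mat_exp (\<rho> (t \<cdot>\<^sub>m X)) * 1\<^sub>m d = mat_exp (t \<cdot>\<^sub>m \<rho> X)"
        unfolding rep_smult[OF rep Xs] by (rule right_mult_one_mat[OF mat_exp_carrier[OF smult_carrier_mat[OF Xc]]])
      ultimately show "w \<bullet> (mat_exp (t \<cdot>\<^sub>m \<rho> X) *\<^sub>v x) = w \<bullet> x"
        using w x by (auto simp: invariant_forms_def)
    qed
  qed
  then show "annihilates_D n d \<rho> w" using wc by (simp add: annihilates_D_def)
next
  assume w: "annihilates_D n d \<rho> w"
  then have wc: "w \<in> carrier_vec d" by (simp add: annihilates_D_def)
  have e: "w \<bullet> (mat_exp (\<rho> X) *\<^sub>v u) = w \<bullet> u" if X: "X \<in> neg_nilpotent_D n" and u: "u \<in> carrier_vec d" for X u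
  proof -
    have Xc: "\<rho> X \<in> carrier_mat d d" using rep_carrier[OF rep neg_nilpotent_so_odd[OF X]] .
    have "w \<bullet> ((\<rho> X ^\<^sub>m Suc k) *\<^sub>v u) = 0" for k
    proof -
      have p: "\<rho> X ^\<^sub>m k \<in> carrier_mat d d" using Xc by (rule pow_carrier_mat)
      have "\<rho> X ^\<^sub>m Suc k = \<rho> X * \<rho> X ^\<^sub>m k"
        by (rule pow_mat_Suc_left[OF Xc])
      then have "(\<rho> X ^\<^sub>m Suc k) *\<^sub>v u = \<rho> X *\<^sub>v (\<rho> X ^\<^sub>m k *\<^sub>v u)"
        using assoc_mult_mat_vec[OF Xc p u] by (simp only:)
      then show ?thesis using annihilates_neg_nilpotent[OF w X, of "\<rho> X ^\<^sub>m k *\<^sub>v u"] p u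
        by (simp add: mult_mat_vec_carrier)
    qed
    then have "(\<lambda>k. (w \<bullet> ((\<rho> X ^\<^sub>m k) *\<^sub>v u)) / fact k) = (\<lambda>k. if k = 0 then w \<bullet> u else 0)"
      using Xc u by (intro ext, case_tac k) auto
    then have "(\<lambda>k. if k = 0 then w \<bullet> u else 0) sums (w \<bullet> (mat_exp (\<rho> X) *\<^sub>v u))"
      using form_mat_exp[OF Xc wc u] by simp
    moreover have "(\<lambda>k. if k = 0 then w \<bullet> u else 0) sums (w \<bullet> u)"
      using sums_single[of 0 "\<lambda>_. w \<bullet> u"] by simp
    ultimately show ?thesis by (rule sums_unique2)
  qed
  have "g \<in> carrier_mat d d \<and> (\<forall>u\<in>carrier_vec d. w \<bullet> (g *\<^sub>v u) = w \<bullet> u)" if "g \<in> neg_unipotent_D n d \<rho>" for g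
    using that
  proof (induction rule: neg_unipotent_D.induct)
    case (mult g X)
    have m: "mat_exp (\<rho> X) \<in> carrier_mat d d"
      using rep_carrier[OF rep neg_nilpotent_so_odd[OF mult.hyps(2)]] by (rule mat_exp_carrier)
    have "w \<bullet> (mat_exp (\<rho> X) * g *\<^sub>v u) = w \<bullet> u" if u: "u \<in> carrier_vec d" for u
    proof -
      have "mat_exp (\<rho> X) * g *\<^sub>v u = mat_exp (\<rho> X) *\<^sub>v (g *\<^sub>v u)"
        using m mult.IH u by (intro assoc_mult_mat_vec) auto
      moreover have "g *\<^sub>v u \<in> carrier_vec d" using mult.IH u by (auto intro: mult_mat_vec_carrier)
      ultimately show ?thesis using e[OF mult.hyps(2)] mult.IH u by simp
    qed
    then show ?case using m mult.IH by auto
  qed auto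
  then show "w \<in> invariant_forms n d \<rho>" using wc by (auto simp: invariant_forms_def)
qed

end

section \<open>Monomials on a form annihilating the negative roots of \<open>D\<^sub>n\<close>\<close>

definition expword :: "nat \<Rightarrow> exponents \<Rightarrow> nat list" where
  "expword n p = concat (map (\<lambda>i. replicate (p (eps i)) i) [1..<Suc n])"

lemma set_expword: "set (expword n p) \<subseteq> {1..n}"
  by (auto simp: expword_def)

lemma count_expword: "count (mset (expword n p)) k = (if k \<in> {1..n} then p (eps k) else 0)"
proof -
  have "count (mset (concat (map (\<lambda>i. replicate (p (eps i)) i) is))) k = (if k \<in> set is then p (eps k) else 0)"
    if "distinct is" for "is"
    using that by (induction "is") auto
  from this[of "[1..<Suc n]"] show ?thesis by (auto simp: expword_def simp del: upt_Suc)
qed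

text \<open>
  The leftmost factor with a positive exponent would bring the vector into a subspace on which the form
  vanishes.
\<close>
lemma foldr_pow_annihilated:
  fixes A :: "'a \<Rightarrow> complex mat"
  assumes A: "\<And>a. a \<in> set L \<Longrightarrow> A a \<in> carrier_mat d d" and x: "x \<in> carrier_vec d"
    and w: "\<And>a z. a \<in> set L \<Longrightarrow> z \<in> carrier_vec d \<Longrightarrow> w \<bullet> (A a *\<^sub>v z) = 0"
    and nz: "w \<bullet> foldr (\<lambda>a u. (A a ^\<^sub>m p a) *\<^sub>v u) L x \<noteq> 0"
  shows "(\<forall>a\<in>set L. p a = 0) \<and> foldr (\<lambda>a u. (A a ^\<^sub>m p a) *\<^sub>v u) L x = x"
  using A w nz
proof (induction L)
  case (Cons a L)
  let ?z = "foldr (\<lambda>a u. (A a ^\<^sub>m p a) *\<^sub>v u) L x"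
  have z: "?z \<in> carrier_vec d"
    using Cons.prems(1) by (induction L) (auto simp: x intro!: mult_mat_vec_carrier[OF pow_carrier_mat])
  have Aa: "A a \<in> carrier_mat d d" using Cons.prems(1) by simp
  have "p a = 0"
  proof (rule ccontr)
    assume "p a \<noteq> 0"
    then obtain k where k: "p a = Suc k" by (cases "p a") auto
    have pc: "A a ^\<^sub>m k \<in> carrier_mat d d" using Aa by (rule pow_carrier_mat)
    have "(A a ^\<^sub>m p a) *\<^sub>v ?z = A a *\<^sub>v (A a ^\<^sub>m k *\<^sub>v ?z)"
      unfolding k pow_mat_Suc_left[OF Aa] by (rule assoc_mult_mat_vec[OF Aa pc z])
    then show False using Cons.prems(2)[of a "A a ^\<^sub>m k *\<^sub>v ?z"] Cons.prems(3) pc z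
      by (simp add: mult_mat_vec_carrier)
  qed
  moreover have "foldr (\<lambda>a u. (A a ^\<^sub>m p a) *\<^sub>v u) (a # L) x = ?z" using \<open>p a = 0\<close> Aa z by simp
  ultimately show ?case using Cons by simp
qed simp

lemma root_vector_short:
  assumes e: "root_vectors n e" and i: "i \<in> {1..n}"
  obtains c where "c \<noteq> 0" "e (- eps i) = c \<cdot>\<^sub>m so_unit n 0 i"
proof -
  have "- eps i = wt n 0 - wt n i" using i by (auto simp: wt_def)
  moreover have "- eps i \<in> uminus ` set (pos_roots n)" using i by (auto simp: set_pos_roots)
  ultimately have X: "e (- eps i) \<in> root_space (so_odd n) n (wt n 0 - wt n i)" "e (- eps i) \<noteq> 0\<^sub>m (2*n+1) (2*n+1)"
    using e unfolding root_vectors_def by (metis UnI2)+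
  have e1: "e (- eps i) = e (- eps i) $$ (0, i) \<cdot>\<^sub>m so_unit n 0 i"
    by (rule root_space_unit[OF X(1)]) (use i in \<open>auto simp: dual_def\<close>)
  have "0 \<cdot>\<^sub>m so_unit n 0 i = 0\<^sub>m (2*n+1) (2*n+1)" by (rule eq_matI) (auto simp: so_unit_def)
  then have "e (- eps i) $$ (0, i) \<noteq> 0" using e1 X(2) by metis
  then show ?thesis using e1 that by blast
qed

context so_rep
begin

lemma pow_yword:
  assumes "i \<in> {1..n}" "x \<in> carrier_vec d"
  shows "(y i ^\<^sub>m k) *\<^sub>v x = yword n \<rho> (replicate k i) x"
proof -
  have c: "y i \<in> carrier_mat d d" using assms by simp
  show ?thesis
  proof (induction k)
    case (Suc k)
    have "y i ^\<^sub>m k \<in> carrier_mat d d" using c by (rule pow_carrier_mat)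
    then show ?case unfolding pow_mat_Suc_left[OF c] using Suc assoc_mult_mat_vec[OF c _ assms(2)] by simp
  next
    case 0
    show ?case using one_mult_mat_vec[OF assms(2)] by (simp only: pow_mat.simps carrier_matD[OF c] replicate.simps yword_simps)
  qed
qed

lemma monomial_short:
  assumes e: "root_vectors n e" and x: "x \<in> carrier_vec d" and I: "set is \<subseteq> {1..n}"
  shows "\<exists>c. c \<noteq> 0 \<and> foldr (\<lambda>\<alpha> u. (\<rho> (e (- \<alpha>)) ^\<^sub>m p \<alpha>) *\<^sub>v u) (map eps is) x =
     c \<cdot>\<^sub>v yword n \<rho> (concat (map (\<lambda>i. replicate (p (eps i)) i) is)) x"
  using I
proof (induction "is")
  case Nil
  then show ?case by (intro exI[of _ 1]) simp
next
  case (Cons i "is")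
  let ?Y = "yword n \<rho> (concat (map (\<lambda>i. replicate (p (eps i)) i) is)) x"
  have Yc: "?Y \<in> carrier_vec d" using Cons.prems x by (intro yword_carrier) auto
  have sub: "set is \<subseteq> {1..n}" using Cons.prems by simp
  from Cons.IH[OF sub] obtain c where c: "c \<noteq> 0"
    "foldr (\<lambda>\<alpha> u. (\<rho> (e (- \<alpha>)) ^\<^sub>m p \<alpha>) *\<^sub>v u) (map eps is) x = c \<cdot>\<^sub>v ?Y" by blast
  have i: "i \<in> {1..n}" using Cons.prems by simp
  obtain b where b: "b \<noteq> 0" "e (- eps i) = b \<cdot>\<^sub>m so_unit n 0 i" using root_vector_short[OF e i] .
  have yc: "y i \<in> carrier_mat d d" using i by simp
  then have pc: "y i ^\<^sub>m p (eps i) \<in> carrier_mat d d" by (rule pow_carrier_mat)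
  have "\<rho> (e (- eps i)) = b \<cdot>\<^sub>m y i" unfolding b(2) using i by (intro rep_smult[OF rep]) auto
  then have "\<rho> (e (- eps i)) ^\<^sub>m p (eps i) = b ^ p (eps i) \<cdot>\<^sub>m (y i ^\<^sub>m p (eps i))"
    using pow_mat_smult[OF yc] by simp
  then have "(\<rho> (e (- eps i)) ^\<^sub>m p (eps i)) *\<^sub>v (c \<cdot>\<^sub>v ?Y) = b ^ p (eps i) \<cdot>\<^sub>v ((y i ^\<^sub>m p (eps i)) *\<^sub>v (c \<cdot>\<^sub>v ?Y))"
    using smult_mat_vec[OF pc] Yc by simp
  also have "\<dots> = (b ^ p (eps i) * c) \<cdot>\<^sub>v ((y i ^\<^sub>m p (eps i)) *\<^sub>v ?Y)"
    by (simp only: mult_mat_vec[OF pc Yc] smult_smult_assoc)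
  also have "\<dots> = (b ^ p (eps i) * c) \<cdot>\<^sub>v yword n \<rho> (replicate (p (eps i)) i) ?Y"
    unfolding pow_yword[OF i Yc] ..
  finally have "foldr (\<lambda>\<alpha> u. (\<rho> (e (- \<alpha>)) ^\<^sub>m p \<alpha>) *\<^sub>v u) (map eps (i # is)) x =
      (b ^ p (eps i) * c) \<cdot>\<^sub>v yword n \<rho> (concat (map (\<lambda>i. replicate (p (eps i)) i) (i # is))) x"
    by (simp only: list.map foldr.simps o_apply c(2) concat.simps yword_simps)
  moreover have "b ^ p (eps i) * c \<noteq> 0" using b c by simp
  ultimately show ?case by blast
qed

text \<open>
  This reduces signatures of invariant forms to words in the root vectors for \<open>-\<epsilon>\<^sub>1, \<dots>, -\<epsilon>\<^sub>n\<close>; the next lemma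
  is the converse.
\<close>
lemma monomial_nonzero:
  assumes e: "root_vectors n e" and v: "v \<in> carrier_vec d" and w: "annihilates_D n d \<rho> w"
    and nz: "w \<bullet> monomial_vec n e \<rho> v p \<noteq> 0"
  shows "\<alpha> \<in> pos_roots_D n \<Longrightarrow> p \<alpha> = 0" and "w \<bullet> yword n \<rho> (expword n p) v \<noteq> 0"
proof -
  let ?f = "\<lambda>\<alpha> u. (\<rho> (e (- \<alpha>)) ^\<^sub>m p \<alpha>) *\<^sub>v u"
  let ?S = "foldr ?f (map eps [1..<Suc n]) v"
  have wc: "w \<in> carrier_vec d" using w by (simp add: annihilates_D_def)
  have "set [1..<Suc n] \<subseteq> {1..n}" by auto
  from monomial_short[OF e v this, of p, folded expword_def]
  obtain c where c: "c \<noteq> 0" "?S = c \<cdot>\<^sub>v yword n \<rho> (expword n p) v" by blast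
  have Yc: "yword n \<rho> (expword n p) v \<in> carrier_vec d" by (rule yword_carrier[OF set_expword v])
  have m: "monomial_vec n e \<rho> v p = foldr ?f (pos_list_D n) ?S"
    unfolding monomial_vec_def pos_roots_eq foldr_append ..
  have r: "e (- \<alpha>) \<in> root_space (so_odd n) n (- \<alpha>)" if "\<alpha> \<in> set (pos_list_D n)" for \<alpha>
    using e that unfolding root_vectors_def by (auto simp: set_pos_roots set_pos_list_D)
  have "(\<forall>\<alpha>\<in>set (pos_list_D n). p \<alpha> = 0) \<and> foldr ?f (pos_list_D n) ?S = ?S"
  proof (rule foldr_pow_annihilated)
    show "\<rho> (e (- \<alpha>)) \<in> carrier_mat d d" if "\<alpha> \<in> set (pos_list_D n)" for \<alpha>
      using r[OF that] by (intro rep_carrier[OF rep]) (simp add: root_space_def)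
    show "?S \<in> carrier_vec d" using c Yc by simp
    show "w \<bullet> (\<rho> (e (- \<alpha>)) *\<^sub>v z) = 0" if "\<alpha> \<in> set (pos_list_D n)" "z \<in> carrier_vec d" for \<alpha> z
      using w r[OF that(1)] that unfolding annihilates_D_def set_pos_list_D by blast
    show "w \<bullet> foldr ?f (pos_list_D n) ?S \<noteq> 0" using nz m by simp
  qed
  then show "\<alpha> \<in> pos_roots_D n \<Longrightarrow> p \<alpha> = 0" and "w \<bullet> yword n \<rho> (expword n p) v \<noteq> 0"
    using nz m c Yc wc by (auto simp: set_pos_list_D)
qed

lemma monomial_nonzero_iff:
  assumes e: "root_vectors n e" and v: "v \<in> carrier_vec d" and w: "annihilates_D n d \<rho> w"
    and p: "\<And>\<alpha>. \<alpha> \<in> pos_roots_D n \<Longrightarrow> p \<alpha> = 0"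
  shows "w \<bullet> monomial_vec n e \<rho> v p \<noteq> 0 \<longleftrightarrow> w \<bullet> yword n \<rho> (expword n p) v \<noteq> 0"
proof -
  let ?f = "\<lambda>\<alpha> u. (\<rho> (e (- \<alpha>)) ^\<^sub>m p \<alpha>) *\<^sub>v u"
  let ?S = "foldr ?f (map eps [1..<Suc n]) v"
  have wc: "w \<in> carrier_vec d" using w by (simp add: annihilates_D_def)
  have "set [1..<Suc n] \<subseteq> {1..n}" by auto
  from monomial_short[OF e v this, of p, folded expword_def]
  obtain c where c: "c \<noteq> 0" "?S = c \<cdot>\<^sub>v yword n \<rho> (expword n p) v" by blast
  have Yc: "yword n \<rho> (expword n p) v \<in> carrier_vec d" by (rule yword_carrier[OF set_expword v])
  have Sc: "?S \<in> carrier_vec d" using c Yc by simp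
  have r: "\<rho> (e (- \<alpha>)) \<in> carrier_mat d d" if "\<alpha> \<in> set (pos_list_D n)" for \<alpha>
    using e that unfolding root_vectors_def
    by (intro rep_carrier[OF rep]) (auto simp: set_pos_roots set_pos_list_D root_space_def)
  have "foldr ?f L ?S = ?S" if "set L \<subseteq> set (pos_list_D n)" for L
    using that
  proof (induction L)
    case (Cons a L)
    then have "p a = 0" "\<rho> (e (- a)) \<in> carrier_mat d d" using p r by (auto simp: set_pos_list_D)
    moreover have "foldr ?f L ?S = ?S" by (rule Cons.IH) (use Cons.prems in auto)
    ultimately show ?case using Sc by (simp only: foldr.simps o_apply pow_mat.simps carrier_matD one_mult_mat_vec)
  qed (simp only: foldr.simps id_apply)
  then have "monomial_vec n e \<rho> v p = ?S"
    unfolding monomial_vec_def pos_roots_eq foldr_append by blast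
  then show ?thesis using c Yc wc by simp
qed

end

section \<open>Exponents are bounded by coefficients of fundamental weights\<close>

lemma eval_cartan_diag_eps:
  "k \<in> {1..n} \<Longrightarrow> eval_weight n l (cartan_diag n (\<lambda>i. c * eps k i)) = c * l k"
proof -
  assume k: "k \<in> {1..n}"
  have "eval_weight n l (cartan_diag n (\<lambda>i. c * eps k i)) = (\<Sum>i=1..n. eps k i * (c * l i))"
    unfolding eval_weight_cartan_diag by (rule sum.cong) auto
  then show ?thesis using k by (simp only: eval_weight_wt_eps) auto
qed

lemma cartan_diag_entry:
  "a \<le> 2*n \<Longrightarrow> b \<le> 2*n \<Longrightarrow> cartan_diag n h $$ (a, b) = (if a = b then \<Sum>i=1..n. wt n a i * h i else 0)"
  by (simp add: cartan_diag_def)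

lemma sum_wt_eps: "k \<in> {1..n} \<Longrightarrow> (\<Sum>i=1..n. wt n a i * eps k i) = wt n a k"
proof -
  assume k: "k \<in> {1..n}"
  have "(\<Sum>i=1..n. wt n a i * eps k i) = (\<Sum>i=1..n. eps k i * wt n a i)"
    by (rule sum.cong) auto
  then show ?thesis using k by (simp only: eval_weight_wt_eps) auto
qed

lemma so_unit_diag:
  assumes k: "k \<in> {1..n}"
  shows "so_unit n k k = cartan_diag n (eps k)"
proof (rule eq_mat_soI)
  fix a b assume ab: "a \<le> 2*n" "b \<le> 2*n"
  have d: "dual n k = n + k" using k by (auto simp: dual_def)
  show "so_unit n k k $$ (a, b) = cartan_diag n (eps k) $$ (a, b)"
    using k ab unfolding cartan_diag_entry[OF ab] sum_wt_eps[OF k] so_unit_entry[OF ab] d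
    by (auto simp: wt_coord)
qed (auto simp: cartan_diag_def intro: so_unit_carrier)

lemma so_unit_diag_cartan: "k \<in> {1..n} \<Longrightarrow> so_unit n k k \<in> cartan n"
  by (simp add: so_unit_diag cartan_diag_in)

lemma eval_so_unit_diag: "k \<in> {1..n} \<Longrightarrow> eval_weight n l (so_unit n k k) = l k"
  using eval_cartan_diag_eps[of k n l 1] by (simp add: so_unit_diag)

lemma bracket_simple:
  assumes k: "1 \<le> k" "Suc k \<le> n"
  shows "lie_bracket (so_unit n k (Suc k)) (so_unit n (Suc k) k) = cartan_diag n (\<lambda>i. eps k i - eps (Suc k) i)"
proof (rule eq_mat_soI)
  fix a b assume ab: "a \<le> 2*n" "b \<le> 2*n"
  have d: "dual n k = n + k" "dual n (Suc k) = n + Suc k" using k by (auto simp: dual_def)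
  have s: "(\<Sum>i=1..n. wt n a i * (eps k i - eps (Suc k) i)) = wt n a k - wt n a (Suc k)"
    using k sum_wt_eps[of k n a] sum_wt_eps[of "Suc k" n a] by (simp add: right_diff_distrib sum_subtractf)
  have w: "wt n a k = (if a = k then 1 else if a = n + k then -1 else 0)"
    "wt n a (Suc k) = (if a = Suc k then 1 else if a = n + Suc k then -1 else 0)"
    using k ab by (simp_all add: wt_coord)
  have "lie_bracket (so_unit n k (Suc k)) (so_unit n (Suc k) k) $$ (a, b) = so_unit n k k $$ (a, b) - so_unit n (Suc k) (Suc k) $$ (a, b)"
    using k by (subst bracket_so_unit[OF _ _ _ _ ab]) (auto simp: d)
  also have "\<dots> = cartan_diag n (\<lambda>i. eps k i - eps (Suc k) i) $$ (a, b)"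
    unfolding cartan_diag_entry[OF ab] s w so_unit_entry[OF ab] d using k by auto
  finally show "lie_bracket (so_unit n k (Suc k)) (so_unit n (Suc k) k) $$ (a, b) = cartan_diag n (\<lambda>i. eps k i - eps (Suc k) i) $$ (a, b)" .
qed (auto simp: cartan_diag_def)

lemma bracket_short_opposite:
  assumes k: "k \<in> {1..n}"
  shows "lie_bracket (so_unit n k 0) (so_unit n 0 k) = so_unit n k k"
proof (rule eq_mat_soI)
  fix a b assume ab: "a \<le> 2*n" "b \<le> 2*n"
  have d: "dual n k = n + k" "dual n 0 = 0" using k by (auto simp: dual_def)
  have z: "so_unit n 0 0 $$ (a, b) = 0"
    using ab by (simp only: so_unit_entry d) auto
  show "lie_bracket (so_unit n k 0) (so_unit n 0 k) $$ (a, b) = so_unit n k k $$ (a, b)"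
    using k by (subst bracket_so_unit[OF _ _ _ _ ab]) (auto simp: d z)
qed (auto intro: so_unit_carrier)

lemma bracket_smult_left:
  assumes "X \<in> carrier_mat m m" "Y \<in> carrier_mat m m"
  shows "lie_bracket (c \<cdot>\<^sub>m X) Y = c \<cdot>\<^sub>m lie_bracket X Y"
  unfolding lie_bracket_def mult_smult_distrib[OF assms(2,1)] mult_smult_assoc_mat[OF assms]
  by (rule eq_matI) (use assms in \<open>auto simp: algebra_simps\<close>)

lemma bracket_cartan_unit:
  assumes "H \<in> cartan n" "a \<le> 2*n" "b \<le> 2*n"
  shows "lie_bracket H (so_unit n a b) = eval_weight n (wt n a - wt n b) H \<cdot>\<^sub>m so_unit n a b"
  using so_unit_root_space[OF assms(2,3)] assms(1) by (simp add: root_space_def)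

lemma cartan_so_odd: "H \<in> cartan n \<Longrightarrow> H \<in> so_odd n"
  by (simp add: cartan_def)

locale so_hw = so_rep +
  fixes l :: weight and v :: "complex vec"
  assumes v: "v \<in> carrier_vec d"
    and weight: "\<And>H. H \<in> cartan n \<Longrightarrow> \<rho> H *\<^sub>v v = eval_weight n l H \<cdot>\<^sub>v v"
    and highest: "\<And>\<alpha> X. \<alpha> \<in> set (pos_roots n) \<Longrightarrow> X \<in> root_space (so_odd n) n \<alpha> \<Longrightarrow> \<rho> X *\<^sub>v v = 0\<^sub>v d"
begin

lemma sl2_zero:
  assumes H: "H \<in> cartan n" and ab: "a \<le> 2*n" "b \<le> 2*n" and X: "X \<in> so_odd n"
    and br: "lie_bracket X (so_unit n a b) = H"
    and two: "eval_weight n (wt n a - wt n b) H = -2"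
    and hi: "\<rho> X *\<^sub>v v = 0\<^sub>v d" and m: "eval_weight n l H = of_nat m"
  shows "(((*\<^sub>v) (\<rho> (so_unit n a b))) ^^ (m + 1)) v = 0\<^sub>v d"
proof (rule sl2_lowering_power_zero)
  have F: "so_unit n a b \<in> so_odd n" using ab by simp
  show c: "\<rho> X \<in> carrier_mat d d" "\<rho> (so_unit n a b) \<in> carrier_mat d d" "\<rho> H \<in> carrier_mat d d"
    using rep_carrier[OF rep] X F cartan_so_odd[OF H] by auto
  show "\<rho> X *\<^sub>v (\<rho> (so_unit n a b) *\<^sub>v x) = \<rho> (so_unit n a b) *\<^sub>v (\<rho> X *\<^sub>v x) + \<rho> H *\<^sub>v x"
    if "x \<in> carrier_vec d" for x
    using rep_commute[OF rep X F that] br by simp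
  show "\<rho> H *\<^sub>v (\<rho> (so_unit n a b) *\<^sub>v x) = \<rho> (so_unit n a b) *\<^sub>v (\<rho> H *\<^sub>v x) + (-2) \<cdot>\<^sub>v (\<rho> (so_unit n a b) *\<^sub>v x)"
    if "x \<in> carrier_vec d" for x
    using rep_commute[OF rep cartan_so_odd[OF H] F that]
    unfolding bracket_cartan_unit[OF H ab] two rep_smult[OF rep F] smult_mat_vec[OF c(2) that] .
  show "\<rho> H *\<^sub>v v = of_nat m \<cdot>\<^sub>v v" using weight[OF H] m by simp
qed (use v hi in auto)

lemma simple_root_zero:
  assumes k: "1 \<le> k" "Suc k \<le> n" and m: "l k - l (Suc k) = of_nat m"
  shows "(((*\<^sub>v) (\<rho> (so_unit n (Suc k) k))) ^^ (m + 1)) v = 0\<^sub>v d"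
proof (rule sl2_zero)
  let ?H = "cartan_diag n (\<lambda>i. eps k i - eps (Suc k) i)"
  have ev: "eval_weight n f ?H = f k - f (Suc k)" for f
    using eval_cartan_diag_eps[of k n f 1] eval_cartan_diag_eps[of "Suc k" n f 1] k
    by (simp add: eval_weight_cartan_diag right_diff_distrib sum_subtractf)
  show "?H \<in> cartan n" by (rule cartan_diag_in)
  show "lie_bracket (so_unit n k (Suc k)) (so_unit n (Suc k) k) = ?H" using k by (rule bracket_simple)
  show "eval_weight n (wt n (Suc k) - wt n k) ?H = -2"
    using k by (simp add: ev wt_coord)
  have "eps k - eps (Suc k) \<in> set (pos_roots n)" using k unfolding set_pos_roots pos_roots_D_def by blast
  moreover have "eps k - eps (Suc k) = wt n k - wt n (Suc k)" using k by (auto simp: wt_def)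
  ultimately show "\<rho> (so_unit n k (Suc k)) *\<^sub>v v = 0\<^sub>v d"
    using highest so_unit_root_space[of k n "Suc k"] k by simp
  show "eval_weight n l ?H = of_nat m" using m by (simp add: ev)
qed (use k in auto)

lemma short_root_zero:
  assumes k: "k \<in> {1..n}" and m: "2 * l k = of_nat m"
  shows "(((*\<^sub>v) (y k)) ^^ (m + 1)) v = 0\<^sub>v d"
proof (rule sl2_zero)
  let ?H = "cartan_diag n (\<lambda>i. 2 * eps k i)"
  have F: "so_unit n k 0 \<in> so_odd n" using k by simp
  show "?H \<in> cartan n" by (rule cartan_diag_in)
  have "lie_bracket (2 \<cdot>\<^sub>m so_unit n k 0) (so_unit n 0 k) = 2 \<cdot>\<^sub>m cartan_diag n (eps k)"
    using bracket_smult_left[OF so_unit_carrier so_unit_carrier] bracket_short_opposite[OF k] so_unit_diag[OF k] by simp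
  also have "\<dots> = ?H"
    by (rule eq_matI) (auto simp: cartan_diag_def sum_distrib_left intro!: sum.cong)
  finally show "lie_bracket (2 \<cdot>\<^sub>m so_unit n k 0) (so_unit n 0 k) = ?H" .
  show "eval_weight n (wt n 0 - wt n k) ?H = -2"
    using k by (simp only: eval_cartan_diag_eps) (simp add: wt_coord)
  have "wt n k - wt n 0 \<in> set (pos_roots n)" using k by (simp add: set_pos_roots eps_wt[symmetric])
  then show "\<rho> (2 \<cdot>\<^sub>m so_unit n k 0) *\<^sub>v v = 0\<^sub>v d"
    using k by (intro highest[OF _ root_space_smult[OF so_unit_root_space]]) auto
  show "eval_weight n l ?H = of_nat m" using k m by (simp only: eval_cartan_diag_eps)
  show "2 \<cdot>\<^sub>m so_unit n k 0 \<in> so_odd n" using F by (rule so_odd_smult)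
qed (use k in auto)

text \<open>
  By \<open>annihilates_mset\<close> the letters can be arranged so that \<open>lowering_power\<close> applies (for \<open>k < n\<close>) or so
  that \<open>m + 1\<close> letters \<open>n\<close> act first on \<open>v\<close>.
\<close>
theorem exponent_bound:
  assumes w: "annihilates_D n d \<rho> w" and ws: "set ws \<subseteq> {1..n}" and k: "k \<in> {1..n}"
    and m: "(if k < n then l k - l (Suc k) else 2 * l n) = of_nat m"
    and nz: "w \<bullet> yword n \<rho> ws v \<noteq> 0"
  shows "count (mset ws) k \<le> m"
proof (rule ccontr)
  let ?q = "count (mset ws)"
  assume "\<not> ?q k \<le> m"
  then have q: "?q k = (?q k - (m + 1)) + (m + 1)" by simp
  show False
  proof (cases "k < n")
    case True
    have z: "(((*\<^sub>v) (\<rho> (so_unit n (Suc k) k))) ^^ (m + 1)) v = 0\<^sub>v d"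
      using k m True by (intro simple_root_zero) auto
    \<comment> \<open>all letters but the \<open>m + 1\<close> letters \<open>k\<close> to be traded and the letters \<open>Suc k\<close>\<close>
    define A where "A = filter (\<lambda>i. i \<noteq> k \<and> i \<noteq> Suc k) ws @ replicate (?q k - (m + 1)) k"
    have A: "set A \<subseteq> {1..n} - {Suc k}" using ws k by (auto simp: A_def)
    have "mset ws = mset (A @ replicate (m + 1) k @ replicate (?q (Suc k)) (Suc k))"
    proof (rule multiset_eqI)
      fix i
      consider "i = k" | "i = Suc k" | "i \<noteq> k" "i \<noteq> Suc k" by blast
      then show "?q i = count (mset (A @ replicate (m + 1) k @ replicate (?q (Suc k)) (Suc k))) i"
        by cases (use q in \<open>auto simp: A_def count_mset_0_iff\<close>)
    qed
    from annihilates_mset[OF w v _ ws this, of "[]"]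
    have "w \<bullet> yword n \<rho> ws v = w \<bullet> yword n \<rho> (A @ replicate (m + 1) k @ replicate (?q (Suc k)) (Suc k)) v"
      by simp
    also have "\<dots> = 0" using k True by (intro lowering_power[OF w _ _ A v z]) auto
    finally show False using nz by simp
  next
    case False
    then have kn: "k = n" using k by simp
    have z: "(((*\<^sub>v) (y k)) ^^ (m + 1)) v = 0\<^sub>v d"
      using k m kn by (intro short_root_zero) auto
    have p: "yword n \<rho> (replicate r k) v = (((*\<^sub>v) (y k)) ^^ r) v" for r
      by (induction r) auto
    define A where "A = filter (\<lambda>i. i \<noteq> k) ws @ replicate (?q k - (m + 1)) k"
    have A: "set A \<subseteq> {1..n}" using ws k by (auto simp: A_def)
    have "mset ws = mset (A @ replicate (m + 1) k)"
    proof (rule multiset_eqI)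
      fix i show "?q i = count (mset (A @ replicate (m + 1) k)) i"
        by (cases "i = k") (use q in \<open>auto simp: A_def count_mset_0_iff\<close>)
    qed
    from annihilates_mset[OF w v _ ws this, of "[]"]
    have "w \<bullet> yword n \<rho> ws v = w \<bullet> yword n \<rho> (A @ replicate (m + 1) k) v"
      by simp
    also have "\<dots> = 0"
      unfolding yword_simps p z yword_zero[OF A] using w by (simp add: annihilates_D_def)
    finally show False using nz by simp
  qed
qed

end

section \<open>Unitary representations\<close>

text \<open>
  For unitary representations, orthogonal complements of submodules are submodules.
\<close>
definition unitary_rep :: "nat \<Rightarrow> nat \<Rightarrow> (complex mat \<Rightarrow> complex mat) \<Rightarrow> bool" where
  "unitary_rep n d \<rho> \<longleftrightarrow> representation n d \<rho> \<and> (\<forall>X\<in>so_odd n. \<rho> (adj X) = adj (\<rho> X))"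

definition hw_vector ::
    "nat \<Rightarrow> weight \<Rightarrow> nat \<Rightarrow> (complex mat \<Rightarrow> complex mat) \<Rightarrow> complex vec \<Rightarrow> bool" where
  "hw_vector n l d \<rho> v \<longleftrightarrow> v \<in> carrier_vec d \<and>
     (\<forall>H\<in>cartan n. \<rho> H *\<^sub>v v = eval_weight n l H \<cdot>\<^sub>v v) \<and>
     (\<forall>\<alpha>\<in>set (pos_roots n). \<forall>X\<in>root_space (so_odd n) n \<alpha>. \<rho> X *\<^sub>v v = 0\<^sub>v d)"

text \<open>
  The Cartan element \<open>so_unit n k k\<close> reads off the coordinate of a weight at \<open>\<epsilon>\<^sub>k\<close>, so \<open>m\<close> is the weight of
  \<open>u\<close>.
\<close>
definition hw_vector_D ::
    "nat \<Rightarrow> (nat \<Rightarrow> complex) \<Rightarrow> nat \<Rightarrow> (complex mat \<Rightarrow> complex mat) \<Rightarrow> complex vec \<Rightarrow> bool" where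
  "hw_vector_D n m d \<rho> u \<longleftrightarrow> u \<in> carrier_vec d \<and>
     (\<forall>k\<in>{1..n}. \<rho> (so_unit n k k) *\<^sub>v u = m k \<cdot>\<^sub>v u) \<and>
     (\<forall>\<alpha>\<in>pos_roots_D n. \<forall>X\<in>root_space (so_odd n) n \<alpha>. \<rho> X *\<^sub>v u = 0\<^sub>v d)"

text \<open>
  The word \<open>ws\<close> encodes the exponents: its letter \<open>k\<close> stands for one factor at the root \<open>\<epsilon>\<^sub>k\<close>.  The form
  \<open>\<langle>u, \<cdot>\<rangle>\<close> will have the signature given by \<open>l\<close> and \<open>ws\<close>.
\<close>
definition witness ::
    "nat \<Rightarrow> weight \<Rightarrow> nat list \<Rightarrow> nat \<Rightarrow> (complex mat \<Rightarrow> complex mat) \<Rightarrow> complex vec \<Rightarrow> complex vec \<Rightarrow> bool"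
  where
  "witness n l ws d \<rho> v u \<longleftrightarrow> unitary_rep n d \<rho> \<and> hw_vector n l d \<rho> v \<and> set ws \<subseteq> {1..n} \<and>
     hw_vector_D n (\<lambda>k. l k - of_nat (count (mset ws) k)) d \<rho> u \<and>
     conjugate u \<bullet> yword n \<rho> ws v \<noteq> 0"

lemma adj_root_space:
  assumes supp: "\<And>i. i \<notin> {1..n} \<Longrightarrow> \<alpha> i = 0" and X: "X \<in> root_space (so_odd n) n (- \<alpha>)"
  shows "adj X \<in> root_space (so_odd n) n \<alpha>"
proof -
  have supp': "(- \<alpha>) i = 0" if "i \<notin> {1..n}" for i using supp[OF that] by simp
  have X': "X \<in> so_odd n" "\<And>p q. p \<le> 2*n \<Longrightarrow> q \<le> 2*n \<Longrightarrow> X $$ (p, q) \<noteq> 0 \<Longrightarrow> wt n p - wt n q = - \<alpha>"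
    using X root_space_iff[of n "- \<alpha>" X, OF supp'] by blast+
  have "wt n p - wt n q = \<alpha>" if "p \<le> 2*n" "q \<le> 2*n" "adj X $$ (p, q) \<noteq> 0" for p q
  proof -
    have "adj X $$ (p, q) = cnj (X $$ (q, p))"
      using so_oddD(1)[OF X'(1)] that by (intro adj_index) auto
    then have "wt n q - wt n p = - \<alpha>" using X'(2)[of q p] that by simp
    then show ?thesis by (metis minus_diff_eq minus_minus)
  qed
  then show ?thesis using root_space_iff[of n \<alpha> "adj X", OF supp] adj_so_odd[OF X'(1)] by blast
qed

lemma pos_roots_D_support: "\<alpha> \<in> pos_roots_D n \<Longrightarrow> i \<notin> {1..n} \<Longrightarrow> \<alpha> i = 0"
  by (rule pos_root_support[of _ n]) (simp_all add: set_pos_roots)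

lemma unitary_form:
  assumes U: "unitary_rep n d \<rho>" and X: "X \<in> so_odd n" and u: "u \<in> carrier_vec d" and x: "x \<in> carrier_vec d"
  shows "conjugate u \<bullet> (\<rho> X *\<^sub>v x) = conjugate (\<rho> (adj X) *\<^sub>v u) \<bullet> x"
  using form_adj[OF rep_carrier[OF _ X] u x] U X by (simp add: unitary_rep_def)

text \<open>
  The adjoint of a negative root vector is a positive root vector.
\<close>
lemma hw_vector_D_annihilates:
  assumes U: "unitary_rep n d \<rho>" and u: "hw_vector_D n m d \<rho> u"
  shows "annihilates_D n d \<rho> (conjugate u)"
  unfolding annihilates_D_def
proof (intro conjI ballI)
  show "conjugate u \<in> carrier_vec d" using u by (simp add: hw_vector_D_def)
  fix \<alpha> X and x :: "complex vec"
  assume a: "\<alpha> \<in> pos_roots_D n" "X \<in> root_space (so_odd n) n (- \<alpha>)" "x \<in> carrier_vec d"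
  have "\<rho> (adj X) *\<^sub>v u = 0\<^sub>v d"
    using adj_root_space[OF pos_roots_D_support[OF a(1)] a(2)] u a(1) by (simp add: hw_vector_D_def)
  moreover have "X \<in> so_odd n" using a(2) by (simp add: root_space_def)
  ultimately show "conjugate u \<bullet> (\<rho> X *\<^sub>v x) = 0"
    using unitary_form[OF U _ _ a(3), of X u] u a(3) by (simp add: hw_vector_D_def)
qed

lemma hw_vector_so_hw:
  assumes "representation n d \<rho>" "hw_vector n l d \<rho> v"
  shows "so_hw n d \<rho> l v"
  using assms by unfold_locales (auto simp: hw_vector_def)

context so_hw
begin

lemma yword_weight:
  assumes "set ws \<subseteq> {1..n}" and k: "k \<in> {1..n}"
  shows "\<rho> (so_unit n k k) *\<^sub>v yword n \<rho> ws v = (l k - of_nat (count (mset ws) k)) \<cdot>\<^sub>v yword n \<rho> ws v"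
  using assms(1)
proof (induction ws)
  case Nil
  then show ?case using weight[OF so_unit_diag_cartan[OF k]] k by (simp add: eval_so_unit_diag)
next
  case (Cons i ws)
  let ?H = "\<rho> (so_unit n k k)" and ?Y = "yword n \<rho> ws v"
  have i: "i \<in> {1..n}" using Cons.prems by simp
  have Y: "?Y \<in> carrier_vec d" using Cons.prems v by (intro yword_carrier) auto
  have F: "so_unit n 0 i \<in> so_odd n" using i by simp
  have yc: "y i \<in> carrier_mat d d" using i by simp
  let ?e = "eval_weight n (wt n 0 - wt n i) (so_unit n k k)"
  have ev: "?e = (if i = k then -1 else 0)"
    using k i by (simp add: eval_so_unit_diag wt_coord)
  have "?H *\<^sub>v (y i *\<^sub>v ?Y) = y i *\<^sub>v (?H *\<^sub>v ?Y) + \<rho> (?e \<cdot>\<^sub>m so_unit n 0 i) *\<^sub>v ?Y"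
    using rep_commute[OF rep _ F Y, of "so_unit n k k"] k i bracket_cartan_unit[OF so_unit_diag_cartan[OF k], of 0 i]
    by simp
  also have "\<rho> (?e \<cdot>\<^sub>m so_unit n 0 i) *\<^sub>v ?Y = ?e \<cdot>\<^sub>v (y i *\<^sub>v ?Y)"
    unfolding rep_smult[OF rep F] smult_mat_vec[OF yc Y] ..
  also have "?H *\<^sub>v ?Y = (l k - of_nat (count (mset ws) k)) \<cdot>\<^sub>v ?Y"
    using Cons by simp
  also have "y i *\<^sub>v \<dots> = (l k - of_nat (count (mset ws) k)) \<cdot>\<^sub>v (y i *\<^sub>v ?Y)"
    by (rule mult_mat_vec[OF yc Y])
  also have "(l k - of_nat (count (mset ws) k)) \<cdot>\<^sub>v (y i *\<^sub>v ?Y) + ?e \<cdot>\<^sub>v (y i *\<^sub>v ?Y) =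
      (l k - of_nat (count (mset (i # ws)) k)) \<cdot>\<^sub>v (y i *\<^sub>v ?Y)"
    unfolding ev by (rule eq_vecI) (auto simp: algebra_simps)
  finally show ?case by simp
qed

end

text \<open>
  The Cartan elements \<open>so_unit n k k\<close> are Hermitian, so vectors with different weights are orthogonal.
  Weights have complex coordinates here; comparing \<open>us\<close> with \<open>ws\<close> itself cancels the conjugation.
\<close>
lemma witness_mset:
  assumes W: "witness n l ws d \<rho> v u" and us: "set us \<subseteq> {1..n}"
    and nz: "conjugate u \<bullet> yword n \<rho> us v \<noteq> 0"
  shows "mset us = mset ws"
proof -
  have U: "unitary_rep n d \<rho>" and hw: "hw_vector n l d \<rho> v" and ws: "set ws \<subseteq> {1..n}"
    and u: "hw_vector_D n (\<lambda>k. l k - of_nat (count (mset ws) k)) d \<rho> u"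
    and nz': "conjugate u \<bullet> yword n \<rho> ws v \<noteq> 0"
    using W by (auto simp: witness_def)
  interpret so_hw n d \<rho> l v using hw_vector_so_hw U hw by (simp add: unitary_rep_def)
  have uc: "u \<in> carrier_vec d" using u by (simp add: hw_vector_D_def)
  \<comment> \<open>both sides of the pairing with the action of \<open>so_unit n k k\<close>, divided by the pairing\<close>
  have e: "cnj (l k - of_nat (count (mset ws) k)) = l k - of_nat (count (mset xs) k)"
    if k: "k \<in> {1..n}" and xs: "set xs \<subseteq> {1..n}" and nz: "conjugate u \<bullet> yword n \<rho> xs v \<noteq> 0" for k xs
  proof -
    let ?Y = "yword n \<rho> xs v" and ?c = "l k - of_nat (count (mset ws) k)"
    have Y: "?Y \<in> carrier_vec d" using xs v by (rule yword_carrier)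
    have F: "so_unit n k k \<in> so_odd n" using k by simp
    have "conjugate u \<bullet> (\<rho> (so_unit n k k) *\<^sub>v ?Y) = conjugate (\<rho> (so_unit n k k) *\<^sub>v u) \<bullet> ?Y"
      using unitary_form[OF U F uc Y] k by (simp add: adj_so_unit)
    also have "\<rho> (so_unit n k k) *\<^sub>v u = ?c \<cdot>\<^sub>v u" using u k by (simp add: hw_vector_D_def)
    also have "conjugate (?c \<cdot>\<^sub>v u) \<bullet> ?Y = cnj ?c * (conjugate u \<bullet> ?Y)"
      using uc Y by (simp add: conjugate_smult_vec)
    finally have "(l k - of_nat (count (mset xs) k)) * (conjugate u \<bullet> ?Y) = cnj ?c * (conjugate u \<bullet> ?Y)"
      unfolding yword_weight[OF xs k] using uc Y by simp
    then show ?thesis using nz by simp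
  qed
  have "count (mset us) k = count (mset ws) k" for k
  proof (cases "k \<in> {1..n}")
    case True
    have "(of_nat (count (mset us) k) :: complex) = of_nat (count (mset ws) k)"
      using e[OF True us nz] e[OF True ws nz'] by simp
    then show ?thesis by simp
  next
    case False
    then have "k \<notin> set us" "k \<notin> set ws" using us ws by auto
    then show ?thesis by (metis not_in_iff set_mset_mset)
  qed
  then show ?thesis by (rule multiset_eqI)
qed

section \<open>Tensor products\<close>

definition tensor_rep ::
    "nat \<Rightarrow> nat \<Rightarrow> (complex mat \<Rightarrow> complex mat) \<Rightarrow> (complex mat \<Rightarrow> complex mat) \<Rightarrow> complex mat \<Rightarrow> complex mat" where
  "tensor_rep d d' \<rho> \<rho>' X = kron (\<rho> X) (1\<^sub>m d') + kron (1\<^sub>m d) (\<rho>' X)"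

lemma four_term_commutator:
  fixes A B C D :: "complex mat"
  assumes "A \<in> carrier_mat m m" "B \<in> carrier_mat m m" "C \<in> carrier_mat m m" "D \<in> carrier_mat m m"
    and "A * D = D * A" "B * C = C * B"
  shows "(A + B) * (C + D) - (C + D) * (A + B) = (A * C - C * A) + (B * D - D * B)"
proof -
  have e1: "(A + B) * (C + D) = (A * C + B * C) + (A * D + B * D)"
    using assms by (simp add: mult_add_distrib_mat[of _ m m _ m] add_mult_distrib_mat[of _ m m _ _ m])
  have e2: "(C + D) * (A + B) = (C * A + A * D) + (B * C + D * B)"
    using assms by (simp add: mult_add_distrib_mat[of _ m m _ m] add_mult_distrib_mat[of _ m m _ _ m])
  have "((P + Q) + (R + S)) - ((T + R) + (Q + V)) = (P - T) + (S - V)"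
    if "P \<in> carrier_mat m m" "Q \<in> carrier_mat m m" "R \<in> carrier_mat m m" "S \<in> carrier_mat m m"
      "T \<in> carrier_mat m m" "V \<in> carrier_mat m m" for P Q R S T V :: "complex mat"
    by (rule eq_matI) (use that in auto)
  then show ?thesis unfolding e1 e2 using assms(1-4) by (meson mult_carrier_mat)
qed

lemma tensor_unitary:
  assumes U: "unitary_rep n d \<rho>" and U': "unitary_rep n d' \<rho>'"
  shows "unitary_rep n (d * d') (tensor_rep d d' \<rho> \<rho>')"
proof -
  let ?t = "tensor_rep d d' \<rho> \<rho>'"
  have R: "representation n d \<rho>" and R': "representation n d' \<rho>'" using U U' by (auto simp: unitary_rep_def)
  note c = rep_carrier[OF R] rep_carrier[OF R']
  have kc: "kron (\<rho> X) (1\<^sub>m d') \<in> carrier_mat (d * d') (d * d')" "kron (1\<^sub>m d) (\<rho>' X) \<in> carrier_mat (d * d') (d * d')"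
    if "X \<in> so_odd n" for X using c that by auto
  have a: "?t (X + Y) = ?t X + ?t Y" if X: "X \<in> so_odd n" and Y: "Y \<in> so_odd n" for X Y
  proof -
    have "?t (X + Y) = (kron (\<rho> X) (1\<^sub>m d') + kron (\<rho> Y) (1\<^sub>m d')) + (kron (1\<^sub>m d) (\<rho>' X) + kron (1\<^sub>m d) (\<rho>' Y))"
      using c X Y by (simp add: tensor_rep_def rep_add[OF R] rep_add[OF R'] kron_add_left[of _ d d] kron_add_right[of _ d' d'])
    then show ?thesis using kc[OF X] kc[OF Y] by (auto simp: tensor_rep_def intro!: eq_matI)
  qed
  have s: "?t (z \<cdot>\<^sub>m X) = z \<cdot>\<^sub>m ?t X" if X: "X \<in> so_odd n" for z X
    using kc[OF X] by (simp add: tensor_rep_def rep_smult[OF R X] rep_smult[OF R' X] kron_smult_left kron_smult_right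
      add_smult_distrib_left_mat[of _ "d*d'" "d*d'"])
  have b: "?t (lie_bracket X Y) = lie_bracket (?t X) (?t Y)" if X: "X \<in> so_odd n" and Y: "Y \<in> so_odd n" for X Y
  proof -
    have x: "\<rho> X \<in> carrier_mat d d" "\<rho> Y \<in> carrier_mat d d" "\<rho>' X \<in> carrier_mat d' d'" "\<rho>' Y \<in> carrier_mat d' d'"
      using c X Y by auto
    have "lie_bracket (?t X) (?t Y) =
       (kron (\<rho> X) (1\<^sub>m d') * kron (\<rho> Y) (1\<^sub>m d') - kron (\<rho> Y) (1\<^sub>m d') * kron (\<rho> X) (1\<^sub>m d')) +
       (kron (1\<^sub>m d) (\<rho>' X) * kron (1\<^sub>m d) (\<rho>' Y) - kron (1\<^sub>m d) (\<rho>' Y) * kron (1\<^sub>m d) (\<rho>' X))"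
      unfolding lie_bracket_def tensor_rep_def
    proof (rule four_term_commutator)
      show "kron (\<rho> X) (1\<^sub>m d') * kron (1\<^sub>m d) (\<rho>' Y) = kron (1\<^sub>m d) (\<rho>' Y) * kron (\<rho> X) (1\<^sub>m d')"
        using x by (simp add: kron_mult[of _ d _ _ d'])
      show "kron (1\<^sub>m d) (\<rho>' X) * kron (\<rho> Y) (1\<^sub>m d') = kron (\<rho> Y) (1\<^sub>m d') * kron (1\<^sub>m d) (\<rho>' X)"
        using x by (simp add: kron_mult[of _ d _ _ d'])
    qed (use kc X Y in auto)
    also have "\<dots> = kron (\<rho> X * \<rho> Y - \<rho> Y * \<rho> X) (1\<^sub>m d') + kron (1\<^sub>m d) (\<rho>' X * \<rho>' Y - \<rho>' Y * \<rho>' X)"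
      using x by (simp add: kron_mult[of _ d _ _ d'] kron_minus_left[of _ d d] kron_minus_right[of _ d' d'])
    also have "\<dots> = ?t (lie_bracket X Y)"
      by (simp add: tensor_rep_def rep_bracket[OF R X Y] rep_bracket[OF R' X Y])
    finally show ?thesis ..
  qed
  have "?t (adj X) = adj (?t X)" if X: "X \<in> so_odd n" for X
    using U U' X kc[OF X] by (simp add: unitary_rep_def tensor_rep_def adj_add[of _ "d*d'" "d*d'"] adj_kron)
  then show ?thesis using a s b kc unfolding unitary_rep_def representation_def
    by (auto simp: tensor_rep_def)
qed

lemma vkron_smult_left: "vkron (c \<cdot>\<^sub>v x) z = c \<cdot>\<^sub>v vkron x z"
  by (rule eq_vecI) (auto simp: vkron_def div_less)

lemma vkron_smult_right: "vkron x (c \<cdot>\<^sub>v z) = c \<cdot>\<^sub>v vkron x z"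
  by (rule eq_vecI) (auto simp: vkron_def mod_less)

lemma vkron_zero_left: "x \<in> carrier_vec d' \<Longrightarrow> vkron (0\<^sub>v d) x = 0\<^sub>v (d * d')"
  by (rule eq_vecI) (auto simp: vkron_def div_less)

lemma vkron_zero_right: "x \<in> carrier_vec d \<Longrightarrow> vkron x (0\<^sub>v d') = 0\<^sub>v (d * d')"
  by (rule eq_vecI) (auto simp: vkron_def mod_less)

lemma tensor_mult_vkron:
  assumes "A \<in> carrier_mat d d" "B \<in> carrier_mat d' d'" "x \<in> carrier_vec d" "x' \<in> carrier_vec d'"
  shows "(kron A (1\<^sub>m d') + kron (1\<^sub>m d) B) *\<^sub>v vkron x x' = vkron (A *\<^sub>v x) x' + vkron x (B *\<^sub>v x')"
proof -
  have "(kron A (1\<^sub>m d') + kron (1\<^sub>m d) B) *\<^sub>v vkron x x' =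
      kron A (1\<^sub>m d') *\<^sub>v vkron x x' + kron (1\<^sub>m d) B *\<^sub>v vkron x x'"
    using assms by (intro add_mult_distrib_mat_vec[of _ "d*d'" "d*d'"]) auto
  then show ?thesis
    using assms kron_mult_vkron[OF assms(1) one_carrier_mat assms(3,4)] kron_mult_vkron[OF one_carrier_mat assms(2,3,4)]
    by simp
qed

text \<open>
  All ways of distributing the letters of a word to two words, as they occur in the Leibniz rule for a
  tensor product.
\<close>
fun splits :: "'a list \<Rightarrow> ('a list \<times> 'a list) list" where
  "splits [] = [([], [])]"
| "splits (x # xs) = map (\<lambda>(a, b). (x # a, b)) (splits xs) @ map (\<lambda>(a, b). (a, x # b)) (splits xs)"

lemma splits_subset: "(a, b) \<in> set (splits ws) \<Longrightarrow> set a \<subseteq> set ws \<and> set b \<subseteq> set ws"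
  by (induction ws arbitrary: a b) fastforce+

lemma splits_append: "(xs, ys) \<in> set (splits (xs @ ys))"
proof -
  have "([], ys) \<in> set (splits ys)" by (induction ys) force+
  then show ?thesis by (induction xs) force+
qed

text \<open>
  The first letter of the word is moved to the form, where it acts on one of the two tensor factors of
  \<open>vkron u u'\<close>; hence the induction over \<open>ws\<close> for arbitrary \<open>u\<close> and \<open>u'\<close>.
\<close>
lemma form_tensor_word:
  assumes R: "representation n d \<rho>" and R': "representation n d' \<rho>'"
    and v: "v \<in> carrier_vec d" "v' \<in> carrier_vec d'" and u: "u \<in> carrier_vec d" "u' \<in> carrier_vec d'"
    and ws: "set ws \<subseteq> {1..n}"
  shows "conjugate (vkron u u') \<bullet> yword n (tensor_rep d d' \<rho> \<rho>') ws (vkron v v') =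
    (\<Sum>(a, b)\<leftarrow>splits ws. (conjugate u \<bullet> yword n \<rho> a v) * (conjugate u' \<bullet> yword n \<rho>' b v'))"
  using u ws
proof (induction ws arbitrary: u u')
  case Nil
  then show ?case using form_vkron v by simp
next
  case (Cons i ws)
  let ?t = "tensor_rep d d' \<rho> \<rho>'" and ?A = "\<rho> (so_unit n 0 i)" and ?B = "\<rho>' (so_unit n 0 i)"
  interpret r: so_rep n d \<rho> by unfold_locales (rule R)
  interpret r': so_rep n d' \<rho>' by unfold_locales (rule R')
  have i: "i \<in> {1..n}" and ws: "set ws \<subseteq> {1..n}" using Cons.prems by auto
  have c: "?A \<in> carrier_mat d d" "?B \<in> carrier_mat d' d'" using i by auto
  have uc: "adj ?A *\<^sub>v u \<in> carrier_vec d" "adj ?B *\<^sub>v u' \<in> carrier_vec d'"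
    using mult_mat_vec_carrier[OF adj_carrier[OF c(1)] Cons.prems(1)]
      mult_mat_vec_carrier[OF adj_carrier[OF c(2)] Cons.prems(2)] by auto
  have tc: "?t (so_unit n 0 j) \<in> carrier_mat (d * d') (d * d')" if "j \<in> {1..n}" for j
    using that r.y_carrier r'.y_carrier by (auto simp: tensor_rep_def)
  have Yc: "yword n ?t ws (vkron v v') \<in> carrier_vec (d * d')"
    using ws by (induction ws) (use v tc in \<open>auto intro!: mult_mat_vec_carrier\<close>)
  have at: "adj (?t (so_unit n 0 i)) = kron (adj ?A) (1\<^sub>m d') + kron (1\<^sub>m d) (adj ?B)"
    unfolding tensor_rep_def using c by (subst adj_add[of _ "d*d'" "d*d'"]) (auto simp: adj_kron)
  have "conjugate (vkron u u') \<bullet> yword n ?t (i # ws) (vkron v v') =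
      conjugate (adj (?t (so_unit n 0 i)) *\<^sub>v vkron u u') \<bullet> yword n ?t ws (vkron v v')"
    unfolding yword_simps by (rule form_adj[OF tc[OF i] _ Yc]) (use Cons.prems in auto)
  also have "adj (?t (so_unit n 0 i)) *\<^sub>v vkron u u' = vkron (adj ?A *\<^sub>v u) u' + vkron u (adj ?B *\<^sub>v u')"
    unfolding at by (rule tensor_mult_vkron) (use c Cons.prems in auto)
  also have "conjugate \<dots> = conjugate (vkron (adj ?A *\<^sub>v u) u') + conjugate (vkron u (adj ?B *\<^sub>v u'))"
    using uc Cons.prems by (intro conjugate_add_vec[of _ "d*d'"]) auto
  also have "\<dots> \<bullet> yword n ?t ws (vkron v v') =
      conjugate (vkron (adj ?A *\<^sub>v u) u') \<bullet> yword n ?t ws (vkron v v')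
      + conjugate (vkron u (adj ?B *\<^sub>v u')) \<bullet> yword n ?t ws (vkron v v')"
    using uc Cons.prems Yc by (intro add_scalar_prod_distrib[of _ "d*d'"]) auto
  also have "conjugate (vkron (adj ?A *\<^sub>v u) u') \<bullet> yword n ?t ws (vkron v v') =
      (\<Sum>(a, b)\<leftarrow>splits ws. (conjugate u \<bullet> yword n \<rho> (i # a) v) * (conjugate u' \<bullet> yword n \<rho>' b v'))"
  proof -
    have "conjugate (adj ?A *\<^sub>v u) \<bullet> yword n \<rho> a v = conjugate u \<bullet> yword n \<rho> (i # a) v"
      if "(a, b) \<in> set (splits ws)" for a b
      using form_adj[OF c(1) Cons.prems(1) r.yword_carrier[OF _ v(1)], of a] splits_subset[OF that] ws by auto
    then show ?thesis using Cons.IH[OF uc(1) Cons.prems(2) ws]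
      by (auto intro!: arg_cong[where f=sum_list] map_cong)
  qed
  also have "conjugate (vkron u (adj ?B *\<^sub>v u')) \<bullet> yword n ?t ws (vkron v v') =
      (\<Sum>(a, b)\<leftarrow>splits ws. (conjugate u \<bullet> yword n \<rho> a v) * (conjugate u' \<bullet> yword n \<rho>' (i # b) v'))"
  proof -
    have "conjugate (adj ?B *\<^sub>v u') \<bullet> yword n \<rho>' b v' = conjugate u' \<bullet> yword n \<rho>' (i # b) v'"
      if "(a, b) \<in> set (splits ws)" for a b
      using form_adj[OF c(2) Cons.prems(2) r'.yword_carrier[OF _ v(2)], of b] splits_subset[OF that] ws by auto
    then show ?thesis using Cons.IH[OF Cons.prems(1) uc(2) ws]
      by (auto intro!: arg_cong[where f=sum_list] map_cong)
  qed
  finally show ?case unfolding splits.simps map_append sum_list_append map_map comp_def case_prod_unfold fst_conv snd_conv .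
qed

lemma eval_weight_add: "eval_weight n (l + l') H = eval_weight n l H + eval_weight n l' H"
  by (simp add: eval_weight_def algebra_simps sum.distrib)

lemma sum_list_const_filter:
  assumes "\<And>x. x \<in> set xs \<Longrightarrow> f x = (if P x then c else (0::complex))"
  shows "sum_list (map f xs) = of_nat (length (filter P xs)) * c"
  using assms by (induction xs) (auto simp: algebra_simps)

text \<open>
  In the Leibniz expansion of the pairing, only those splittings of \<open>ws @ ws'\<close> contribute whose parts are
  rearrangements of \<open>ws\<close> and \<open>ws'\<close>.  All of them contribute the same nonzero product, and the splitting
  into \<open>ws\<close> and \<open>ws'\<close> is one of them.
\<close>
lemma witness_tensor:
  assumes W: "witness n l ws d \<rho> v u" and W': "witness n l' ws' d' \<rho>' v' u'"
  shows "witness n (l + l') (ws @ ws') (d * d') (tensor_rep d d' \<rho> \<rho>') (vkron v v') (vkron u u')"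
proof -
  let ?t = "tensor_rep d d' \<rho> \<rho>'"
  have U: "unitary_rep n d \<rho>" "unitary_rep n d' \<rho>'" and R: "representation n d \<rho>" "representation n d' \<rho>'"
    and hw: "hw_vector n l d \<rho> v" "hw_vector n l' d' \<rho>' v'" and ws: "set ws \<subseteq> {1..n}" "set ws' \<subseteq> {1..n}"
    and u: "hw_vector_D n (\<lambda>k. l k - of_nat (count (mset ws) k)) d \<rho> u"
      "hw_vector_D n (\<lambda>k. l' k - of_nat (count (mset ws') k)) d' \<rho>' u'"
    and nz: "conjugate u \<bullet> yword n \<rho> ws v \<noteq> 0" "conjugate u' \<bullet> yword n \<rho>' ws' v' \<noteq> 0"
    using W W' by (auto simp: witness_def unitary_rep_def)
  have vc: "v \<in> carrier_vec d" "v' \<in> carrier_vec d'" and uc: "u \<in> carrier_vec d" "u' \<in> carrier_vec d'"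
    using hw u by (auto simp: hw_vector_def hw_vector_D_def)
  interpret r: so_rep n d \<rho> by unfold_locales (rule R)
  interpret r': so_rep n d' \<rho>' by unfold_locales (rule R)
  have act: "?t X *\<^sub>v vkron x x' = vkron (\<rho> X *\<^sub>v x) x' + vkron x (\<rho>' X *\<^sub>v x')"
    if "X \<in> so_odd n" "x \<in> carrier_vec d" "x' \<in> carrier_vec d'" for X x x'
    unfolding tensor_rep_def using that rep_carrier[OF R(1)] rep_carrier[OF R(2)]
    by (intro tensor_mult_vkron) auto
  have eig: "?t X *\<^sub>v vkron x x' = (c + c') \<cdot>\<^sub>v vkron x x'"
    if "X \<in> so_odd n" "x \<in> carrier_vec d" "x' \<in> carrier_vec d'" "\<rho> X *\<^sub>v x = c \<cdot>\<^sub>v x" "\<rho>' X *\<^sub>v x' = c' \<cdot>\<^sub>v x'" for X x x' c c'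
    unfolding act[OF that(1-3)] that(4,5) vkron_smult_left vkron_smult_right
    by (rule eq_vecI) (auto simp: algebra_simps)
  have kill: "?t X *\<^sub>v vkron x x' = 0\<^sub>v (d * d')"
    if "X \<in> so_odd n" "x \<in> carrier_vec d" "x' \<in> carrier_vec d'" "\<rho> X *\<^sub>v x = 0\<^sub>v d" "\<rho>' X *\<^sub>v x' = 0\<^sub>v d'" for X x x'
    unfolding act[OF that(1-3)] that(4,5) vkron_zero_left[OF that(3)] vkron_zero_right[OF that(2)] by simp
  have "hw_vector n (l + l') (d * d') ?t (vkron v v')"
    unfolding hw_vector_def
  proof (intro conjI ballI)
    show "vkron v v' \<in> carrier_vec (d * d')" using vc by simp
    show "?t H *\<^sub>v vkron v v' = eval_weight n (l + l') H \<cdot>\<^sub>v vkron v v'" if "H \<in> cartan n" for H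
      unfolding eval_weight_add by (rule eig) (use that vc hw in \<open>auto simp: cartan_so_odd hw_vector_def\<close>)
    show "?t X *\<^sub>v vkron v v' = 0\<^sub>v (d * d')" if "\<alpha> \<in> set (pos_roots n)" "X \<in> root_space (so_odd n) n \<alpha>" for \<alpha> X
      by (rule kill) (use that vc hw in \<open>auto simp: root_space_def hw_vector_def\<close>)
  qed
  moreover have "hw_vector_D n (\<lambda>k. (l + l') k - of_nat (count (mset (ws @ ws')) k)) (d * d') ?t (vkron u u')"
    unfolding hw_vector_D_def
  proof (intro conjI ballI)
    show "vkron u u' \<in> carrier_vec (d * d')" using uc by simp
    show "?t (so_unit n k k) *\<^sub>v vkron u u' = ((l + l') k - of_nat (count (mset (ws @ ws')) k)) \<cdot>\<^sub>v vkron u u'"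
      if k: "k \<in> {1..n}" for k
    proof -
      have "?t (so_unit n k k) *\<^sub>v vkron u u' =
        ((l k - of_nat (count (mset ws) k)) + (l' k - of_nat (count (mset ws') k))) \<cdot>\<^sub>v vkron u u'"
        by (rule eig) (use k uc u in \<open>auto simp: hw_vector_D_def\<close>)
      then show ?thesis by (simp add: algebra_simps)
    qed
    show "?t X *\<^sub>v vkron u u' = 0\<^sub>v (d * d')" if "\<alpha> \<in> pos_roots_D n" "X \<in> root_space (so_odd n) n \<alpha>" for \<alpha> X
      by (rule kill) (use that uc u in \<open>auto simp: root_space_def hw_vector_D_def\<close>)
  qed
  moreover have "conjugate (vkron u u') \<bullet> yword n ?t (ws @ ws') (vkron v v') \<noteq> 0"
  proof -
    let ?C = "(conjugate u \<bullet> yword n \<rho> ws v) * (conjugate u' \<bullet> yword n \<rho>' ws' v')"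
    let ?P = "\<lambda>(a, b). mset a = mset ws \<and> mset b = mset ws'"
    let ?f = "\<lambda>(a, b). (conjugate u \<bullet> yword n \<rho> a v) * (conjugate u' \<bullet> yword n \<rho>' b v')"
    have f: "?f x = (if ?P x then ?C else 0)" if "x \<in> set (splits (ws @ ws'))" for x
    proof -
      obtain a b where x: "x = (a, b)" by (cases x)
      have ab: "set a \<subseteq> {1..n}" "set b \<subseteq> {1..n}" using splits_subset[of a b "ws @ ws'"] that x ws by auto
      show ?thesis
      proof (cases "?P x")
        case True
        then have "conjugate u \<bullet> yword n \<rho> ([] @ a) v = conjugate u \<bullet> yword n \<rho> ([] @ ws) v"
          using x by (intro r.annihilates_mset[OF hw_vector_D_annihilates[OF U(1) u(1)] vc(1) _ ab(1)]) auto
        moreover have "conjugate u' \<bullet> yword n \<rho>' ([] @ b) v' = conjugate u' \<bullet> yword n \<rho>' ([] @ ws') v'"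
          using True x by (intro r'.annihilates_mset[OF hw_vector_D_annihilates[OF U(2) u(2)] vc(2) _ ab(2)]) auto
        ultimately show ?thesis using True x by simp
      next
        case False
        then have "conjugate u \<bullet> yword n \<rho> a v = 0 \<or> conjugate u' \<bullet> yword n \<rho>' b v' = 0"
          using witness_mset[OF W ab(1)] witness_mset[OF W' ab(2)] x by auto
        then show ?thesis using False x by auto
      qed
    qed
    have ws2: "set (ws @ ws') \<subseteq> {1..n}" using ws by simp
    have "conjugate (vkron u u') \<bullet> yword n ?t (ws @ ws') (vkron v v') =
      of_nat (length (filter ?P (splits (ws @ ws')))) * ?C"
      unfolding form_tensor_word[OF R vc uc ws2] by (rule sum_list_const_filter) (rule f)
    moreover have "(ws, ws') \<in> set (filter ?P (splits (ws @ ws')))" using splits_append[of ws ws'] by simp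
    then have "length (filter ?P (splits (ws @ ws'))) \<noteq> 0" by (metis length_0_conv list.distinct(1) list.set_cases)
    ultimately show ?thesis using nz by simp
  qed
  ultimately show ?thesis using tensor_unitary[OF U] ws by (simp add: witness_def)
qed

lemma witness_zero: "witness n 0 [] 1 (\<lambda>X. 0\<^sub>m 1 1) (vec 1 (\<lambda>_. 1)) (vec 1 (\<lambda>_. 1))"
proof -
  have z: "0\<^sub>m 1 1 *\<^sub>v vec 1 (\<lambda>_. 1 :: complex) = 0\<^sub>v 1" "0 \<cdot>\<^sub>v vec 1 (\<lambda>_. 1 :: complex) = 0\<^sub>v 1" 
    by (rule eq_vecI; simp)+
  have "representation n 1 (\<lambda>X. 0\<^sub>m 1 1)"
    by (auto simp: representation_def lie_bracket_def intro!: eq_matI)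
  moreover have "adj (0\<^sub>m 1 1) = 0\<^sub>m 1 1" by (rule eq_matI) auto
  moreover have "conjugate (vec 1 (\<lambda>_. 1 :: complex)) \<bullet> vec 1 (\<lambda>_. 1) \<noteq> 0"
    by (simp add: scalar_prod_def)
  ultimately show ?thesis
    using z by (simp add: witness_def unitary_rep_def hw_vector_def hw_vector_D_def eval_weight_def)
qed

section \<open>Passing to an irreducible summand\<close>

lemma mult_mat_zero_vec: "A \<in> carrier_mat m k \<Longrightarrow> A *\<^sub>v 0\<^sub>v k = 0\<^sub>v m" for A :: "complex mat"
  by (rule eq_vecI) (auto simp: scalar_prod_def)

definition subspace_of :: "nat \<Rightarrow> complex vec set \<Rightarrow> bool" where
  "subspace_of d W \<longleftrightarrow> W \<subseteq> carrier_vec d \<and> 0\<^sub>v d \<in> W \<and>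
     (\<forall>u\<in>W. \<forall>w\<in>W. u + w \<in> W) \<and> (\<forall>c. \<forall>w\<in>W. c \<cdot>\<^sub>v w \<in> W)"

text \<open>
  The columns of \<open>B\<close> form an orthonormal system in \<open>W\<close>.
\<close>
definition isometry_into :: "nat \<Rightarrow> nat \<Rightarrow> complex vec set \<Rightarrow> complex mat \<Rightarrow> bool" where
  "isometry_into d k W B \<longleftrightarrow> B \<in> carrier_mat d k \<and> adj B * B = 1\<^sub>m k \<and> (\<forall>x\<in>carrier_vec k. B *\<^sub>v x \<in> W)"

lemma isometry_dim:
  assumes B: "B \<in> carrier_mat d k" and I: "adj B * B = 1\<^sub>m k"
  shows "k \<le> d"
proof (rule ccontr)
  assume "\<not> k \<le> d"
  then have dk: "d < k" by simp
  \<comment> \<open>pad \<open>B\<close> with zero rows to a square matrix\<close>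
  define A where "A = mat k k (\<lambda>(i, j). if i < d then B $$ (i, j) else 0)"
  have A: "A \<in> carrier_mat k k" by (simp add: A_def)
  have "adj A * A = 1\<^sub>m k"
  proof (rule eq_matI)
    fix i j assume "i < dim_row (1\<^sub>m k :: complex mat)" "j < dim_col (1\<^sub>m k :: complex mat)"
    then have ij: "i < k" "j < k" by auto
    have "(adj A * A) $$ (i, j) = (\<Sum>c<k. adj A $$ (i, c) * A $$ (c, j))"
      using A ij by (intro index_mult_sum) auto
    also have "\<dots> = (\<Sum>c<k. if c < d then cnj (B $$ (c, i)) * B $$ (c, j) else 0)"
      using ij by (intro sum.cong) (auto simp: A_def)
    also have "\<dots> = (\<Sum>c<d. cnj (B $$ (c, i)) * B $$ (c, j))"
      using dk by (intro sum.mono_neutral_cong_right) auto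
    also have "\<dots> = (\<Sum>c<d. adj B $$ (i, c) * B $$ (c, j))"
      using ij B by (intro sum.cong) auto
    also have "\<dots> = (adj B * B) $$ (i, j)"
      using ij B by (intro index_mult_sum[symmetric]) auto
    finally show "(adj A * A) $$ (i, j) = 1\<^sub>m k $$ (i, j)" using I by simp
  qed (use A in auto)
  then have "A * adj A = 1\<^sub>m k"
    using mat_mult_left_right_inverse[OF adj_carrier[OF A] A] by simp
  then have "(A * adj A) $$ (d, d) = 1" using dk by simp
  moreover have "(A * adj A) $$ (d, d) = (\<Sum>c<k. A $$ (d, c) * adj A $$ (c, d))"
    using A dk by (intro index_mult_sum) auto
  moreover have "\<dots> = 0" using dk by (intro sum.neutral) (auto simp: A_def)
  ultimately show False by simp
qed

lemma form_self_real: 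
  fixes r :: "complex vec"
  shows "conjugate r \<bullet> r = of_real (\<Sum>i<dim_vec r. (cmod (r $ i))\<^sup>2)"
proof -
  have "cnj z * z = of_real ((cmod z)\<^sup>2)" for z by (metis complex_norm_square mult.commute)
  then show ?thesis by (simp add: scalar_prod_def lessThan_atLeast0 del: of_real_power)
qed

text \<open>
  One step of the Gram-Schmidt process: the new column is the normalised component of \<open>w\<close> orthogonal to
  the range of \<open>B\<close>.
\<close>
lemma isometry_extend:
  assumes W: "subspace_of d W" and B: "isometry_into d k W B"
    and w: "w \<in> W" "B *\<^sub>v (adj B *\<^sub>v w) \<noteq> w"
  shows "\<exists>B'. isometry_into d (Suc k) W B'"
proof -
  have Bc: "B \<in> carrier_mat d k" and I: "adj B * B = 1\<^sub>m k" and rg: "\<And>x. x \<in> carrier_vec k \<Longrightarrow> B *\<^sub>v x \<in> W"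
    using B by (auto simp: isometry_into_def)
  have aB: "adj B \<in> carrier_mat k d" using Bc by simp
  have wc: "w \<in> carrier_vec d" using W w by (auto simp: subspace_of_def)
  have aw: "adj B *\<^sub>v w \<in> carrier_vec k" using mult_mat_vec_carrier[OF aB wc] .
  have Pw: "B *\<^sub>v (adj B *\<^sub>v w) \<in> W" "B *\<^sub>v (adj B *\<^sub>v w) \<in> carrier_vec d"
    using rg[OF aw] mult_mat_vec_carrier[OF Bc aw] by auto
  define r where "r = w - B *\<^sub>v (adj B *\<^sub>v w)"
  have rc: "r \<in> carrier_vec d" using wc Pw by (simp add: r_def)
  have "r = w + (-1) \<cdot>\<^sub>v (B *\<^sub>v (adj B *\<^sub>v w))" using wc Pw by (auto simp: r_def)
  then have rW: "r \<in> W" using W w Pw by (simp add: subspace_of_def)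
  have r0: "r \<noteq> 0\<^sub>v d"
  proof
    assume "r = 0\<^sub>v d"
    then have "w $ i = (B *\<^sub>v (adj B *\<^sub>v w)) $ i" if "i < d" for i
      using that wc Pw(2) unfolding r_def by (metis carrier_vecD index_minus_vec(1) index_zero_vec(1) right_minus_eq)
    then show False using w(2) wc Pw(2) by (metis carrier_vecD eq_vecI)
  qed
  have ar: "adj B *\<^sub>v r = 0\<^sub>v k"
  proof -
    have "adj B *\<^sub>v r = adj B *\<^sub>v w - adj B *\<^sub>v (B *\<^sub>v (adj B *\<^sub>v w))"
      unfolding r_def by (rule mult_minus_distrib_mat_vec[OF aB wc Pw(2)])
    also have "adj B *\<^sub>v (B *\<^sub>v (adj B *\<^sub>v w)) = adj B *\<^sub>v w"
      using assoc_mult_mat_vec[OF aB Bc aw] I aw by simp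
    finally show ?thesis using aw by simp
  qed
  define N where "N = (\<Sum>i<d. (cmod (r $ i))\<^sup>2)"
  have rr: "conjugate r \<bullet> r = of_real N" using form_self_real[of r] rc by (simp add: N_def)
  then have "N \<noteq> 0" using form_self_eq_0[OF rc] r0 by auto
  then have N: "N > 0" unfolding N_def by (metis less_eq_real_def sum_nonneg zero_le_power2)
  define s where "s = (1 / of_real (sqrt N) :: complex) \<cdot>\<^sub>v r"
  have sc: "s \<in> carrier_vec d" and sW: "s \<in> W" using rc rW W by (auto simp: s_def subspace_of_def)
  have ss: "conjugate s \<bullet> s = 1"
  proof -
    have "conjugate s \<bullet> s = (1 / of_real (sqrt N)) * ((1 / of_real (sqrt N)) * (conjugate r \<bullet> r))"
      using rc by (simp add: s_def conjugate_smult_vec)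
    then show ?thesis using N rr by (simp add: field_simps flip: of_real_mult)
  qed
  have as: "adj B *\<^sub>v s = 0\<^sub>v k"
    unfolding s_def mult_mat_vec[OF aB rc] ar by (rule eq_vecI) auto
  define B' where "B' = mat d (Suc k) (\<lambda>(i, j). if j < k then B $$ (i, j) else s $ i)"
  have B'c: "B' \<in> carrier_mat d (Suc k)" by (simp add: B'_def)
  have "adj B' * B' = 1\<^sub>m (Suc k)"
  proof (rule eq_matI)
    fix i j assume "i < dim_row (1\<^sub>m (Suc k) :: complex mat)" "j < dim_col (1\<^sub>m (Suc k) :: complex mat)"
    then have ij: "i < Suc k" "j < Suc k" by auto
    have "(adj B' * B') $$ (i, j) = (\<Sum>c<d. adj B' $$ (i, c) * B' $$ (c, j))"
      using B'c ij by (intro index_mult_sum) auto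
    also have "\<dots> = (\<Sum>c<d. cnj (B' $$ (c, i)) * B' $$ (c, j))"
      using ij B'c by (intro sum.cong) auto
    finally have e: "(adj B' * B') $$ (i, j) = (\<Sum>c<d. cnj (B' $$ (c, i)) * B' $$ (c, j))" .
    have z: "(\<Sum>c<d. cnj (B $$ (c, p)) * s $ c) = 0" if "p < k" for p
    proof -
      have "(\<Sum>c<d. cnj (B $$ (c, p)) * s $ c) = (\<Sum>c<d. adj B $$ (p, c) * s $ c)"
        using that Bc by (intro sum.cong) auto
      also have "\<dots> = (adj B *\<^sub>v s) $ p"
        using that by (intro index_mult_vec_sum[OF aB sc, symmetric])
      finally show ?thesis using as that by simp
    qed
    have z': "(\<Sum>c<d. cnj (s $ c) * B $$ (c, p)) = 0" if "p < k" for p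
      using arg_cong[OF z[OF that], of cnj] by (simp add: mult.commute)
    have b: "(\<Sum>c<d. cnj (B $$ (c, p)) * B $$ (c, q)) = (if p = q then 1 else 0)" if "p < k" "q < k" for p q
    proof -
      have "(\<Sum>c<d. cnj (B $$ (c, p)) * B $$ (c, q)) = (\<Sum>c<d. adj B $$ (p, c) * B $$ (c, q))"
        using that Bc by (intro sum.cong) auto
      also have "\<dots> = (adj B * B) $$ (p, q)" using that Bc by (intro index_mult_sum[symmetric]) auto
      finally show ?thesis using I that by simp
    qed
    have s1: "(\<Sum>c<d. cnj (s $ c) * s $ c) = 1"
      using ss sc by (simp add: scalar_prod_sum[OF sc])
    show "(adj B' * B') $$ (i, j) = 1\<^sub>m (Suc k) $$ (i, j)"
      unfolding e using ij z z' b s1 by (auto simp: B'_def less_Suc_eq)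
  qed (use B'c in auto)
  moreover have "B' *\<^sub>v x \<in> W" if x: "x \<in> carrier_vec (Suc k)" for x
  proof -
    define x' where "x' = vec k (\<lambda>i. x $ i)"
    have "B' *\<^sub>v x = B *\<^sub>v x' + x $ k \<cdot>\<^sub>v s"
    proof (rule eq_vecI)
      fix i assume "i < dim_vec (B *\<^sub>v x' + x $ k \<cdot>\<^sub>v s)"
      then have i: "i < d" using sc by simp
      have "(B' *\<^sub>v x) $ i = (\<Sum>c<Suc k. B' $$ (i, c) * x $ c)"
        by (rule index_mult_vec_sum[OF B'c x i])
      also have "\<dots> = (\<Sum>c<k. B $$ (i, c) * x' $ c) + x $ k * s $ i"
        using i by (simp add: B'_def x'_def)
      also have "(\<Sum>c<k. B $$ (i, c) * x' $ c) = (B *\<^sub>v x') $ i"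
        using i by (intro index_mult_vec_sum[OF Bc, symmetric]) (auto simp: x'_def)
      finally show "(B' *\<^sub>v x) $ i = (B *\<^sub>v x' + x $ k \<cdot>\<^sub>v s) $ i" using i sc by simp
    qed (use B'c sc in auto)
    moreover have "B *\<^sub>v x' \<in> W" by (rule rg) (simp add: x'_def)
    ultimately show ?thesis using W sW by (simp add: subspace_of_def)
  qed
  ultimately show ?thesis using B'c by (auto simp: isometry_into_def)
qed

text \<open>
  An orthonormal system of greatest length spans \<open>W\<close>.
\<close>
lemma isometry_onto:
  assumes W: "subspace_of d W"
  obtains k B where "isometry_into d k W B" "\<And>w. w \<in> W \<Longrightarrow> B *\<^sub>v (adj B *\<^sub>v w) = w"
    "W \<noteq> carrier_vec d \<Longrightarrow> k < d"
proof -
  let ?P = "\<lambda>k. \<exists>B. isometry_into d k W B"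
  have P0: "?P 0"
  proof (intro exI)
    have "mat d 0 (\<lambda>_. 0) *\<^sub>v x = 0\<^sub>v d" if "x \<in> carrier_vec 0" for x :: "complex vec"
      by (rule eq_vecI) (use that in \<open>auto simp: scalar_prod_def\<close>)
    then show "isometry_into d 0 W (mat d 0 (\<lambda>_. 0))"
      using W by (auto simp: isometry_into_def subspace_of_def intro!: eq_matI)
  qed
  have bd: "k \<le> d" if "?P k" for k using that isometry_dim by (auto simp: isometry_into_def)
  define k where "k = (GREATEST k. ?P k)"
  have "?P k" unfolding k_def using P0 bd by (rule GreatestI_nat)
  then obtain B where B: "isometry_into d k W B" by blast
  have fix_w: "B *\<^sub>v (adj B *\<^sub>v w) = w" if "w \<in> W" for w
  proof (rule ccontr)
    assume "B *\<^sub>v (adj B *\<^sub>v w) \<noteq> w"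
    then have "?P (Suc k)" using isometry_extend[OF W B that] by blast
    then have "Suc k \<le> k" unfolding k_def using bd by (rule Greatest_le_nat)
    then show False by simp
  qed
  have "k < d" if "W \<noteq> carrier_vec d"
  proof (rule ccontr)
    assume "\<not> k < d"
    then have kd: "k = d" using bd[OF \<open>?P k\<close>] by simp
    have Bc: "B \<in> carrier_mat d d" and I: "adj B * B = 1\<^sub>m d" and rg: "\<And>x. x \<in> carrier_vec d \<Longrightarrow> B *\<^sub>v x \<in> W"
      using B kd by (auto simp: isometry_into_def)
    have "B * adj B = 1\<^sub>m d" using mat_mult_left_right_inverse[OF adj_carrier[OF Bc] Bc I] .
    then have "x \<in> W" if "x \<in> carrier_vec d" for x
      using rg[OF mult_mat_vec_carrier[OF adj_carrier[OF Bc] that]] assoc_mult_mat_vec[OF Bc adj_carrier[OF Bc] that] that by simp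
    then show False using that W by (auto simp: subspace_of_def)
  qed
  then show ?thesis using that B fix_w by blast
qed

lemma submodule_subspace: "submodule n d \<rho> W \<Longrightarrow> subspace_of d W"
  by (auto simp: submodule_def subspace_of_def)

lemma mat_eq_if_mult_vec_eq:
  fixes A A' :: "complex mat"
  assumes A: "A \<in> carrier_mat m k" and A': "A' \<in> carrier_mat m k"
    and e: "\<And>x. x \<in> carrier_vec k \<Longrightarrow> A *\<^sub>v x = A' *\<^sub>v x"
  shows "A = A'"
proof (rule eq_matI)
  fix i j assume ij: "i < dim_row A'" "j < dim_col A'"
  have "(A *\<^sub>v unit_vec k j) $ i = (A' *\<^sub>v unit_vec k j) $ i" using e by simp
  moreover have "(C *\<^sub>v unit_vec k j) $ i = C $$ (i, j)" if C: "C \<in> carrier_mat m k" for C :: "complex mat"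
  proof -
    have "(C *\<^sub>v unit_vec k j) $ i = (\<Sum>c<k. C $$ (i, c) * unit_vec k j $ c)"
      using C ij A' by (intro index_mult_vec_sum) auto
    also have "\<dots> = (\<Sum>c<k. if c = j then C $$ (i, j) else 0)" 
      using ij A' by (intro sum.cong) auto
    finally show ?thesis using ij A' by simp
  qed
  ultimately show "A $$ (i, j) = A' $$ (i, j)" using A A' by simp
qed (use A A' in auto)

text \<open>
  Since \<open>W\<close> and its orthogonal complement are submodules, the coordinate map \<open>adj B\<close> of the orthogonal
  projection to \<open>W\<close> is a homomorphism of modules.  It carries highest weight vectors to such vectors or
  to zero, and only the pairing can be lost.
\<close>
lemma restrict_witness:
  assumes Wt: "witness n l ws d \<rho> v u" and W: "submodule n d \<rho> W" and B: "isometry_into d k W B"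
    and onto: "\<And>w. w \<in> W \<Longrightarrow> B *\<^sub>v (adj B *\<^sub>v w) = w"
  shows "X \<in> so_odd n \<Longrightarrow> adj B * \<rho> X = (adj B * \<rho> X * B) * adj B"
    and "conjugate u \<bullet> (B *\<^sub>v (adj B *\<^sub>v yword n \<rho> ws v)) \<noteq> 0 \<Longrightarrow>
      witness n l ws k (\<lambda>X. adj B * \<rho> X * B) (adj B *\<^sub>v v) (adj B *\<^sub>v u)"
proof -
  have U: "unitary_rep n d \<rho>" and hw: "hw_vector n l d \<rho> v" and ws: "set ws \<subseteq> {1..n}"
    and u: "hw_vector_D n (\<lambda>k. l k - of_nat (count (mset ws) k)) d \<rho> u"
    using Wt by (auto simp: witness_def)
  have R: "representation n d \<rho>" using U by (simp add: unitary_rep_def)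
  have vc: "v \<in> carrier_vec d" and uc: "u \<in> carrier_vec d" using hw u by (auto simp: hw_vector_def hw_vector_D_def)
  have Bc: "B \<in> carrier_mat d k" and I: "adj B * B = 1\<^sub>m k" and rg: "\<And>x. x \<in> carrier_vec k \<Longrightarrow> B *\<^sub>v x \<in> W"
    using B by (auto simp: isometry_into_def)
  have aB: "adj B \<in> carrier_mat k d" using Bc by simp
  let ?r = "\<lambda>X. adj B * \<rho> X * B"
  note c = rep_carrier[OF R]
  have aR: "adj B * \<rho> X \<in> carrier_mat k d" if "X \<in> so_odd n" for X using aB c[OF that] by (rule mult_carrier_mat)
  have rc: "?r X \<in> carrier_mat k k" if "X \<in> so_odd n" for X using aR[OF that] Bc by (rule mult_carrier_mat)
  have K1: "\<rho> X * B = B * ?r X" if X: "X \<in> so_odd n" for X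
  proof (rule mat_eq_if_mult_vec_eq)
    show "\<rho> X * B \<in> carrier_mat d k" using c[OF X] Bc by (rule mult_carrier_mat)
    show "B * ?r X \<in> carrier_mat d k" using Bc rc[OF X] by (rule mult_carrier_mat)
    fix x :: "complex vec" assume x: "x \<in> carrier_vec k"
    have Bx: "B *\<^sub>v x \<in> carrier_vec d" using mult_mat_vec_carrier[OF Bc x] .
    have RBx: "\<rho> X *\<^sub>v (B *\<^sub>v x) \<in> carrier_vec d" using mult_mat_vec_carrier[OF c[OF X] Bx] .
    have "\<rho> X *\<^sub>v (B *\<^sub>v x) \<in> W" using W X rg[OF x] by (simp add: submodule_def)
    then have "B *\<^sub>v (adj B *\<^sub>v (\<rho> X *\<^sub>v (B *\<^sub>v x))) = \<rho> X *\<^sub>v (B *\<^sub>v x)" by (rule onto)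
    moreover have "?r X *\<^sub>v x = adj B *\<^sub>v (\<rho> X *\<^sub>v (B *\<^sub>v x))"
      using assoc_mult_mat_vec[OF aR[OF X] Bc x] assoc_mult_mat_vec[OF aB c[OF X] Bx] by simp
    ultimately show "(\<rho> X * B) *\<^sub>v x = (B * ?r X) *\<^sub>v x"
      using assoc_mult_mat_vec[OF c[OF X] Bc x] assoc_mult_mat_vec[OF Bc rc[OF X] x] by simp
  qed
  have adr: "adj (?r (adj X)) = ?r X" if X: "X \<in> so_odd n" for X
  proof -
    have "adj (?r (adj X)) = adj B * (adj (\<rho> (adj X)) * adj (adj B))"
      using aR[OF adj_so_odd[OF X]] Bc adj_mult[OF aB c[OF adj_so_odd[OF X]]]
      by (simp add: adj_mult[of _ k d _ k])
    also have "adj (\<rho> (adj X)) = \<rho> X" using U X by (simp add: unitary_rep_def)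
    finally show ?thesis using assoc_mult_mat[OF aB c[OF X] Bc] by simp
  qed
  have K2: "adj B * \<rho> X = ?r X * adj B" if X: "X \<in> so_odd n" for X
  proof -
    have "adj (\<rho> (adj X) * B) = adj (B * ?r (adj X))" using K1[OF adj_so_odd[OF X]] by simp
    then have "adj B * adj (\<rho> (adj X)) = adj (?r (adj X)) * adj B"
      using adj_mult[OF c[OF adj_so_odd[OF X]] Bc] adj_mult[OF Bc rc[OF adj_so_odd[OF X]]] by simp
    moreover have "adj (\<rho> (adj X)) = \<rho> X" using U X by (simp add: unitary_rep_def)
    ultimately show ?thesis using adr[OF X] by simp
  qed
  then show "X \<in> so_odd n \<Longrightarrow> adj B * \<rho> X = (adj B * \<rho> X * B) * adj B" .
  have act: "?r X *\<^sub>v (adj B *\<^sub>v x) = adj B *\<^sub>v (\<rho> X *\<^sub>v x)" if "X \<in> so_odd n" "x \<in> carrier_vec d" for X x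
    using assoc_mult_mat_vec[OF rc[OF that(1)] aB that(2)] assoc_mult_mat_vec[OF aB c[OF that(1)] that(2)] K2[OF that(1)]
    by simp
  have prod: "?r X * ?r Y = adj B * (\<rho> X * \<rho> Y) * B" if X: "X \<in> so_odd n" and Y: "Y \<in> so_odd n" for X Y
  proof -
    have "?r X * ?r Y = ?r X * (adj B * (\<rho> Y * B))" using assoc_mult_mat[OF aB c[OF Y] Bc] by simp
    also have "\<dots> = (?r X * adj B) * (\<rho> Y * B)"
      by (rule assoc_mult_mat[OF rc[OF X] aB mult_carrier_mat[OF c[OF Y] Bc], symmetric])
    also have "\<dots> = (adj B * \<rho> X) * (\<rho> Y * B)" using K2[OF X] by simp
    also have "\<dots> = (adj B * \<rho> X * \<rho> Y) * B" by (rule assoc_mult_mat[OF aR[OF X] c[OF Y] Bc, symmetric])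
    also have "adj B * \<rho> X * \<rho> Y = adj B * (\<rho> X * \<rho> Y)" using aB c[OF X] c[OF Y] by (rule assoc_mult_mat)
    finally show ?thesis .
  qed
  assume nz: "conjugate u \<bullet> (B *\<^sub>v (adj B *\<^sub>v yword n \<rho> ws v)) \<noteq> 0"
  have "representation n k ?r"
    unfolding representation_def
  proof (intro conjI ballI allI)
    fix X Y assume X: "X \<in> so_odd n" and Y: "Y \<in> so_odd n"
    show "?r X \<in> carrier_mat k k" using X by (rule rc)
    show "?r (X + Y) = ?r X + ?r Y"
      unfolding rep_add[OF R X Y] mult_add_distrib_mat[OF aB c[OF X] c[OF Y]]
      by (rule add_mult_distrib_mat[OF aR[OF X] aR[OF Y] Bc])
    have "?r (lie_bracket X Y) = adj B * (\<rho> X * \<rho> Y) * B - adj B * (\<rho> Y * \<rho> X) * B"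
    proof -
      have xy: "\<rho> X * \<rho> Y \<in> carrier_mat d d" "\<rho> Y * \<rho> X \<in> carrier_mat d d" using c[OF X] c[OF Y] by auto
      show ?thesis
        unfolding rep_bracket[OF R X Y] mult_minus_distrib_mat[OF aB xy]
        by (rule minus_mult_distrib_mat[OF mult_carrier_mat[OF aB xy(1)] mult_carrier_mat[OF aB xy(2)] Bc])
    qed
    then show "?r (lie_bracket X Y) = lie_bracket (?r X) (?r Y)"
      unfolding lie_bracket_def[of "?r X"] prod[OF X Y] prod[OF Y X] .
  next
    fix z X assume X: "X \<in> so_odd n"
    show "?r (z \<cdot>\<^sub>m X) = z \<cdot>\<^sub>m ?r X"
      unfolding rep_smult[OF R X] mult_smult_distrib[OF aB c[OF X]] mult_smult_assoc_mat[OF aR[OF X] Bc] ..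
  qed
  moreover have "?r (adj X) = adj (?r X)" if "X \<in> so_odd n" for X
    using adr[OF that] by (metis adj_adj)
  ultimately have U': "unitary_rep n k ?r" by (simp add: unitary_rep_def)
  have z0: "adj B *\<^sub>v 0\<^sub>v d = 0\<^sub>v k" by (rule mult_mat_zero_vec[OF aB])
  have "hw_vector n l k ?r (adj B *\<^sub>v v)"
    unfolding hw_vector_def
  proof (intro conjI ballI)
    show "adj B *\<^sub>v v \<in> carrier_vec k" using mult_mat_vec_carrier[OF aB vc] .
    show "?r H *\<^sub>v (adj B *\<^sub>v v) = eval_weight n l H \<cdot>\<^sub>v (adj B *\<^sub>v v)" if "H \<in> cartan n" for H
      using act[OF cartan_so_odd[OF that] vc] hw that by (simp add: hw_vector_def mult_mat_vec[OF aB vc])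
    show "?r X *\<^sub>v (adj B *\<^sub>v v) = 0\<^sub>v k" if "\<alpha> \<in> set (pos_roots n)" "X \<in> root_space (so_odd n) n \<alpha>" for \<alpha> X
      using act[of X v] vc hw that z0 by (simp add: hw_vector_def root_space_def)
  qed
  moreover have "hw_vector_D n (\<lambda>k. l k - of_nat (count (mset ws) k)) k ?r (adj B *\<^sub>v u)"
    unfolding hw_vector_D_def
  proof (intro conjI ballI)
    show "adj B *\<^sub>v u \<in> carrier_vec k" using mult_mat_vec_carrier[OF aB uc] .
    show "?r (so_unit n j j) *\<^sub>v (adj B *\<^sub>v u) = (l j - of_nat (count (mset ws) j)) \<cdot>\<^sub>v (adj B *\<^sub>v u)" if "j \<in> {1..n}" for j
      using act[of "so_unit n j j" u] uc u that by (simp add: hw_vector_D_def mult_mat_vec[OF aB uc])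
    show "?r X *\<^sub>v (adj B *\<^sub>v u) = 0\<^sub>v k" if "\<alpha> \<in> pos_roots_D n" "X \<in> root_space (so_odd n) n \<alpha>" for \<alpha> X
      using act[of X u] uc u that z0 by (simp add: hw_vector_D_def root_space_def)
  qed
  moreover have "conjugate (adj B *\<^sub>v u) \<bullet> yword n ?r ws (adj B *\<^sub>v v) \<noteq> 0"
  proof -
    interpret so_rep n d \<rho> by unfold_locales (rule R)
    have "yword n ?r ws (adj B *\<^sub>v v) = adj B *\<^sub>v yword n \<rho> ws v"
      using ws
    proof (induction ws)
      case (Cons i ws)
      then have "yword n \<rho> ws v \<in> carrier_vec d" using vc by (intro yword_carrier) auto
      then show ?case using Cons act[of "so_unit n 0 i" "yword n \<rho> ws v"] by simp
    qed simp
    moreover have Y: "yword n \<rho> ws v \<in> carrier_vec d" using ws vc by (rule yword_carrier)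
    have "conjugate u \<bullet> (B *\<^sub>v (adj B *\<^sub>v yword n \<rho> ws v)) = conjugate (adj B *\<^sub>v u) \<bullet> (adj B *\<^sub>v yword n \<rho> ws v)"
      by (rule form_adj[OF Bc uc mult_mat_vec_carrier[OF aB Y]])
    ultimately show ?thesis using nz by simp
  qed
  ultimately show "witness n l ws k ?r (adj B *\<^sub>v v) (adj B *\<^sub>v u)"
    using U' ws by (simp add: witness_def)
qed

text \<open>
  Take a witness of least dimension.  If there were a proper nonzero submodule \<open>W\<close>, then the projections
  to \<open>W\<close> and to its complement would split the nonzero pairing of \<open>u\<close> and \<open>y\<^sup>p v\<close> into two summands; the one
  that does not vanish gives a witness of smaller dimension.
\<close>
lemma irreducible_witness:
  assumes "witness n l ws d \<rho> v u"
  obtains d' \<rho>' v' u' where "witness n l ws d' \<rho>' v' u'" "irreducible_rep n d' \<rho>'"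
proof -
  let ?P = "\<lambda>d. \<exists>\<rho> v u. witness n l ws d \<rho> v u"
  define d' where "d' = (LEAST d. ?P d)"
  have "?P d'" unfolding d'_def using assms by (intro LeastI[of ?P d]) blast
  then obtain \<rho>' v' u' where Wt: "witness n l ws d' \<rho>' v' u'" by blast
  have min: "\<not> ?P k" if "k < d'" for k using that not_less_Least unfolding d'_def by blast
  have U: "unitary_rep n d' \<rho>'" and hw: "hw_vector n l d' \<rho>' v'" and ws: "set ws \<subseteq> {1..n}"
    and u: "hw_vector_D n (\<lambda>k. l k - of_nat (count (mset ws) k)) d' \<rho>' u'"
    and nz: "conjugate u' \<bullet> yword n \<rho>' ws v' \<noteq> 0"
    using Wt by (auto simp: witness_def)
  have R: "representation n d' \<rho>'" using U by (simp add: unitary_rep_def)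
  have vc: "v' \<in> carrier_vec d'" and uc: "u' \<in> carrier_vec d'" using hw u by (auto simp: hw_vector_def hw_vector_D_def)
  interpret so_rep n d' \<rho>' by unfold_locales (rule R)
  let ?Y = "yword n \<rho>' ws v'"
  have Y: "?Y \<in> carrier_vec d'" using ws vc by (rule yword_carrier)
  have "d' \<noteq> 0" using nz scalar_prod_sum[OF Y] by (cases "d' = 0") auto
  moreover have "W = {0\<^sub>v d'} \<or> W = carrier_vec d'" if W: "submodule n d' \<rho>' W" for W
  proof (rule ccontr)
    assume "\<not> (W = {0\<^sub>v d'} \<or> W = carrier_vec d')"
    then have W0: "W \<noteq> {0\<^sub>v d'}" and W1: "W \<noteq> carrier_vec d'" by auto
    obtain k B where B: "isometry_into d' k W B" and onto: "\<And>w. w \<in> W \<Longrightarrow> B *\<^sub>v (adj B *\<^sub>v w) = w" and k: "k < d'"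
      using isometry_onto[OF submodule_subspace[OF W]] W1 by metis
    have Bc: "B \<in> carrier_mat d' k" and I: "adj B * B = 1\<^sub>m k" using B by (auto simp: isometry_into_def)
    have aB: "adj B \<in> carrier_mat k d'" using Bc by simp
    have K1: "adj B * \<rho>' X = (adj B * \<rho>' X * B) * adj B" if "X \<in> so_odd n" for X
      using restrict_witness(1)[OF Wt W B onto that] .
    have z1: "conjugate u' \<bullet> (B *\<^sub>v (adj B *\<^sub>v ?Y)) = 0" using restrict_witness(2)[OF Wt W B onto] min[OF k] by blast
    \<comment> \<open>the orthogonal complement of \<open>W\<close>\<close>
    define V where "V = {x \<in> carrier_vec d'. adj B *\<^sub>v x = 0\<^sub>v k}"
    have V: "submodule n d' \<rho>' V"
      unfolding submodule_def
    proof (intro conjI ballI allI)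
      show "V \<subseteq> carrier_vec d'" by (auto simp: V_def)
      have "adj B *\<^sub>v 0\<^sub>v d' = 0\<^sub>v k" by (rule mult_mat_zero_vec[OF aB])
      then show "0\<^sub>v d' \<in> V" by (simp add: V_def)
      show "a + b \<in> V" if "a \<in> V" "b \<in> V" for a b
        using that mult_add_distrib_mat_vec[OF aB, of a b] by (simp add: V_def)
      show "z \<cdot>\<^sub>v a \<in> V" if "a \<in> V" for a z
      proof -
        have "z \<cdot>\<^sub>v 0\<^sub>v k = 0\<^sub>v k" by (rule eq_vecI) auto
        then show ?thesis using that mult_mat_vec[OF aB, of a z] by (simp add: V_def)
      qed
      show "\<rho>' X *\<^sub>v a \<in> V" if X: "X \<in> so_odd n" and a: "a \<in> V" for X a
      proof -
        have ac: "a \<in> carrier_vec d'" "adj B *\<^sub>v a = 0\<^sub>v k" using a by (auto simp: V_def)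
        note Xc = rep_carrier[OF R X]
        have r: "adj B * \<rho>' X * B \<in> carrier_mat k k" using aB Xc Bc by auto
        have "adj B *\<^sub>v (\<rho>' X *\<^sub>v a) = (adj B * \<rho>' X) *\<^sub>v a" using assoc_mult_mat_vec[OF aB Xc ac(1)] by simp
        also have "\<dots> = (adj B * \<rho>' X * B) *\<^sub>v (adj B *\<^sub>v a)"
          using K1[OF X] assoc_mult_mat_vec[OF r aB ac(1)] by simp
        also have "\<dots> = 0\<^sub>v k" unfolding ac(2) by (rule mult_mat_zero_vec[OF r])
        finally show ?thesis using mult_mat_vec_carrier[OF Xc ac(1)] by (simp add: V_def)
      qed
    qed
    have "V \<noteq> carrier_vec d'"
    proof
      assume e: "V = carrier_vec d'"
      obtain w where w: "w \<in> W" "w \<noteq> 0\<^sub>v d'" using W0 W by (auto simp: submodule_def)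
      then have "w \<in> V" using e W by (auto simp: submodule_def)
      then have "w = B *\<^sub>v 0\<^sub>v k" using onto[OF w(1)] by (simp add: V_def)
      then show False using w(2) mult_mat_zero_vec[OF Bc] by simp
    qed
    then obtain k' C where C: "isometry_into d' k' V C" and onto': "\<And>w. w \<in> V \<Longrightarrow> C *\<^sub>v (adj C *\<^sub>v w) = w" and k': "k' < d'"
      using isometry_onto[OF submodule_subspace[OF V]] by metis
    have Cc: "C \<in> carrier_mat d' k'" and rgC: "\<And>x. x \<in> carrier_vec k' \<Longrightarrow> C *\<^sub>v x \<in> V" using C by (auto simp: isometry_into_def)
    have aC: "adj C \<in> carrier_mat k' d'" using Cc by simp
    have z2: "conjugate u' \<bullet> (C *\<^sub>v (adj C *\<^sub>v ?Y)) = 0"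
      using restrict_witness(2)[OF Wt V C onto'] min[OF k'] by blast
    let ?y = "adj B *\<^sub>v ?Y"
    have yc: "?y \<in> carrier_vec k" using mult_mat_vec_carrier[OF aB Y] .
    have Byc: "B *\<^sub>v ?y \<in> carrier_vec d'" using mult_mat_vec_carrier[OF Bc yc] .
    let ?q = "adj C *\<^sub>v (B *\<^sub>v ?y)"
    have qc: "?q \<in> carrier_vec k'" using mult_mat_vec_carrier[OF aC Byc] .
    \<comment> \<open>the projection to \<open>V\<close> kills \<open>W\<close>\<close>
    have "conjugate ?q \<bullet> ?q = conjugate (adj (adj C) *\<^sub>v ?q) \<bullet> (B *\<^sub>v ?y)"
      by (rule form_adj[OF aC qc Byc])
    also have "\<dots> = conjugate (adj B *\<^sub>v (C *\<^sub>v ?q)) \<bullet> ?y"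
      using form_adj[OF Bc mult_mat_vec_carrier[OF Cc qc] yc] by simp
    also have "\<dots> = 0" using rgC[OF qc] yc by (simp add: V_def)
    finally have q0: "?q = 0\<^sub>v k'" using form_self_eq_0[OF qc] by simp
    define r where "r = ?Y - B *\<^sub>v ?y"
    have rc: "r \<in> carrier_vec d'" using Y Byc by (simp add: r_def)
    have "adj B *\<^sub>v r = ?y - adj B *\<^sub>v (B *\<^sub>v ?y)"
      unfolding r_def by (rule mult_minus_distrib_mat_vec[OF aB Y Byc])
    also have "adj B *\<^sub>v (B *\<^sub>v ?y) = ?y" using assoc_mult_mat_vec[OF aB Bc yc] I yc by simp
    finally have "r \<in> V" using rc yc by (simp add: V_def)
    then have "r = C *\<^sub>v (adj C *\<^sub>v r)" by (rule onto'[symmetric])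
    also have "adj C *\<^sub>v r = adj C *\<^sub>v ?Y - ?q"
      unfolding r_def by (rule mult_minus_distrib_mat_vec[OF aC Y Byc])
    also have "\<dots> = adj C *\<^sub>v ?Y" unfolding q0 using mult_mat_vec_carrier[OF aC Y] by simp
    finally have "conjugate u' \<bullet> r = 0" using z2 by simp
    moreover have "conjugate u' \<bullet> r = conjugate u' \<bullet> ?Y - conjugate u' \<bullet> (B *\<^sub>v ?y)"
      unfolding r_def by (rule scalar_prod_minus_distrib[OF _ Y Byc]) (use uc in simp)
    ultimately show False using z1 nz by simp
  qed
  ultimately have "irreducible_rep n d' \<rho>'" using R by (simp add: irreducible_rep_def)
  then show ?thesis using Wt that by blast
qed

section \<open>Clifford generators and the spin representation\<close>

text \<open>
  Matrices indexed like the basis of the standard representation, with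
  \<open>g a * g b + g b * g a\<close> the value of the invariant form at the two basis vectors times the identity.  The vector \<open>x\<close> will
  be a highest weight vector of the spin module.
\<close>
definition clifford :: "nat \<Rightarrow> nat \<Rightarrow> (nat \<Rightarrow> complex mat) \<Rightarrow> complex vec \<Rightarrow> bool" where
  "clifford n d g x \<longleftrightarrow> (\<forall>a\<le>2*n. g a \<in> carrier_mat d d) \<and>
     (\<forall>a\<le>2*n. \<forall>b\<le>2*n. g a * g b + g b * g a = (if b = dual n a then 1\<^sub>m d else 0\<^sub>m d d)) \<and>
     (\<forall>a\<le>2*n. adj (g a) = g (dual n a)) \<and>
     x \<in> carrier_vec d \<and> x \<noteq> 0\<^sub>v d \<and> (\<forall>i\<in>{1..n}. g i *\<^sub>v x = 0\<^sub>v d)"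

definition pauli_z :: "complex mat" where
  "pauli_z = mat 2 2 (\<lambda>(i, j). if i = j then (if i = 0 then 1 else -1) else 0)"

definition raising :: "complex mat" where
  "raising = mat 2 2 (\<lambda>(i, j). if i = 0 \<and> j = 1 then 1 else 0)"

lemma less_2_iff: "(i::nat) < 2 \<longleftrightarrow> i = 0 \<or> i = 1" by auto

lemma pauli_carrier [simp]: "pauli_z \<in> carrier_mat 2 2" "raising \<in> carrier_mat 2 2"
  by (simp_all add: pauli_z_def raising_def)

lemma pauli_relations:
  "pauli_z * pauli_z = 1\<^sub>m 2" "raising * raising = 0\<^sub>m 2 2" "adj raising * adj raising = 0\<^sub>m 2 2"
  "raising * adj raising + adj raising * raising = 1\<^sub>m 2"
  "raising * pauli_z + pauli_z * raising = 0\<^sub>m 2 2"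
  "adj raising * pauli_z + pauli_z * adj raising = 0\<^sub>m 2 2"
  "adj pauli_z = pauli_z"
  by (rule eq_matI; auto simp: pauli_z_def raising_def adj_def scalar_prod_def less_2_iff numeral_2_eq_2)+

lemma kron_zero_left: "kron (0\<^sub>m m k) B = 0\<^sub>m (m * dim_row B) (k * dim_col B)"
  by (rule eq_matI) (auto simp: kron_def div_less)

lemma kron_zero_right: "kron A (0\<^sub>m m k) = 0\<^sub>m (dim_row A * m) (dim_col A * k)"
  by (rule eq_matI) (auto simp: kron_def mod_less)

text \<open>
  The Jordan-Wigner construction: the old generators are tensored with \<open>pauli_z\<close>, and the raising matrix
  and its adjoint, tensored with the identity, provide the two generators of weights \<open>\<plusminus>\<epsilon>\<^sub>n\<^sub>+\<^sub>1\<close>.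
\<close>
lemma clifford_exists: "\<exists>d g x. clifford n d g x"
proof (induction n)
  case 0
  \<comment> \<open>the relation for \<open>a = b = 0\<close> requires the square \<open>1/2\<close>\<close>
  let ?g = "\<lambda>a::nat. (1 / of_real (sqrt 2) :: complex) \<cdot>\<^sub>m 1\<^sub>m 1"
  have r: "(1 / of_real (sqrt 2) :: complex) * (1 / of_real (sqrt 2)) = 1 / 2"
    by (simp flip: of_real_mult)
  have "?g 0 * ?g 0 + ?g 0 * ?g 0 = 1\<^sub>m 1"
    by (rule eq_matI) (use r in \<open>auto simp: scalar_prod_def\<close>)
  moreover have "adj (?g 0) = ?g 0" by (rule eq_matI) auto
  moreover have "vec 1 (\<lambda>_. 1 :: complex) \<noteq> 0\<^sub>v 1"
    by (metis index_vec index_zero_vec(1) less_one zero_neq_one)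
  ultimately have "clifford 0 1 ?g (vec 1 (\<lambda>_. 1))" by (simp add: clifford_def dual_def)
  then show ?case by blast
next
  case (Suc n)
  then obtain d g x where C: "clifford n d g x" by blast
  then have gc: "\<And>a. a \<le> 2*n \<Longrightarrow> g a \<in> carrier_mat d d"
    and rel: "\<And>a b. a \<le> 2*n \<Longrightarrow> b \<le> 2*n \<Longrightarrow> g a * g b + g b * g a = (if b = dual n a then 1\<^sub>m d else 0\<^sub>m d d)"
    and ad: "\<And>a. a \<le> 2*n \<Longrightarrow> adj (g a) = g (dual n a)"
    and xc: "x \<in> carrier_vec d" "x \<noteq> 0\<^sub>v d" and xk: "\<And>i. i \<in> {1..n} \<Longrightarrow> g i *\<^sub>v x = 0\<^sub>v d"
    by (auto simp: clifford_def)
  let ?P = "kron raising (1\<^sub>m d)" and ?M = "kron (adj raising) (1\<^sub>m d)"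
  \<comment> \<open>\<open>\<phi>\<close> identifies the indices of the old generators\<close>
  define \<phi> where "\<phi> a = (if a \<le> n then a else a - 1)" for a
  define h where "h a = (if a = n + 1 then ?P else if a = 2*n + 2 then ?M else kron pauli_z (g (\<phi> a)))" for a
  let ?x = "vkron (unit_vec 2 0) x"
  have \<phi>: "\<phi> a \<le> 2*n" "\<phi> (dual (Suc n) a) = dual n (\<phi> a)" "dual (Suc n) a \<noteq> n + 1" "dual (Suc n) a \<noteq> 2*n + 2"
    if "a \<le> 2 * Suc n" "a \<noteq> n + 1" "a \<noteq> 2*n + 2" for a
    using that by (auto simp: \<phi>_def dual_def)
  have \<phi>_inj: "\<phi> a = \<phi> b \<longleftrightarrow> a = b" if "a \<noteq> n + 1" "b \<noteq> n + 1" for a b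
    using that by (auto simp: \<phi>_def split: if_splits)
  have dn: "dual (Suc n) (n + 1) = 2*n + 2" "dual (Suc n) (2*n + 2) = n + 1" by (auto simp: dual_def)
  have h1: "h (n + 1) = ?P" "h (2*n + 2) = ?M" by (simp_all add: h_def)
  have h2: "h a = kron pauli_z (g (\<phi> a))" if "a \<noteq> n + 1" "a \<noteq> 2*n + 2" for a
    using that by (simp add: h_def)
  have aR: "adj raising \<in> carrier_mat 2 2" by (rule adj_carrier) simp
  have hc: "h a \<in> carrier_mat (2 * d) (2 * d)" if "a \<le> 2 * Suc n" for a
    using that gc \<phi>(1)[OF that] aR by (auto simp: h_def intro!: kron_carrier)
  have mix: "kron A (1\<^sub>m d) * kron pauli_z (g p) + kron pauli_z (g p) * kron A (1\<^sub>m d) = 0\<^sub>m (2*d) (2*d)"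
    if "A \<in> carrier_mat 2 2" "A * pauli_z + pauli_z * A = 0\<^sub>m 2 2" "p \<le> 2*n" for A p
  proof -
    have "kron A (1\<^sub>m d) * kron pauli_z (g p) + kron pauli_z (g p) * kron A (1\<^sub>m d)
        = kron (A * pauli_z) (g p) + kron (pauli_z * A) (g p)"
      using that gc[OF that(3)] by (simp add: kron_mult[of _ 2 _ _ d])
    also have "\<dots> = kron (A * pauli_z + pauli_z * A) (g p)"
      by (rule kron_add_left[symmetric, OF mult_carrier_mat[OF that(1) pauli_carrier(1)] mult_carrier_mat[OF pauli_carrier(1) that(1)]])
    also have "\<dots> = 0\<^sub>m (2*d) (2*d)" unfolding that(2) kron_zero_left using gc[OF that(3)] by simp
    finally show ?thesis .
  qed
  have same: "kron A (1\<^sub>m d) * kron B (1\<^sub>m d) + kron B (1\<^sub>m d) * kron A (1\<^sub>m d) = kron (A * B + B * A) (1\<^sub>m d)"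
    if "A \<in> carrier_mat 2 2" "B \<in> carrier_mat 2 2" for A B
    using that by (simp add: kron_mult[of _ 2 _ _ d] kron_add_left[of _ 2 2])
  have comm: "A + B = B + A" if "A \<in> carrier_mat (2*d) (2*d)" "B \<in> carrier_mat (2*d) (2*d)" for A B :: "complex mat"
    using that by (rule comm_add_mat)
  have z2: "0\<^sub>m 2 2 + 0\<^sub>m 2 2 = (0\<^sub>m 2 2 :: complex mat)" by simp
  have PP: "?P * ?P + ?P * ?P = 0\<^sub>m (2*d) (2*d)" 
    using same[of raising raising] by (simp add: pauli_relations kron_zero_left)
  have MM: "?M * ?M + ?M * ?M = 0\<^sub>m (2*d) (2*d)" 
    using same[OF aR aR] by (simp add: pauli_relations kron_zero_left)
  have PM: "?P * ?M + ?M * ?P = 1\<^sub>m (2*d)" 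
    using same[OF _ aR, of raising] by (simp add: pauli_relations kron_one)
  have MP: "?M * ?P + ?P * ?M = 1\<^sub>m (2*d)" 
  proof -
    have "?P \<in> carrier_mat (2*d) (2*d)" "?M \<in> carrier_mat (2*d) (2*d)"
      using hc[of "n+1"] hc[of "2*n+2"] unfolding h1 by auto
    then have "?M * ?P + ?P * ?M = ?P * ?M + ?M * ?P"
      using comm mult_carrier_mat by blast
    then show ?thesis using PM by simp
  qed
  have relh: "h a * h b + h b * h a = (if b = dual (Suc n) a then 1\<^sub>m (2*d) else 0\<^sub>m (2*d) (2*d))"
    if ab: "a \<le> 2 * Suc n" "b \<le> 2 * Suc n" for a b
  proof -
    consider "a = n + 1" "b = n + 1" | "a = n + 1" "b = 2*n + 2" | "a = 2*n + 2" "b = n + 1" | "a = 2*n + 2" "b = 2*n + 2"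
      | "a \<noteq> n + 1" "a \<noteq> 2*n + 2" "b = n + 1 \<or> b = 2*n + 2" | "b \<noteq> n + 1" "b \<noteq> 2*n + 2" "a = n + 1 \<or> a = 2*n + 2"
      | "a \<noteq> n + 1" "a \<noteq> 2*n + 2" "b \<noteq> n + 1" "b \<noteq> 2*n + 2" by blast
    then show ?thesis
    proof cases
      case 1
      show ?thesis unfolding 1 h1 dn using PP by simp
    next
      case 2
      show ?thesis unfolding 2 h1 dn using PM by simp
    next
      case 3
      show ?thesis unfolding 3 h1 dn using MP by simp
    next
      case 4
      show ?thesis unfolding 4 h1 dn using MM by simp
    next
      case 5
      have p: "\<phi> a \<le> 2*n" using \<phi> ab 5 by blast
      have hb: "h b = kron (if b = n + 1 then raising else adj raising) (1\<^sub>m d)"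
        using 5 by (auto simp: h_def)
      have "h b * h a + h a * h b = 0\<^sub>m (2*d) (2*d)"
        unfolding hb h2[OF 5(1,2)] by (rule mix[OF _ _ p]) (use aR pauli_relations in auto)
      then have "h a * h b + h b * h a = 0\<^sub>m (2*d) (2*d)"
        using comm[of "h a * h b" "h b * h a"] hc[OF ab(1)] hc[OF ab(2)] by simp
      moreover have "b \<noteq> dual (Suc n) a" using \<phi>(3,4)[OF ab(1) 5(1,2)] 5(3) by auto
      ultimately show ?thesis by simp
    next
      case 6
      have p: "\<phi> b \<le> 2*n" using \<phi> ab 6 by blast
      have ha: "h a = kron (if a = n + 1 then raising else adj raising) (1\<^sub>m d)"
        using 6 by (auto simp: h_def)
      have "h a * h b + h b * h a = 0\<^sub>m (2*d) (2*d)"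
        unfolding ha h2[OF 6(1,2)] by (rule mix[OF _ _ p]) (use aR pauli_relations in auto)
      moreover have "b \<noteq> dual (Suc n) a" using 6 dn by metis
      ultimately show ?thesis by simp
    next
      case 7
      have p: "\<phi> a \<le> 2*n" "\<phi> b \<le> 2*n" using \<phi> ab 7 by blast+
      have "h a * h b + h b * h a = kron (1\<^sub>m 2) (g (\<phi> a) * g (\<phi> b)) + kron (1\<^sub>m 2) (g (\<phi> b) * g (\<phi> a))"
        using gc[OF p(1)] gc[OF p(2)] by (simp add: h2[OF 7(1,2)] h2[OF 7(3,4)] kron_mult[of _ 2 _ _ d] pauli_relations)
      also have "\<dots> = kron (1\<^sub>m 2) (g (\<phi> a) * g (\<phi> b) + g (\<phi> b) * g (\<phi> a))"
        by (rule kron_add_right[symmetric, of _ d d]) (use gc[OF p(1)] gc[OF p(2)] in auto)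
      also have "g (\<phi> a) * g (\<phi> b) + g (\<phi> b) * g (\<phi> a) = (if \<phi> b = dual n (\<phi> a) then 1\<^sub>m d else 0\<^sub>m d d)"
        by (rule rel[OF p])
      also have "\<phi> b = dual n (\<phi> a) \<longleftrightarrow> b = dual (Suc n) a"
        using \<phi>[OF ab(1) 7(1,2)] \<phi>_inj[of b "dual (Suc n) a"] 7 by simp
      finally show ?thesis by (simp add: kron_one kron_zero_right)
    qed
  qed
  have adh: "adj (h a) = h (dual (Suc n) a)" if a: "a \<le> 2 * Suc n" for a
  proof -
    consider "a = n + 1" | "a = 2*n + 2" | "a \<noteq> n + 1" "a \<noteq> 2*n + 2" by blast
    then show ?thesis
    proof cases
      case 1 then show ?thesis by (simp only: dn h1 adj_kron adj_one)
    next
      case 2 then show ?thesis by (simp only: dn h1 adj_kron adj_one adj_adj)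
    next
      case 3
      have "h (dual (Suc n) a) = kron pauli_z (g (dual n (\<phi> a)))"
        using h2[OF \<phi>(3,4)[OF a 3]] \<phi>(2)[OF a 3] by simp
      then show ?thesis using h2[OF 3] ad[OF \<phi>(1)[OF a 3]] by (simp add: adj_kron pauli_relations)
    qed
  qed
  have e0: "unit_vec 2 0 \<in> carrier_vec 2" by simp
  have xk': "h i *\<^sub>v ?x = 0\<^sub>v (2*d)" if i: "i \<in> {1..Suc n}" for i
  proof (cases "i = n + 1")
    case True
    have "raising *\<^sub>v unit_vec 2 0 = 0\<^sub>v 2"
      by (rule eq_vecI) (auto simp: raising_def scalar_prod_def numeral_2_eq_2)
    then show ?thesis
      unfolding True h1 kron_mult_vkron[OF pauli_carrier(2) one_carrier_mat e0 xc(1)] using xc by (simp add: vkron_zero_left)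
  next
    case False
    then have i: "i \<in> {1..n}" "i \<noteq> 2*n + 2" "\<phi> i = i" "i \<le> 2*n" using i by (auto simp: \<phi>_def)
    show ?thesis
      unfolding h2[OF False i(2)] i(3) kron_mult_vkron[OF pauli_carrier(1) gc[OF i(4)] e0 xc(1)] xk[OF i(1)]
      by (rule vkron_zero_right) (rule mult_mat_vec_carrier[OF pauli_carrier(1) e0])
  qed
  obtain j where j: "j < d" "x $ j \<noteq> 0" using xc by (metis carrier_vecD eq_vecI index_zero_vec)
  have "?x $ j = x $ j" using j xc by (simp add: vkron_def)
  then have "?x \<noteq> 0\<^sub>v (2*d)" using j by (metis index_zero_vec(1) trans_less_add1 mult_2)
  moreover have "?x \<in> carrier_vec (2*d)" using e0 xc by (intro vkron_carrier) auto
  ultimately have "clifford (Suc n) (2*d) h ?x"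
    using hc relh adh xk' unfolding clifford_def by blast
  then show ?case by blast
qed

lemma sum_swap_weighted:
  fixes f :: "nat \<Rightarrow> nat \<Rightarrow> nat \<Rightarrow> complex"
  shows "(\<Sum>c\<in>C. k * (\<Sum>a\<in>A. \<Sum>b\<in>B. X a b * f c a b)) = k * (\<Sum>a\<in>A. \<Sum>b\<in>B. X a b * (\<Sum>c\<in>C. f c a b))"
proof -
  have "(\<Sum>c\<in>C. \<Sum>a\<in>A. \<Sum>b\<in>B. X a b * f c a b) = (\<Sum>a\<in>A. \<Sum>c\<in>C. \<Sum>b\<in>B. X a b * f c a b)"
    by (rule sum.swap)
  also have "\<dots> = (\<Sum>a\<in>A. \<Sum>b\<in>B. \<Sum>c\<in>C. X a b * f c a b)"
    by (intro sum.cong refl sum.swap)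
  finally show ?thesis by (simp add: sum_distrib_left[symmetric])
qed

locale clifford_module =
  fixes n d :: nat and g :: "nat \<Rightarrow> complex mat" and x :: "complex vec"
  assumes C: "clifford n d g x"
begin

lemma gc: "a \<le> 2*n \<Longrightarrow> g a \<in> carrier_mat d d"
  and anti: "a \<le> 2*n \<Longrightarrow> b \<le> 2*n \<Longrightarrow> g a * g b + g b * g a = (if b = dual n a then 1\<^sub>m d else 0\<^sub>m d d)"
  and adj_g: "a \<le> 2*n \<Longrightarrow> adj (g a) = g (dual n a)"
  and xc: "x \<in> carrier_vec d" and x0: "x \<noteq> 0\<^sub>v d" and kill: "i \<in> {1..n} \<Longrightarrow> g i *\<^sub>v x = 0\<^sub>v d"
  using C by (auto simp: clifford_def)

lemma gg_carrier: "a \<le> 2*n \<Longrightarrow> b \<le> 2*n \<Longrightarrow> g a * g b \<in> carrier_mat d d"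
  using gc by (meson mult_carrier_mat)

lemma anti_index:
  assumes "a \<le> 2*n" "b \<le> 2*n" "i < d" "j < d"
  shows "(g a * g b) $$ (i, j) + (g b * g a) $$ (i, j) = (if b = dual n a then (if i = j then 1 else 0) else 0)"
proof -
  have "(g a * g b + g b * g a) $$ (i, j) = (g a * g b) $$ (i, j) + (g b * g a) $$ (i, j)"
    using gg_carrier[of b a] assms by (intro index_add_mat) auto
  then show ?thesis unfolding anti[OF assms(1,2)] using assms by auto
qed

text \<open>
  The quadratic element of the Clifford algebra whose commutator with the generators is the standard
  representation (\<open>spin_commutator\<close>).
\<close>
definition spin :: "complex mat \<Rightarrow> complex mat" where
  "spin X = mat d d (\<lambda>(i, j). (1/2) * (\<Sum>a\<le>2*n. \<Sum>b\<le>2*n. X $$ (a, b) * (g a * g (dual n b)) $$ (i, j)))"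

lemma spin_carrier [simp]: "spin X \<in> carrier_mat d d"
  by (simp add: spin_def)

lemma spin_index: "i < d \<Longrightarrow> j < d \<Longrightarrow>
    spin X $$ (i, j) = (1/2) * (\<Sum>a\<le>2*n. \<Sum>b\<le>2*n. X $$ (a, b) * (g a * g (dual n b)) $$ (i, j))"
  by (simp add: spin_def)

lemma spin_mult_index:
  assumes A: "A \<in> carrier_mat d d" and ij: "i < d" "j < d"
  shows "(spin X * A) $$ (i, j) = (1/2) * (\<Sum>a\<le>2*n. \<Sum>b\<le>2*n. X $$ (a, b) * (g a * g (dual n b) * A) $$ (i, j))"
    and "(A * spin X) $$ (i, j) = (1/2) * (\<Sum>a\<le>2*n. \<Sum>b\<le>2*n. X $$ (a, b) * (A * (g a * g (dual n b))) $$ (i, j))"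
proof -
  have gg: "g a * g (dual n b) \<in> carrier_mat d d" if "a \<le> 2*n" "b \<le> 2*n" for a b
    using gg_carrier dual_le that by blast
  have "(spin X * A) $$ (i, j) = (\<Sum>c<d. spin X $$ (i, c) * A $$ (c, j))"
    by (rule index_mult_sum[OF spin_carrier A ij])
  also have "\<dots> = (\<Sum>c<d. (1/2) * (\<Sum>a\<le>2*n. \<Sum>b\<le>2*n. X $$ (a, b) * ((g a * g (dual n b)) $$ (i, c) * A $$ (c, j))))"
    using ij by (intro sum.cong) (simp_all add: spin_index sum_distrib_right mult.assoc)
  also have "\<dots> = (1/2) * (\<Sum>a\<le>2*n. \<Sum>b\<le>2*n. X $$ (a, b) * (\<Sum>c<d. (g a * g (dual n b)) $$ (i, c) * A $$ (c, j)))"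
    by (rule sum_swap_weighted)
  also have "\<dots> = (1/2) * (\<Sum>a\<le>2*n. \<Sum>b\<le>2*n. X $$ (a, b) * (g a * g (dual n b) * A) $$ (i, j))"
    using ij by (intro arg_cong2[where f="(*)"] refl sum.cong index_mult_sum[symmetric, OF gg A]) auto
  finally show "(spin X * A) $$ (i, j) = (1/2) * (\<Sum>a\<le>2*n. \<Sum>b\<le>2*n. X $$ (a, b) * (g a * g (dual n b) * A) $$ (i, j))" .
  have "(A * spin X) $$ (i, j) = (\<Sum>c<d. A $$ (i, c) * spin X $$ (c, j))"
    by (rule index_mult_sum[OF A spin_carrier ij])
  also have "\<dots> = (\<Sum>c<d. (1/2) * (\<Sum>a\<le>2*n. \<Sum>b\<le>2*n. X $$ (a, b) * (A $$ (i, c) * (g a * g (dual n b)) $$ (c, j))))"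
    using ij by (intro sum.cong) (simp_all add: spin_index sum_distrib_left ac_simps)
  also have "\<dots> = (1/2) * (\<Sum>a\<le>2*n. \<Sum>b\<le>2*n. X $$ (a, b) * (\<Sum>c<d. A $$ (i, c) * (g a * g (dual n b)) $$ (c, j)))"
    by (rule sum_swap_weighted)
  also have "\<dots> = (1/2) * (\<Sum>a\<le>2*n. \<Sum>b\<le>2*n. X $$ (a, b) * (A * (g a * g (dual n b))) $$ (i, j))"
    using ij by (intro arg_cong2[where f="(*)"] refl sum.cong index_mult_sum[symmetric, OF A gg]) auto
  finally show "(A * spin X) $$ (i, j) = (1/2) * (\<Sum>a\<le>2*n. \<Sum>b\<le>2*n. X $$ (a, b) * (A * (g a * g (dual n b))) $$ (i, j))" .
qed

lemma triple_commutator: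
  assumes a: "a \<le> 2*n" and b: "b \<le> 2*n" and c: "c \<le> 2*n" and ij: "i < d" "j < d"
  shows "(g a * g b * g c) $$ (i, j) - (g c * (g a * g b)) $$ (i, j) =
    (if c = dual n b then g a $$ (i, j) else 0) - (if c = dual n a then g b $$ (i, j) else 0)"
proof -
  note ca = gc[OF a] and cb = gc[OF b] and cc = gc[OF c]
  have e1: "g a * (g b * g c + g c * g b) = (if c = dual n b then g a else 0\<^sub>m d d)"
    unfolding anti[OF b c] using ca by auto
  have e2: "(g a * g c + g c * g a) * g b = (if c = dual n a then g b else 0\<^sub>m d d)"
    unfolding anti[OF a c] using cb by auto
  have m: "g b * g c \<in> carrier_mat d d" "g c * g b \<in> carrier_mat d d" "g a * g c \<in> carrier_mat d d" "g c * g a \<in> carrier_mat d d"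
    using a b c gg_carrier by auto
  have t: "g a * (g b * g c) \<in> carrier_mat d d" "g a * (g c * g b) \<in> carrier_mat d d"
     "g a * g c * g b \<in> carrier_mat d d" "g c * g a * g b \<in> carrier_mat d d"
    using m ca cb by (meson mult_carrier_mat)+
  have f1: "(g a * (g b * g c + g c * g b)) $$ (i, j) = (g a * (g b * g c)) $$ (i, j) + (g a * (g c * g b)) $$ (i, j)"
    unfolding mult_add_distrib_mat[OF ca m(1,2)] using t ij by (intro index_add_mat) auto
  have f2: "((g a * g c + g c * g a) * g b) $$ (i, j) = (g a * g c * g b) $$ (i, j) + (g c * g a * g b) $$ (i, j)"
    unfolding add_mult_distrib_mat[OF m(3,4) cb] using t ij by (intro index_add_mat) auto
  have "(g a * g b * g c) $$ (i, j) - (g c * (g a * g b)) $$ (i, j) =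
    (g a * (g b * g c + g c * g b)) $$ (i, j) - ((g a * g c + g c * g a) * g b) $$ (i, j)"
    unfolding f1 f2 assoc_mult_mat[OF ca cb cc] assoc_mult_mat[OF ca cc cb] assoc_mult_mat[OF cc ca cb] by simp
  then show ?thesis unfolding e1 e2 using ij by simp
qed

lemma spin_commutator:
  assumes X: "X \<in> so_odd n" and c: "c \<le> 2*n" and ij: "i < d" "j < d"
  shows "(spin X * g c) $$ (i, j) - (g c * spin X) $$ (i, j) = (\<Sum>a\<le>2*n. X $$ (a, c) * g a $$ (i, j))"
proof -
  let ?S = "\<Sum>a\<le>2*n. X $$ (a, c) * g a $$ (i, j)"
  have "(spin X * g c) $$ (i, j) - (g c * spin X) $$ (i, j) =
    (1/2) * (\<Sum>a\<le>2*n. \<Sum>b\<le>2*n. X $$ (a, b) * ((g a * g (dual n b) * g c) $$ (i, j) - (g c * (g a * g (dual n b))) $$ (i, j)))"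
    unfolding spin_mult_index[OF gc[OF c] ij] by (simp add: right_diff_distrib sum_subtractf)
  also have "\<dots> = (1/2) * (\<Sum>a\<le>2*n. \<Sum>b\<le>2*n. X $$ (a, b) *
      ((if b = c then g a $$ (i, j) else 0) - (if a = dual n c then g (dual n b) $$ (i, j) else 0)))"
  proof (intro arg_cong2[where f="(*)"] refl sum.cong)
    fix a b assume "a \<in> {..2*n}" "b \<in> {..2*n}"
    then have ab: "a \<le> 2*n" "b \<le> 2*n" by auto
    have "c = dual n a \<longleftrightarrow> a = dual n c" using ab c by (metis dual_dual)
    then show "(g a * g (dual n b) * g c) $$ (i, j) - (g c * (g a * g (dual n b))) $$ (i, j) =
      (if b = c then g a $$ (i, j) else 0) - (if a = dual n c then g (dual n b) $$ (i, j) else 0)"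
      using triple_commutator[OF ab(1) dual_le[OF ab(2)] c ij] ab by (simp add: eq_commute[of c])
  qed
  also have "\<dots> = (1/2) * ((\<Sum>a\<le>2*n. \<Sum>b\<le>2*n. if b = c then X $$ (a, c) * g a $$ (i, j) else 0) -
      (\<Sum>a\<le>2*n. if a = dual n c then \<Sum>b\<le>2*n. X $$ (dual n c, b) * g (dual n b) $$ (i, j) else 0))"
    unfolding right_diff_distrib sum_subtractf
    by (intro arg_cong2[where f="(*)"] arg_cong2[where f="(-)"] refl sum.cong) auto
  also have "\<dots> = (1/2) * (?S - (\<Sum>b\<le>2*n. X $$ (dual n c, b) * g (dual n b) $$ (i, j)))"
    using c dual_le[OF c] by simp
  also have "(\<Sum>b\<le>2*n. X $$ (dual n c, b) * g (dual n b) $$ (i, j)) = (\<Sum>b\<le>2*n. X $$ (dual n c, dual n b) * g b $$ (i, j))"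
  proof -
    have "(\<Sum>b\<le>2*n. X $$ (dual n c, b) * g (dual n b) $$ (i, j)) =
        (\<Sum>b\<le>2*n. X $$ (dual n c, dual n (dual n b)) * g (dual n b) $$ (i, j))"
      by (rule sum.cong) auto
    then show ?thesis using sum_dual[of "\<lambda>b. X $$ (dual n c, dual n b) * g b $$ (i, j)" n] by (rule trans)
  qed
  also have "\<dots> = (\<Sum>b\<le>2*n. - (X $$ (b, c) * g b $$ (i, j)))"
    by (rule sum.cong) (simp_all add: so_oddD(2)[OF X _ c])
  also have "\<dots> = - ?S" by (rule sum_negf)
  finally show ?thesis by simp
qed

lemma commutator_product:
  fixes R A B :: "complex mat"
  assumes R: "R \<in> carrier_mat d d" and A: "A \<in> carrier_mat d d" and B: "B \<in> carrier_mat d d" and ij: "i < d" "j < d"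
  shows "(R * (A * B)) $$ (i, j) - (A * B * R) $$ (i, j) =
    ((\<Sum>c<d. ((R * A) $$ (i, c) - (A * R) $$ (i, c)) * B $$ (c, j)) +
     (\<Sum>c<d. A $$ (i, c) * ((R * B) $$ (c, j) - (B * R) $$ (c, j))))"
proof -
  have c: "R * A \<in> carrier_mat d d" "A * R \<in> carrier_mat d d" "R * B \<in> carrier_mat d d" "B * R \<in> carrier_mat d d"
    using R A B by auto
  have e: "(\<Sum>c<d. (R * A) $$ (i, c) * B $$ (c, j)) = (R * (A * B)) $$ (i, j)"
    "(\<Sum>c<d. (A * R) $$ (i, c) * B $$ (c, j)) = (A * (R * B)) $$ (i, j)"
    "(\<Sum>c<d. A $$ (i, c) * (R * B) $$ (c, j)) = (A * (R * B)) $$ (i, j)"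
    "(\<Sum>c<d. A $$ (i, c) * (B * R) $$ (c, j)) = (A * B * R) $$ (i, j)"
    using index_mult_sum[OF c(1) B ij] index_mult_sum[OF c(2) B ij] index_mult_sum[OF A c(3) ij] index_mult_sum[OF A c(4) ij]
      assoc_mult_mat[OF R A B] assoc_mult_mat[OF A R B] assoc_mult_mat[OF A B R] by simp_all
  have "(\<Sum>c<d. ((R * A) $$ (i, c) - (A * R) $$ (i, c)) * B $$ (c, j)) = (R * (A * B)) $$ (i, j) - (A * (R * B)) $$ (i, j)"
    unfolding e[symmetric] by (simp add: left_diff_distrib sum_subtractf del: index_mult_mat(1))
  moreover have "(\<Sum>c<d. A $$ (i, c) * ((R * B) $$ (c, j) - (B * R) $$ (c, j))) = (A * (R * B)) $$ (i, j) - (A * B * R) $$ (i, j)"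
    unfolding e(3,4)[symmetric] by (simp add: right_diff_distrib sum_subtractf del: index_mult_mat(1))
  ultimately show ?thesis by (simp del: index_mult_mat(1))
qed

text \<open>
  The commutator with \<open>spin X\<close> is a derivation, hence determined on the products \<open>g c * g (dual n e)\<close> that
  make up \<open>spin Y\<close> by its values on the generators.
\<close>
lemma spin_bracket:
  assumes X: "X \<in> so_odd n" and Y: "Y \<in> so_odd n"
  shows "spin (lie_bracket X Y) = lie_bracket (spin X) (spin Y)"
proof (rule eq_matI)
  fix i j assume "i < dim_row (lie_bracket (spin X) (spin Y))" "j < dim_col (lie_bracket (spin X) (spin Y))"
  then have ij: "i < d" "j < d" by (auto simp: lie_bracket_def spin_def)
  define M where "M a b = (g a * g b) $$ (i, j)" for a b
  have Msum: "M a b = (\<Sum>c<d. g a $$ (i, c) * g b $$ (c, j))" if "a \<le> 2*n" "b \<le> 2*n" for a b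
    unfolding M_def by (rule index_mult_sum[OF gc gc ij]) (use that in auto)
  have K: "(spin X * (g c * g (dual n e))) $$ (i, j) - (g c * g (dual n e) * spin X) $$ (i, j) =
     (\<Sum>a\<le>2*n. X $$ (a, c) * M a (dual n e)) - (\<Sum>a\<le>2*n. X $$ (e, a) * M c (dual n a))"
    if ce: "c \<le> 2*n" "e \<le> 2*n" for c e
  proof -
    have e': "dual n e \<le> 2*n" using ce dual_le by blast
    have s: "(\<Sum>k<d. ((spin X * g c) $$ (i, k) - (g c * spin X) $$ (i, k)) * g (dual n e) $$ (k, j)) = (\<Sum>a\<le>2*n. X $$ (a, c) * M a (dual n e))"
    proof -
      have "(\<Sum>k<d. ((spin X * g c) $$ (i, k) - (g c * spin X) $$ (i, k)) * g (dual n e) $$ (k, j)) =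
         (\<Sum>k<d. \<Sum>a\<le>2*n. X $$ (a, c) * (g a $$ (i, k) * g (dual n e) $$ (k, j)))"
        using ij by (intro sum.cong refl) (simp add: spin_commutator[OF X ce(1)] sum_distrib_right mult.assoc del: index_mult_mat(1))
      also have "\<dots> = (\<Sum>a\<le>2*n. X $$ (a, c) * M a (dual n e))"
        by (subst sum.swap) (simp add: Msum[OF _ e'] sum_distrib_left)
      finally show ?thesis .
    qed
    have t: "(\<Sum>k<d. g c $$ (i, k) * ((spin X * g (dual n e)) $$ (k, j) - (g (dual n e) * spin X) $$ (k, j))) =
       (\<Sum>a\<le>2*n. X $$ (a, dual n e) * M c a)"
    proof -
      have "(\<Sum>k<d. g c $$ (i, k) * ((spin X * g (dual n e)) $$ (k, j) - (g (dual n e) * spin X) $$ (k, j))) =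
         (\<Sum>k<d. \<Sum>a\<le>2*n. X $$ (a, dual n e) * (g c $$ (i, k) * g a $$ (k, j)))"
        using ij by (intro sum.cong refl) (simp add: spin_commutator[OF X e'] sum_distrib_left ac_simps del: index_mult_mat(1))
      also have "\<dots> = (\<Sum>a\<le>2*n. X $$ (a, dual n e) * M c a)"
        by (subst sum.swap) (simp add: Msum[OF ce(1)] sum_distrib_left)
      finally show ?thesis .
    qed
    have "(\<Sum>a\<le>2*n. X $$ (a, dual n e) * M c a) = (\<Sum>a\<le>2*n. X $$ (dual n a, dual n e) * M c (dual n a))"
      using sum_dual[of "\<lambda>a. X $$ (a, dual n e) * M c a" n] by simp
    also have "\<dots> = (\<Sum>a\<le>2*n. - (X $$ (e, a) * M c (dual n a)))"
      by (rule sum.cong) (simp_all add: so_oddD(2)[OF X ce(2)])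
    also have "\<dots> = - (\<Sum>a\<le>2*n. X $$ (e, a) * M c (dual n a))" by (rule sum_negf)
    finally show ?thesis
      using commutator_product[OF spin_carrier gc[OF ce(1)] gc[OF e'] ij, of X] s t by simp
  qed
  have "lie_bracket (spin X) (spin Y) $$ (i, j) = (spin X * spin Y) $$ (i, j) - (spin Y * spin X) $$ (i, j)"
    unfolding lie_bracket_def using ij by (subst index_minus_mat) (auto simp: spin_def)
  also have "\<dots> = (1/2) * (\<Sum>c\<le>2*n. \<Sum>e\<le>2*n. Y $$ (c, e) *
      ((spin X * (g c * g (dual n e))) $$ (i, j) - (g c * g (dual n e) * spin X) $$ (i, j)))"
    unfolding spin_mult_index(2)[OF spin_carrier ij, of X Y] spin_mult_index(1)[OF spin_carrier ij, of Y X]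
    by (simp add: right_diff_distrib sum_subtractf)
  also have "\<dots> = (1/2) * (\<Sum>c\<le>2*n. \<Sum>e\<le>2*n. Y $$ (c, e) *
      ((\<Sum>a\<le>2*n. X $$ (a, c) * M a (dual n e)) - (\<Sum>a\<le>2*n. X $$ (e, a) * M c (dual n a))))"
    by (intro arg_cong2[where f="(*)"] refl sum.cong) (simp add: K)
  also have "\<dots> = (1/2) * ((\<Sum>a\<le>2*n. \<Sum>e\<le>2*n. (\<Sum>c\<le>2*n. X $$ (a, c) * Y $$ (c, e)) * M a (dual n e)) -
      (\<Sum>a\<le>2*n. \<Sum>e\<le>2*n. (\<Sum>c\<le>2*n. Y $$ (a, c) * X $$ (c, e)) * M a (dual n e)))"
  proof -
    have "(\<Sum>c\<le>2*n. \<Sum>e\<le>2*n. Y $$ (c, e) * (\<Sum>a\<le>2*n. X $$ (a, c) * M a (dual n e)))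
        = (\<Sum>c\<le>2*n. \<Sum>e\<le>2*n. \<Sum>a\<le>2*n. X $$ (a, c) * Y $$ (c, e) * M a (dual n e))"
      by (simp add: sum_distrib_left ac_simps)
    also have "\<dots> = (\<Sum>e\<le>2*n. \<Sum>c\<le>2*n. \<Sum>a\<le>2*n. X $$ (a, c) * Y $$ (c, e) * M a (dual n e))"
      by (rule sum.swap)
    also have "\<dots> = (\<Sum>e\<le>2*n. \<Sum>a\<le>2*n. \<Sum>c\<le>2*n. X $$ (a, c) * Y $$ (c, e) * M a (dual n e))"
      by (intro sum.cong refl sum.swap)
    also have "\<dots> = (\<Sum>a\<le>2*n. \<Sum>e\<le>2*n. \<Sum>c\<le>2*n. X $$ (a, c) * Y $$ (c, e) * M a (dual n e))"
      by (rule sum.swap)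
    finally have 1: "(\<Sum>c\<le>2*n. \<Sum>e\<le>2*n. Y $$ (c, e) * (\<Sum>a\<le>2*n. X $$ (a, c) * M a (dual n e)))
        = (\<Sum>a\<le>2*n. \<Sum>e\<le>2*n. (\<Sum>c\<le>2*n. X $$ (a, c) * Y $$ (c, e)) * M a (dual n e))"
      by (simp add: sum_distrib_right)
    have "(\<Sum>c\<le>2*n. \<Sum>e\<le>2*n. Y $$ (c, e) * (\<Sum>a\<le>2*n. X $$ (e, a) * M c (dual n a)))
        = (\<Sum>c\<le>2*n. \<Sum>e\<le>2*n. \<Sum>a\<le>2*n. Y $$ (c, e) * X $$ (e, a) * M c (dual n a))"
      by (simp add: sum_distrib_left ac_simps)
    also have "\<dots> = (\<Sum>c\<le>2*n. \<Sum>a\<le>2*n. \<Sum>e\<le>2*n. Y $$ (c, e) * X $$ (e, a) * M c (dual n a))"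
      by (intro sum.cong refl sum.swap)
    finally have 2: "(\<Sum>c\<le>2*n. \<Sum>e\<le>2*n. Y $$ (c, e) * (\<Sum>a\<le>2*n. X $$ (e, a) * M c (dual n a)))
        = (\<Sum>a\<le>2*n. \<Sum>e\<le>2*n. (\<Sum>c\<le>2*n. Y $$ (a, c) * X $$ (c, e)) * M a (dual n e))"
      by (simp add: sum_distrib_right)
    show ?thesis unfolding right_diff_distrib sum_subtractf 1 2 ..
  qed
  also have "\<dots> = (1/2) * (\<Sum>a\<le>2*n. \<Sum>e\<le>2*n. lie_bracket X Y $$ (a, e) * M a (dual n e))"
    by (simp add: lie_bracket_entry[OF so_oddD(1)[OF X] so_oddD(1)[OF Y]] left_diff_distrib sum_subtractf)
  also have "\<dots> = spin (lie_bracket X Y) $$ (i, j)"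
    unfolding spin_index[OF ij] M_def ..
  finally show "spin (lie_bracket X Y) $$ (i, j) = lie_bracket (spin X) (spin Y) $$ (i, j)" ..
qed (auto simp: spin_def lie_bracket_def)

lemma spin_unitary: "unitary_rep n d spin"
  unfolding unitary_rep_def representation_def
proof (intro conjI ballI allI)
  fix X Y assume X: "X \<in> so_odd n" and Y: "Y \<in> so_odd n"
  show "spin X \<in> carrier_mat d d" by simp
  show "spin (lie_bracket X Y) = lie_bracket (spin X) (spin Y)" by (rule spin_bracket[OF X Y])
  have e: "(X + Y) $$ (a, b) = X $$ (a, b) + Y $$ (a, b)" if "a \<le> 2*n" "b \<le> 2*n" for a b
    using that so_oddD(1)[OF X] so_oddD(1)[OF Y] by simp
  show "spin (X + Y) = spin X + spin Y"
  proof (rule eq_matI)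
    fix i j assume "i < dim_row (spin X + spin Y)" "j < dim_col (spin X + spin Y)"
    then have ij: "i < d" "j < d" by (auto simp: spin_def)
    have "(spin X + spin Y) $$ (i, j) = spin X $$ (i, j) + spin Y $$ (i, j)"
      using ij by (intro index_add_mat) (auto simp: spin_def)
    then show "spin (X + Y) $$ (i, j) = (spin X + spin Y) $$ (i, j)"
      unfolding spin_index[OF ij] by (simp add: e distrib_right sum.distrib distrib_left del: index_mult_mat(1) index_add_mat(1))
  qed (auto simp: spin_def)
next
  fix z X assume X: "X \<in> so_odd n"
  have e: "(z \<cdot>\<^sub>m X) $$ (a, b) = z * X $$ (a, b)" if "a \<le> 2*n" "b \<le> 2*n" for a b
    using that so_oddD(1)[OF X] by simp
  show "spin (z \<cdot>\<^sub>m X) = z \<cdot>\<^sub>m spin X"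
  proof (rule eq_matI)
    fix i j assume "i < dim_row (z \<cdot>\<^sub>m spin X)" "j < dim_col (z \<cdot>\<^sub>m spin X)"
    then have ij: "i < d" "j < d" by (auto simp: spin_def)
    have "(z \<cdot>\<^sub>m spin X) $$ (i, j) = z * spin X $$ (i, j)"
      using ij by (intro index_smult_mat(1)) (auto simp: spin_def)
    then show "spin (z \<cdot>\<^sub>m X) $$ (i, j) = (z \<cdot>\<^sub>m spin X) $$ (i, j)"
      unfolding spin_index[OF ij] by (simp add: e sum_distrib_left ac_simps del: index_mult_mat(1) index_smult_mat(1))
  qed (auto simp: spin_def)
next
  fix X assume X: "X \<in> so_odd n"
  show "spin (adj X) = adj (spin X)"
  proof (rule eq_matI)
    fix i j assume "i < dim_row (adj (spin X))" "j < dim_col (adj (spin X))"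
    then have ij: "i < d" "j < d" by (auto simp: spin_def)
    have e: "cnj ((g a * g (dual n b)) $$ (j, i)) = (g b * g (dual n a)) $$ (i, j)" if ab: "a \<le> 2*n" "b \<le> 2*n" for a b
    proof -
      have b: "dual n b \<le> 2*n" using ab dual_le by blast
      have "adj (g a * g (dual n b)) = g b * g (dual n a)"
        unfolding adj_mult[OF gc[OF ab(1)] gc[OF b]] using ab by (simp add: adj_g b)
      moreover have "adj (g a * g (dual n b)) $$ (i, j) = cnj ((g a * g (dual n b)) $$ (j, i))"
        using gg_carrier[OF ab(1) b] ij by (intro adj_index) auto
      ultimately show ?thesis by simp
    qed
    have "adj (spin X) $$ (i, j) = cnj (spin X $$ (j, i))"
      using ij by (intro adj_index) (auto simp: spin_def)
    also have "\<dots> = (1/2) * (\<Sum>a\<le>2*n. \<Sum>b\<le>2*n. cnj (X $$ (a, b)) * (g b * g (dual n a)) $$ (i, j))"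
      unfolding spin_index[OF ij(2,1)] by (simp add: e)
    also have "\<dots> = (1/2) * (\<Sum>b\<le>2*n. \<Sum>a\<le>2*n. cnj (X $$ (a, b)) * (g b * g (dual n a)) $$ (i, j))"
      by (subst sum.swap) simp
    also have "\<dots> = (1/2) * (\<Sum>b\<le>2*n. \<Sum>a\<le>2*n. adj X $$ (b, a) * (g b * g (dual n a)) $$ (i, j))"
      using so_oddD(1)[OF X] by (intro arg_cong2[where f="(*)"] refl sum.cong) auto
    also have "\<dots> = spin (adj X) $$ (i, j)"
      unfolding spin_index[OF ij] ..
    finally show "spin (adj X) $$ (i, j) = adj (spin X) $$ (i, j)" ..
  qed (auto simp: spin_def)
qed

lemma spin_vec_index:
  assumes i: "i < d" and z: "z \<in> carrier_vec d"
  shows "(spin X *\<^sub>v z) $ i = (1/2) * (\<Sum>a\<le>2*n. \<Sum>b\<le>2*n. X $$ (a, b) * (g a *\<^sub>v (g (dual n b) *\<^sub>v z)) $ i)"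
proof -
  have "(spin X *\<^sub>v z) $ i = (\<Sum>c<d. spin X $$ (i, c) * z $ c)"
    by (rule index_mult_vec_sum[OF spin_carrier z i])
  also have "\<dots> = (\<Sum>c<d. (1/2) * (\<Sum>a\<le>2*n. \<Sum>b\<le>2*n. X $$ (a, b) * ((g a * g (dual n b)) $$ (i, c) * z $ c)))"
    using i by (intro sum.cong) (simp_all add: spin_index sum_distrib_right mult.assoc)
  also have "\<dots> = (1/2) * (\<Sum>a\<le>2*n. \<Sum>b\<le>2*n. X $$ (a, b) * (\<Sum>c<d. (g a * g (dual n b)) $$ (i, c) * z $ c))"
    by (rule sum_swap_weighted)
  also have "\<dots> = (1/2) * (\<Sum>a\<le>2*n. \<Sum>b\<le>2*n. X $$ (a, b) * (g a *\<^sub>v (g (dual n b) *\<^sub>v z)) $ i)"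
  proof (intro arg_cong2[where f="(*)"] refl sum.cong)
    fix a b assume "a \<in> {..2*n}" "b \<in> {..2*n}"
    then have ab: "a \<le> 2*n" "dual n b \<le> 2*n" by (auto simp: dual_le)
    have "(\<Sum>c<d. (g a * g (dual n b)) $$ (i, c) * z $ c) = (g a * g (dual n b) *\<^sub>v z) $ i"
      by (rule index_mult_vec_sum[OF gg_carrier[OF ab] z i, symmetric])
    also have "g a * g (dual n b) *\<^sub>v z = g a *\<^sub>v (g (dual n b) *\<^sub>v z)"
      by (rule assoc_mult_mat_vec[OF gc[OF ab(1)] gc[OF ab(2)] z])
    finally show "(\<Sum>c<d. (g a * g (dual n b)) $$ (i, c) * z $ c) = (g a *\<^sub>v (g (dual n b) *\<^sub>v z)) $ i" .
  qed
  finally show ?thesis .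
qed

lemma anti_vec:
  assumes ab: "a \<le> 2*n" "b \<le> 2*n" and z: "z \<in> carrier_vec d"
  shows "g a *\<^sub>v (g b *\<^sub>v z) + g b *\<^sub>v (g a *\<^sub>v z) = (if b = dual n a then z else 0\<^sub>v d)"
proof -
  have "(g a * g b + g b * g a) *\<^sub>v z = g a *\<^sub>v (g b *\<^sub>v z) + g b *\<^sub>v (g a *\<^sub>v z)"
    using add_mult_distrib_mat_vec[OF gg_carrier[OF ab] gg_carrier[OF ab(2,1)] z]
      assoc_mult_mat_vec[OF gc[OF ab(1)] gc[OF ab(2)] z] assoc_mult_mat_vec[OF gc[OF ab(2)] gc[OF ab(1)] z] by simp
  then show ?thesis unfolding anti[OF ab] using z by (auto simp: zero_mat_vec)
qed

lemma g_zero: "a \<le> 2*n \<Longrightarrow> g a *\<^sub>v 0\<^sub>v d = 0\<^sub>v d"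
  using gc[of a] by (intro eq_vecI) (auto simp: scalar_prod_def)

lemma g_vec: "a \<le> 2*n \<Longrightarrow> z \<in> carrier_vec d \<Longrightarrow> g a *\<^sub>v z \<in> carrier_vec d"
  using gc by (meson mult_mat_vec_carrier)

lemma anti_vec_killed:
  assumes a: "a \<le> 2*n" and b: "b \<le> 2*n" and z: "z \<in> carrier_vec d" "g a *\<^sub>v z = 0\<^sub>v d"
  shows "g a *\<^sub>v (g b *\<^sub>v z) = (if b = dual n a then z else 0\<^sub>v d)"
  using anti_vec[OF a b z(1)] g_vec[OF a g_vec[OF b z(1)]] unfolding z(2) g_zero[OF b] by simp

text \<open>
  The generators \<open>g 1, \<dots>, g n\<close> kill \<open>x\<close>.  For a positive root vector every term of \<open>spin X\<close> has such a
  generator on the right or can be reordered to have one; for a Cartan element the reordering leaves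
  half the sum of the first \<open>n\<close> diagonal entries.
\<close>
lemma spin_hw: "hw_vector n (fund_weight n n) d spin x"
  unfolding hw_vector_def
proof (intro conjI ballI)
  show "x \<in> carrier_vec d" by (rule xc)
next
  fix H assume H: "H \<in> cartan n"
  show "spin H *\<^sub>v x = eval_weight n (fund_weight n n) H \<cdot>\<^sub>v x"
  proof (rule eq_vecI)
    fix i assume "i < dim_vec (eval_weight n (fund_weight n n) H \<cdot>\<^sub>v x)"
    then have i: "i < d" using xc by simp
    have "(spin H *\<^sub>v x) $ i = (1/2) * (\<Sum>a\<le>2*n. \<Sum>b\<le>2*n. if b = a then H $$ (a, a) * (g a *\<^sub>v (g (dual n a) *\<^sub>v x)) $ i else 0)"
      unfolding spin_vec_index[OF i xc]
      by (intro arg_cong2[where f="(*)"] refl sum.cong) (auto simp: cartan_entry[OF H])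
    also have "\<dots> = (1/2) * (\<Sum>a\<le>2*n. H $$ (a, a) * (g a *\<^sub>v (g (dual n a) *\<^sub>v x)) $ i)" by simp
    also have "(\<Sum>a\<le>2*n. H $$ (a, a) * (g a *\<^sub>v (g (dual n a) *\<^sub>v x)) $ i) = (\<Sum>a=1..n. H $$ (a, a) * x $ i)"
    proof (rule sum.mono_neutral_cong_right)
      show "\<forall>a\<in>{..2*n} - {1..n}. H $$ (a, a) * (g a *\<^sub>v (g (dual n a) *\<^sub>v x)) $ i = 0"
      proof
        fix a assume a: "a \<in> {..2*n} - {1..n}"
        show "H $$ (a, a) * (g a *\<^sub>v (g (dual n a) *\<^sub>v x)) $ i = 0"
        proof (cases "a = 0")
          case True
          have "H $$ (0, 0) = 0"
            using cartan_entry[OF H, of 0 0] by (simp add: wt_def eval_weight_def)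
          then show ?thesis using True by simp
        next
          case False
          then have "dual n a \<in> {1..n}" "a \<le> 2*n" using a by (auto simp: dual_def)
          then have "g a *\<^sub>v (g (dual n a) *\<^sub>v x) = 0\<^sub>v d" using kill g_zero by simp
          then show ?thesis using i by simp
        qed
      qed
      fix a assume a: "a \<in> {1..n}"
      then have "g a *\<^sub>v (g (dual n a) *\<^sub>v x) = x"
        using anti_vec_killed[of a "dual n a" x] kill[OF a] xc dual_le[of a n] by simp
      then show "H $$ (a, a) * (g a *\<^sub>v (g (dual n a) *\<^sub>v x)) $ i = H $$ (a, a) * x $ i" by simp
    qed auto
    also have "(1/2) * (\<Sum>a=1..n. H $$ (a, a) * x $ i) = eval_weight n (fund_weight n n) H * x $ i"
      by (simp add: eval_weight_def fund_weight_def sum_distrib_left sum_distrib_right)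
    finally show "(spin H *\<^sub>v x) $ i = (eval_weight n (fund_weight n n) H \<cdot>\<^sub>v x) $ i" using i xc by simp
  qed (use xc in \<open>auto simp: spin_def\<close>)
next
  fix \<alpha> X assume \<alpha>: "\<alpha> \<in> set (pos_roots n)" and X: "X \<in> root_space (so_odd n) n \<alpha>"
  show "spin X *\<^sub>v x = 0\<^sub>v d"
  proof (rule eq_vecI)
    fix i assume "i < dim_vec (0\<^sub>v d :: complex vec)"
    then have i: "i < d" by simp
    have "X $$ (a, b) * (g a *\<^sub>v (g (dual n b) *\<^sub>v x)) $ i = 0" if ab: "a \<le> 2*n" "b \<le> 2*n" for a b
    proof (cases "b \<le> n")
      case False
      then have "dual n b \<in> {1..n}" using ab by (auto simp: dual_def)
      then show ?thesis using kill g_zero[OF ab(1)] i by simp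
    next
      case True
      show ?thesis
      proof (cases "X $$ (a, b) = 0")
        case nz: False
        then have u: "1 \<le> a" "a \<le> n" "b \<noteq> 0 \<Longrightarrow> a < b"
          using pos_root_space_upper[OF \<alpha> X nz ab(1) True] by auto
        then have "a \<noteq> b" by auto
        then have "dual n b \<noteq> dual n a" using ab by (simp add: dual_eq_iff)
        then have "g a *\<^sub>v (g (dual n b) *\<^sub>v x) = 0\<^sub>v d"
          using anti_vec_killed[of a "dual n b" x] kill[of a] u xc ab dual_le[of b n] by simp
        then show ?thesis using i by simp
      qed simp
    qed
    then have "(\<Sum>a\<le>2*n. \<Sum>b\<le>2*n. X $$ (a, b) * (g a *\<^sub>v (g (dual n b) *\<^sub>v x)) $ i) = 0"
      by (intro sum.neutral ballI) auto
    then have "(spin X *\<^sub>v x) $ i = 0" unfolding spin_vec_index[OF i xc] by simp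
    then show "(spin X *\<^sub>v x) $ i = 0\<^sub>v d $ i" using i by simp
  qed (auto simp: spin_def)
qed

end

section \<open>Modules with fundamental highest weights\<close>

lemma dual_unitary:
  assumes U: "unitary_rep n d \<rho>"
  shows "unitary_rep n d (\<lambda>X. (-1) \<cdot>\<^sub>m transpose_mat (\<rho> X))"
proof -
  have R: "representation n d \<rho>" using U by (simp add: unitary_rep_def)
  let ?r = "\<lambda>X. (-1) \<cdot>\<^sub>m transpose_mat (\<rho> X)"
  note c = rep_carrier[OF R]
  have "?r (X + Y) = ?r X + ?r Y" if "X \<in> so_odd n" "Y \<in> so_odd n" for X Y
    unfolding rep_add[OF R that] using c[OF that(1)] c[OF that(2)] by (intro eq_matI) auto
  moreover have "?r (z \<cdot>\<^sub>m X) = z \<cdot>\<^sub>m ?r X" if "X \<in> so_odd n" for z X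
    unfolding rep_smult[OF R that] using c[OF that(1)] by (intro eq_matI) auto
  moreover have "?r (lie_bracket X Y) = lie_bracket (?r X) (?r Y)" if X: "X \<in> so_odd n" and Y: "Y \<in> so_odd n" for X Y
  proof -
    have t: "transpose_mat (\<rho> X) \<in> carrier_mat d d" "transpose_mat (\<rho> Y) \<in> carrier_mat d d"
      using c[OF X] c[OF Y] by auto
    have m: "?r A * ?r B = transpose_mat (\<rho> B * \<rho> A)" if A: "A \<in> so_odd n" and B: "B \<in> so_odd n" for A B
    proof -
      have t: "transpose_mat (\<rho> A) \<in> carrier_mat d d" "transpose_mat (\<rho> B) \<in> carrier_mat d d"
        using c[OF A] c[OF B] by auto
      have "?r A * ?r B = (-1) \<cdot>\<^sub>m ((-1) \<cdot>\<^sub>m (transpose_mat (\<rho> A) * transpose_mat (\<rho> B)))"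
        using t by (simp add: mult_smult_assoc_mat[of _ d d _ d] mult_smult_distrib[of _ d d _ d])
      also have "\<dots> = transpose_mat (\<rho> A) * transpose_mat (\<rho> B)" by (rule eq_matI) auto
      also have "\<dots> = transpose_mat (\<rho> B * \<rho> A)" by (rule transpose_mult[symmetric, OF c[OF B] c[OF A]])
      finally show ?thesis .
    qed
    show ?thesis unfolding lie_bracket_def[of "?r X"] m[OF X Y] m[OF Y X] rep_bracket[OF R X Y]
      using c[OF X] c[OF Y] by (intro eq_matI) auto
  qed
  moreover have "?r (adj X) = adj (?r X)" if "X \<in> so_odd n" for X
  proof -
    have "\<rho> (adj X) = adj (\<rho> X)" using U that by (simp add: unitary_rep_def)
    then show ?thesis using c[OF that] by (intro eq_matI) auto
  qed
  ultimately show ?thesis using c by (simp add: unitary_rep_def representation_def)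
qed

context clifford_module
begin

text \<open>
  The product \<open>g 1 * \<cdots> * g k\<close>, as an element of \<open>End S\<close>, is a highest weight vector of weight
  \<open>\<epsilon>\<^sub>1 + \<dots> + \<epsilon>\<^sub>k\<close>: it corresponds to \<open>e\<^sub>1 \<and> \<dots> \<and> e\<^sub>k\<close>.
\<close>
primrec gprod :: "nat \<Rightarrow> complex mat" where
  "gprod 0 = 1\<^sub>m d"
| "gprod (Suc k) = gprod k * g (Suc k)"

lemma gprod_carrier: "k \<le> n \<Longrightarrow> gprod k \<in> carrier_mat d d"
proof (induction k)
  case (Suc k)
  then show ?case using mult_carrier_mat[of "gprod k" d d "g (Suc k)" d] gc[of "Suc k"] by simp
qed simp

lemma anti_swap:
  assumes "a \<le> 2*n" "b \<le> 2*n" "b \<noteq> dual n a"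
  shows "g a * g b = (-1) \<cdot>\<^sub>m (g b * g a)"
proof (rule eq_matI)
  fix i j assume "i < dim_row ((-1) \<cdot>\<^sub>m (g b * g a))" "j < dim_col ((-1) \<cdot>\<^sub>m (g b * g a))"
  then have ij: "i < d" "j < d" using gc assms by auto
  have "((-1) \<cdot>\<^sub>m (g b * g a)) $$ (i, j) = - (g b * g a) $$ (i, j)"
    using ij gg_carrier[OF assms(2,1)] by (subst index_smult_mat(1)) auto
  then show "(g a * g b) $$ (i, j) = ((-1) \<cdot>\<^sub>m (g b * g a)) $$ (i, j)"
    using anti_index[OF assms(1,2) ij] assms(3) by (simp add: add_eq_0_iff2 del: index_mult_mat(1) index_smult_mat(1))
qed (use gc assms in auto)

text \<open>
  Move \<open>g a\<close> to the left until it meets its own copy; its square is zero.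
\<close>
lemma gprod_absorb:
  assumes "k \<le> n" "1 \<le> a" "a \<le> k"
  shows "gprod k * g a = 0\<^sub>m d d"
  using assms
proof (induction k)
  case (Suc k)
  have T: "gprod k \<in> carrier_mat d d" using Suc.prems by (intro gprod_carrier) simp
  have ca: "g a \<in> carrier_mat d d" "g (Suc k) \<in> carrier_mat d d" using Suc.prems by (auto intro!: gc)
  have nd: "b \<noteq> dual n c" if "b \<le> n" "1 \<le> c" "c \<le> n" for b c using that by (auto simp: dual_def)
  have "g (Suc k) * g a = (-1) \<cdot>\<^sub>m (g a * g (Suc k))"
    using Suc.prems by (intro anti_swap nd) auto
  then have e: "gprod (Suc k) * g a = gprod k * ((-1) \<cdot>\<^sub>m (g a * g (Suc k)))"
    using assoc_mult_mat[OF T ca(2,1)] by simp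
  show ?case
  proof (cases "a = Suc k")
    case False
    have "gprod k * ((-1) \<cdot>\<^sub>m (g a * g (Suc k))) = (-1) \<cdot>\<^sub>m (gprod k * (g a * g (Suc k)))"
      using T ca by (intro mult_smult_distrib) auto
    also have "gprod k * (g a * g (Suc k)) = gprod k * g a * g (Suc k)"
      by (rule assoc_mult_mat[OF T ca, symmetric])
    also have "gprod k * g a = 0\<^sub>m d d" using Suc False by simp
    also have "(-1) \<cdot>\<^sub>m (0\<^sub>m d d * g (Suc k)) = 0\<^sub>m d d" using ca by (intro eq_matI) auto
    finally show ?thesis unfolding e .
  next
    case True
    have "(g a * g a) $$ (i, j) = 0" if "i < d" "j < d" for i j
      using anti_index[of a a i j] nd[of a a] Suc.prems that by (simp del: index_mult_mat(1))
    then have "g a * g a = 0\<^sub>m d d" using ca by (intro eq_matI) (auto simp del: index_mult_mat(1))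
    then show ?thesis using assoc_mult_mat[OF T ca(2,1)] True T by simp
  qed
qed simp

text \<open>
  The commutator with \<open>spin X\<close> is a derivation.
\<close>
lemma gprod_commutator_step:
  assumes X: "X \<in> so_odd n" and k: "Suc k \<le> n"
    and IH: "\<And>i j. i < d \<Longrightarrow> j < d \<Longrightarrow> (spin X * gprod k) $$ (i, j) - (gprod k * spin X) $$ (i, j) = c * gprod k $$ (i, j)"
    and ij: "i < d" "j < d"
  shows "(spin X * gprod (Suc k)) $$ (i, j) - (gprod (Suc k) * spin X) $$ (i, j) =
    c * gprod (Suc k) $$ (i, j) + (\<Sum>a\<le>2*n. X $$ (a, Suc k) * (gprod k * g a) $$ (i, j))"
proof -
  have T: "gprod k \<in> carrier_mat d d" using k by (intro gprod_carrier) simp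
  have G: "g (Suc k) \<in> carrier_mat d d" using k by (intro gc) simp
  have k2: "Suc k \<le> 2*n" using k by simp
  have 1: "(\<Sum>p<d. ((spin X * gprod k) $$ (i, p) - (gprod k * spin X) $$ (i, p)) * g (Suc k) $$ (p, j)) =
      c * gprod (Suc k) $$ (i, j)"
  proof -
    have "(\<Sum>p<d. ((spin X * gprod k) $$ (i, p) - (gprod k * spin X) $$ (i, p)) * g (Suc k) $$ (p, j)) =
      (\<Sum>p<d. c * (gprod k $$ (i, p) * g (Suc k) $$ (p, j)))"
      using IH[OF ij(1)] by (intro sum.cong refl) (simp del: index_mult_mat(1))
    then show ?thesis using index_mult_sum[OF T G ij] by (simp add: sum_distrib_left del: index_mult_mat(1))
  qed
  have 2: "(\<Sum>p<d. gprod k $$ (i, p) * ((spin X * g (Suc k)) $$ (p, j) - (g (Suc k) * spin X) $$ (p, j))) =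
      (\<Sum>a\<le>2*n. X $$ (a, Suc k) * (gprod k * g a) $$ (i, j))"
  proof -
    have "(\<Sum>p<d. gprod k $$ (i, p) * ((spin X * g (Suc k)) $$ (p, j) - (g (Suc k) * spin X) $$ (p, j))) =
      (\<Sum>p<d. \<Sum>a\<le>2*n. X $$ (a, Suc k) * (gprod k $$ (i, p) * g a $$ (p, j)))"
      using spin_commutator[OF X k2 _ ij(2)]
      by (intro sum.cong refl) (simp add: sum_distrib_left ac_simps del: index_mult_mat(1))
    also have "\<dots> = (\<Sum>a\<le>2*n. \<Sum>p<d. X $$ (a, Suc k) * (gprod k $$ (i, p) * g a $$ (p, j)))" by (rule sum.swap)
    also have "\<dots> = (\<Sum>a\<le>2*n. X $$ (a, Suc k) * (gprod k * g a) $$ (i, j))"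
    proof (rule sum.cong)
      fix a assume "a \<in> {..2*n}"
      then have "(gprod k * g a) $$ (i, j) = (\<Sum>p<d. gprod k $$ (i, p) * g a $$ (p, j))"
        by (intro index_mult_sum[OF T gc ij]) simp
      then show "(\<Sum>p<d. X $$ (a, Suc k) * (gprod k $$ (i, p) * g a $$ (p, j))) = X $$ (a, Suc k) * (gprod k * g a) $$ (i, j)"
        by (simp add: sum_distrib_left del: index_mult_mat(1))
    qed simp
    finally show ?thesis .
  qed
  show ?thesis using commutator_product[OF spin_carrier T G ij, of X] unfolding 1 2 by simp
qed

lemma gprod_commutator_cartan:
  assumes H: "H \<in> cartan n" and "k \<le> n" "i < d" "j < d"
  shows "(spin H * gprod k) $$ (i, j) - (gprod k * spin H) $$ (i, j) = (\<Sum>a=1..k. H $$ (a, a)) * gprod k $$ (i, j)"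
  using assms(2-)
proof (induction k arbitrary: i j)
  case 0
  then show ?case using right_mult_one_mat[OF spin_carrier[of H]] left_mult_one_mat[OF spin_carrier[of H]]
    by (simp del: index_mult_mat(1))
next
  case (Suc k)
  have k: "k \<le> n" "Suc k \<le> 2*n" using Suc.prems by auto
  have s: "(\<Sum>a\<le>2*n. H $$ (a, Suc k) * (gprod k * g a) $$ (i, j)) = H $$ (Suc k, Suc k) * gprod (Suc k) $$ (i, j)"
  proof -
    have "(\<Sum>a\<le>2*n. H $$ (a, Suc k) * (gprod k * g a) $$ (i, j)) =
      (\<Sum>a\<le>2*n. if a = Suc k then H $$ (Suc k, Suc k) * (gprod k * g (Suc k)) $$ (i, j) else 0)"
      using k by (intro sum.cong refl) (auto simp: cartan_entry[OF H] simp del: index_mult_mat(1))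
    then show ?thesis using k by (simp del: index_mult_mat(1))
  qed
  show ?case
    using gprod_commutator_step[OF cartan_so_odd[OF H] Suc.prems(1) Suc.IH[OF k(1)] Suc.prems(2,3)] unfolding s
    by (simp add: algebra_simps del: index_mult_mat(1) gprod.simps)
qed

text \<open>
  A positive root vector maps \<open>e\<^sub>k\<^sub>+\<^sub>1\<close> into the span of \<open>e\<^sub>1, \<dots>, e\<^sub>k\<close>, and these are absorbed.
\<close>
lemma gprod_commutator_positive:
  assumes \<alpha>: "\<alpha> \<in> set (pos_roots n)" and X: "X \<in> root_space (so_odd n) n \<alpha>" and "k \<le> n" "i < d" "j < d"
  shows "(spin X * gprod k) $$ (i, j) - (gprod k * spin X) $$ (i, j) = 0"
  using assms(3-)
proof (induction k arbitrary: i j)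
  case 0
  then show ?case using right_mult_one_mat[OF spin_carrier[of X]] left_mult_one_mat[OF spin_carrier[of X]]
    by (simp del: index_mult_mat(1))
next
  case (Suc k)
  have k: "k \<le> n" using Suc.prems by simp
  have Xs: "X \<in> so_odd n" using X by (simp add: root_space_def)
  have "X $$ (a, Suc k) * (gprod k * g a) $$ (i, j) = 0" if a: "a \<le> 2*n" for a
  proof (cases "X $$ (a, Suc k) = 0")
    case False
    then have "1 \<le> a" "a < Suc k"
      using pos_root_space_upper[OF \<alpha> X False a Suc.prems(1)] by auto
    then have "gprod k * g a = 0\<^sub>m d d" using k by (intro gprod_absorb) auto
    then show ?thesis using Suc.prems by (simp del: index_mult_mat(1))
  qed simp
  then have s: "(\<Sum>a\<le>2*n. X $$ (a, Suc k) * (gprod k * g a) $$ (i, j)) = 0" by (intro sum.neutral ballI) simp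
  have IH: "(spin X * gprod k) $$ (i, j) - (gprod k * spin X) $$ (i, j) = 0 * gprod k $$ (i, j)"
    if "i < d" "j < d" for i j using Suc.IH[OF k that] by simp
  show ?case
    using gprod_commutator_step[OF Xs Suc.prems(1) IH Suc.prems(2,3)] unfolding s by simp
qed

text \<open>
  A vector that \<open>gprod k\<close> maps to \<open>x\<close>, which shows that \<open>gprod k\<close> does not vanish.
\<close>
primrec lowered :: "nat \<Rightarrow> complex vec" where
  "lowered 0 = x"
| "lowered (Suc k) = g (n + Suc k) *\<^sub>v lowered k"

lemma lowered_carrier: "k \<le> n \<Longrightarrow> lowered k \<in> carrier_vec d"
  by (induction k) (simp_all add: xc g_vec)

lemma lowered_killed: "k \<le> n \<Longrightarrow> k < j \<Longrightarrow> j \<le> n \<Longrightarrow> g j *\<^sub>v lowered k = 0\<^sub>v d"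
proof (induction k)
  case (Suc k)
  have "g j *\<^sub>v (g (n + Suc k) *\<^sub>v lowered k) = (if n + Suc k = dual n j then lowered k else 0\<^sub>v d)"
    using Suc by (intro anti_vec_killed lowered_carrier) auto
  then show ?case using Suc.prems by (simp add: dual_def)
qed (simp add: kill)

lemma gprod_lowered: "k \<le> n \<Longrightarrow> gprod k *\<^sub>v lowered k = x"
proof (induction k)
  case (Suc k)
  have "g (Suc k) *\<^sub>v (g (n + Suc k) *\<^sub>v lowered k) = (if n + Suc k = dual n (Suc k) then lowered k else 0\<^sub>v d)"
    using Suc.prems by (intro anti_vec_killed lowered_carrier lowered_killed) auto
  then have "g (Suc k) *\<^sub>v lowered (Suc k) = lowered k" using Suc.prems by (simp add: dual_def)
  moreover have "gprod (Suc k) *\<^sub>v lowered (Suc k) = gprod k *\<^sub>v (g (Suc k) *\<^sub>v lowered (Suc k))"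
    unfolding gprod.simps(2)
    by (rule assoc_mult_mat_vec[OF gprod_carrier gc lowered_carrier]) (use Suc.prems in auto)
  ultimately show ?case using Suc by simp
qed (simp add: xc)

text \<open>
  The module \<open>S \<otimes> S\<^sup>* \<cong> End S\<close>, on which \<open>X\<close> acts by the commutator with \<open>spin X\<close>.
\<close>
abbreviation "spin_end \<equiv> tensor_rep d d spin (\<lambda>X. (-1) \<cdot>\<^sub>m transpose_mat (spin X))"

lemma spin_end_tensor_vec:
  assumes T: "T \<in> carrier_mat d d"
    and e: "\<And>i j. i < d \<Longrightarrow> j < d \<Longrightarrow> (spin X * T) $$ (i, j) - (T * spin X) $$ (i, j) = c * T $$ (i, j)"
  shows "spin_end X *\<^sub>v tensor_vec T = c \<cdot>\<^sub>v tensor_vec T"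
proof -
  let ?S = "spin X" and ?R = "(-1) \<cdot>\<^sub>m transpose_mat (spin X)"
  have R: "?R \<in> carrier_mat d d" by simp
  have t: "tensor_vec T \<in> carrier_vec (d * d)" using T by simp
  have rt: "transpose_mat ?R = (-1) \<cdot>\<^sub>m ?S" by (rule eq_matI) (auto simp: spin_def)
  have "spin_end X *\<^sub>v tensor_vec T = kron ?S (1\<^sub>m d) *\<^sub>v tensor_vec T + kron (1\<^sub>m d) ?R *\<^sub>v tensor_vec T"
    unfolding tensor_rep_def
    by (rule add_mult_distrib_mat_vec[OF kron_carrier[OF spin_carrier one_carrier_mat] kron_carrier[OF one_carrier_mat R] t])
  also have "\<dots> = tensor_vec (?S * T * transpose_mat (1\<^sub>m d)) + tensor_vec (1\<^sub>m d * T * transpose_mat ?R)"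
    using kron_tensor_vec[OF spin_carrier one_carrier_mat T] kron_tensor_vec[OF one_carrier_mat R T] by simp
  also have "?S * T * transpose_mat (1\<^sub>m d) = ?S * T"
    using right_mult_one_mat[OF mult_carrier_mat[OF spin_carrier T]] by simp
  also have "1\<^sub>m d * T * transpose_mat ?R = (-1) \<cdot>\<^sub>m (T * ?S)"
    unfolding rt left_mult_one_mat[OF T] by (rule mult_smult_distrib[OF T spin_carrier])
  also have "tensor_vec (?S * T) + tensor_vec ((-1) \<cdot>\<^sub>m (T * ?S)) = c \<cdot>\<^sub>v tensor_vec T"
  proof (rule eq_vecI)
    have ST: "?S * T \<in> carrier_mat d d" "T * ?S \<in> carrier_mat d d"
      using mult_carrier_mat[OF spin_carrier T] mult_carrier_mat[OF T spin_carrier] by auto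
    have dS: "dim_row ?S = d" "dim_col ?S = d" by (simp_all add: spin_def)
    show "dim_vec (tensor_vec (?S * T) + tensor_vec ((-1) \<cdot>\<^sub>m (T * ?S))) = dim_vec (c \<cdot>\<^sub>v tensor_vec T)"
      using ST T dS by (simp add: tensor_vec_def)
    fix p assume "p < dim_vec (c \<cdot>\<^sub>v tensor_vec T)"
    then have p: "p < d * d" using T by (simp add: tensor_vec_def)
    note q = div_less[OF p] mod_less[OF p]
    have "((-1) \<cdot>\<^sub>m (T * ?S)) $$ (p div d, p mod d) = - (T * ?S) $$ (p div d, p mod d)"
      using q ST by (subst index_smult_mat(1)) auto
    then have "(tensor_vec (?S * T) + tensor_vec ((-1) \<cdot>\<^sub>m (T * ?S))) $ p =
      (?S * T) $$ (p div d, p mod d) - (T * ?S) $$ (p div d, p mod d)"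
      using p ST T dS by (simp add: tensor_vec_def del: index_mult_mat(1) index_smult_mat(1))
    also have "\<dots> = (c \<cdot>\<^sub>v tensor_vec T) $ p" using e[OF q] p T by (simp add: tensor_vec_def)
    finally show "(tensor_vec (?S * T) + tensor_vec ((-1) \<cdot>\<^sub>m (T * ?S))) $ p = (c \<cdot>\<^sub>v tensor_vec T) $ p" .
  qed
  finally show ?thesis .
qed

lemma spin_end_hw:
  assumes k: "k < n"
  shows "hw_vector n (fund_weight n k) (d * d) spin_end (tensor_vec (gprod k))"
  unfolding hw_vector_def
proof (intro conjI ballI)
  have T: "gprod k \<in> carrier_mat d d" using k by (intro gprod_carrier) simp
  then show "tensor_vec (gprod k) \<in> carrier_vec (d * d)" by simp
  fix H assume H: "H \<in> cartan n"
  have "eval_weight n (fund_weight n k) H = (\<Sum>a=1..k. H $$ (a, a))"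
    unfolding eval_weight_def using k
    by (intro sum.mono_neutral_cong_right) (auto simp: fund_weight_def)
  then show "spin_end H *\<^sub>v tensor_vec (gprod k) = eval_weight n (fund_weight n k) H \<cdot>\<^sub>v tensor_vec (gprod k)"
    using gprod_commutator_cartan[OF H, of k] k by (intro spin_end_tensor_vec[OF T]) simp
next
  have T: "gprod k \<in> carrier_mat d d" using k by (intro gprod_carrier) simp
  fix \<alpha> X assume \<alpha>: "\<alpha> \<in> set (pos_roots n)" and X: "X \<in> root_space (so_odd n) n \<alpha>"
  have "spin_end X *\<^sub>v tensor_vec (gprod k) = 0 \<cdot>\<^sub>v tensor_vec (gprod k)"
    using gprod_commutator_positive[OF \<alpha> X, of k] k by (intro spin_end_tensor_vec[OF T]) simp
  also have "\<dots> = 0\<^sub>v (d * d)" using T by (intro eq_vecI) (auto simp: tensor_vec_def)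
  finally show "spin_end X *\<^sub>v tensor_vec (gprod k) = 0\<^sub>v (d * d)" .
qed

lemma tensor_gprod_nonzero:
  assumes k: "k < n"
  shows "tensor_vec (gprod k) \<noteq> 0\<^sub>v (d * d)"
proof
  assume z: "tensor_vec (gprod k) = 0\<^sub>v (d * d)"
  have T: "gprod k \<in> carrier_mat d d" using k by (intro gprod_carrier) simp
  have "gprod k = 0\<^sub>m d d"
  proof (rule eq_matI)
    fix i j assume "i < dim_row (0\<^sub>m d d :: complex mat)" "j < dim_col (0\<^sub>m d d :: complex mat)"
    then have ij: "i < d" "j < d" by auto
    have "i * d + j < (i + 1) * d" using ij by simp
    also have "\<dots> \<le> d * d" using ij by (intro mult_right_mono) auto
    finally have l: "i * d + j < d * d" .
    have "tensor_vec (gprod k) $ (i * d + j) = gprod k $$ (i, j)"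
      using l ij T by (simp add: tensor_vec_def)
    then show "gprod k $$ (i, j) = 0\<^sub>m d d $$ (i, j)" using z l ij by simp
  qed (use T in auto)
  then have "x = 0\<^sub>v d" using gprod_lowered[of k] lowered_carrier[of k] k by (simp add: zero_mat_vec)
  then show False using x0 by simp
qed

end

text \<open>
  For \<open>k = n\<close> this is the spin module, and for \<open>k < n\<close> the module \<open>End S\<close>.
\<close>
theorem fundamental_module:
  assumes k: "k \<in> {1..n}"
  shows "\<exists>d \<rho> v. unitary_rep n d \<rho> \<and> hw_vector n (fund_weight n k) d \<rho> v \<and> v \<noteq> 0\<^sub>v d"
proof -
  obtain d g x where "clifford n d g x" using clifford_exists by blast
  then interpret clifford_module n d g x by unfold_locales
  show ?thesis
  proof (cases "k = n")
    case True
    then show ?thesis using spin_unitary spin_hw x0 by blast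
  next
    case False
    then have "k < n" using k by simp
    then show ?thesis
      using tensor_unitary[OF spin_unitary dual_unitary[OF spin_unitary]] spin_end_hw tensor_gprod_nonzero by blast
  qed
qed

section \<open>Witnesses for the generators\<close>

lemma pos_roots_D_subset: "\<alpha> \<in> pos_roots_D n \<Longrightarrow> \<alpha> \<in> set (pos_roots n)"
  by (simp add: set_pos_roots)

lemma witness_highest:
  assumes U: "unitary_rep n d \<rho>" and hw: "hw_vector n l d \<rho> v" and v0: "v \<noteq> 0\<^sub>v d"
  shows "witness n l [] d \<rho> v v"
proof -
  have v: "v \<in> carrier_vec d" using hw by (simp add: hw_vector_def)
  have "hw_vector_D n (\<lambda>k. l k - of_nat (count (mset []) k)) d \<rho> v"
    unfolding hw_vector_D_def
  proof (intro conjI ballI)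
    fix k assume k: "k \<in> {1..n}"
    show "\<rho> (so_unit n k k) *\<^sub>v v = (l k - of_nat (count (mset []) k)) \<cdot>\<^sub>v v"
      using hw so_unit_diag_cartan[OF k] eval_so_unit_diag[OF k, of l] by (simp add: hw_vector_def)
  qed (use hw pos_roots_D_subset in \<open>auto simp: hw_vector_def\<close>)
  moreover have "conjugate v \<bullet> v \<noteq> 0" using form_self_eq_0[OF v] v0 by simp
  ultimately show ?thesis using U hw by (simp add: witness_def)
qed

context so_hw
begin

lemma short_raise:
  assumes i: "i \<in> {1..n}"
  shows "\<rho> (so_unit n i 0) *\<^sub>v v = 0\<^sub>v d"
proof -
  have "wt n i - wt n 0 \<in> set (pos_roots n)" using i by (simp add: set_pos_roots eps_wt[symmetric])
  then show ?thesis using i by (intro highest[OF _ so_unit_root_space]) auto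
qed

lemma short_raise_lower:
  assumes i: "i \<in> {1..n}"
  shows "\<rho> (so_unit n i 0) *\<^sub>v (y i *\<^sub>v v) = l i \<cdot>\<^sub>v v"
proof -
  have F: "so_unit n i 0 \<in> so_odd n" "so_unit n 0 i \<in> so_odd n" using i by auto
  note z = short_raise[OF i]
  have yz: "y i *\<^sub>v 0\<^sub>v d = 0\<^sub>v d" using mult_mat_zero_vec[of "y i" d d] i by simp
  have "\<rho> (so_unit n i 0) *\<^sub>v (y i *\<^sub>v v) = y i *\<^sub>v (\<rho> (so_unit n i 0) *\<^sub>v v) + \<rho> (so_unit n i i) *\<^sub>v v"
    using rep_commute[OF rep F v] bracket_short_opposite[OF i] by simp
  also have "\<dots> = l i \<cdot>\<^sub>v v"
    unfolding z yz weight[OF so_unit_diag_cartan[OF i]] eval_so_unit_diag[OF i] using v by simp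
  finally show ?thesis .
qed

text \<open>
  Move one factor to the other side of the Hermitian form and use \<open>short_raise_lower\<close>.
\<close>
lemma norm_short:
  assumes U: "unitary_rep n d \<rho>" and i: "i \<in> {1..n}"
  shows "conjugate (y i *\<^sub>v v) \<bullet> (y i *\<^sub>v v) = cnj (l i) * (conjugate v \<bullet> v)"
proof -
  have F: "so_unit n 0 i \<in> so_odd n" using i by simp
  have yv: "y i *\<^sub>v v \<in> carrier_vec d" using i v by simp
  have "conjugate (y i *\<^sub>v v) \<bullet> (y i *\<^sub>v v) = conjugate (\<rho> (adj (so_unit n 0 i)) *\<^sub>v (y i *\<^sub>v v)) \<bullet> v"
    by (rule unitary_form[OF U F yv v])
  also have "adj (so_unit n 0 i) = so_unit n i 0" using i by (intro adj_so_unit) auto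
  also have "conjugate (\<rho> (so_unit n i 0) *\<^sub>v (y i *\<^sub>v v)) \<bullet> v = cnj (l i) * (conjugate v \<bullet> v)"
    unfolding short_raise_lower[OF i] using v by (simp add: conjugate_smult_vec)
  finally show ?thesis .
qed

end

lemma bracket_sum_short:
  assumes i: "i \<in> {1..n}" and j: "j \<in> {1..n}" and k: "k \<in> {1..n}" and ij: "i \<noteq> j"
  shows "lie_bracket (so_unit n i (n + j)) (so_unit n 0 k) =
    (if k = i then so_unit n j 0 else if k = j then (-1) \<cdot>\<^sub>m so_unit n i 0 else 0\<^sub>m (2*n+1) (2*n+1))"
proof (rule eq_mat_soI)
  fix a b assume ab: "a \<le> 2*n" "b \<le> 2*n"
  have d: "dual n k = n + k" "dual n 0 = 0" "dual n j = n + j" using j k by (auto simp: dual_def)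
  have s: "((-1) \<cdot>\<^sub>m so_unit n i 0) $$ (a, b) = - so_unit n i 0 $$ (a, b)"
    "((-1) \<cdot>\<^sub>m so_unit n j 0) $$ (a, b) = - so_unit n j 0 $$ (a, b)"
    using ab by (subst index_smult_mat; auto simp: so_unit_def)+
  have "so_unit n 0 (n + j) = (-1) \<cdot>\<^sub>m so_unit n j 0"
    using so_unit_dual[of j n 0] j by (simp add: d)
  then have t: "so_unit n 0 (n + j) $$ (a, b) = - so_unit n j 0 $$ (a, b)" using s by simp
  show "lie_bracket (so_unit n i (n + j)) (so_unit n 0 k) $$ (a, b) =
    (if k = i then so_unit n j 0 else if k = j then (-1) \<cdot>\<^sub>m so_unit n i 0 else 0\<^sub>m (2*n+1) (2*n+1)) $$ (a, b)"
    using assms ab s t d by (subst bracket_so_unit[OF _ _ _ _ ab]) auto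
qed (auto intro: so_unit_carrier)

text \<open>
  The vector \<open>u = y\<^sub>k v\<close> does not vanish, as its norm is a positive multiple of that of \<open>v\<close>.  A root vector
  \<open>X\<close> of \<open>D\<^sub>n\<close> for a positive root maps it to \<open>[X, y\<^sub>k] v\<close>.  This bracket is zero, or a root vector for some
  \<open>\<epsilon>\<^sub>j\<close>, or a multiple of \<open>y\<^sub>j\<close> with \<open>j > k\<close>; in the last case the norm of \<open>y\<^sub>j v\<close> is zero because the
  coordinate of \<open>\<omega>\<^sub>k\<close> at \<open>\<epsilon>\<^sub>j\<close> vanishes.
\<close>
lemma witness_short:
  assumes U: "unitary_rep n d \<rho>" and hw: "hw_vector n (fund_weight n k) d \<rho> v" and v0: "v \<noteq> 0\<^sub>v d"
    and k: "k \<in> {1..n}"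
  shows "witness n (fund_weight n k) [k] d \<rho> v (\<rho> (so_unit n 0 k) *\<^sub>v v)"
proof -
  let ?l = "fund_weight n k"
  interpret so_hw n d \<rho> ?l v using hw_vector_so_hw U hw by (simp add: unitary_rep_def)
  let ?u = "y k *\<^sub>v v"
  have uc: "?u \<in> carrier_vec d" using k v by simp
  have nv: "conjugate v \<bullet> v \<noteq> 0" using form_self_eq_0[OF v] v0 by simp
  note short = short_raise
  have yj: "y j *\<^sub>v v = 0\<^sub>v d" if j: "j \<in> {1..n}" "k < j" for j
  proof -
    have "?l j = 0" using j by (simp add: fund_weight_def)
    then have "conjugate (y j *\<^sub>v v) \<bullet> (y j *\<^sub>v v) = 0" using norm_short[OF U j(1)] by simp
    moreover have "y j *\<^sub>v v \<in> carrier_vec d" using j v by simp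
    ultimately show ?thesis using form_self_eq_0 by blast
  qed
  have neg: "\<rho> ((-1) \<cdot>\<^sub>m F) *\<^sub>v v = 0\<^sub>v d" if "F \<in> so_odd n" "\<rho> F *\<^sub>v v = 0\<^sub>v d" for F
    unfolding rep_smult[OF rep that(1)] smult_mat_vec[OF rep_carrier[OF rep that(1)] v] that(2) by (rule eq_vecI) auto
  have zero: "\<rho> (0\<^sub>m (2*n+1) (2*n+1)) *\<^sub>v v = 0\<^sub>v d"
    unfolding rep_zero[OF rep] using v by (rule zero_mat_vec)
  have kill: "\<rho> X *\<^sub>v ?u = 0\<^sub>v d" if \<alpha>: "\<alpha> \<in> pos_roots_D n" and X: "X \<in> root_space (so_odd n) n \<alpha>" for \<alpha> X
  proof -
    have unit_kill: "\<rho> F *\<^sub>v ?u = 0\<^sub>v d"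
      if F: "F \<in> root_space (so_odd n) n \<alpha>" and br: "\<rho> (lie_bracket F (so_unit n 0 k)) *\<^sub>v v = 0\<^sub>v d" for F
    proof -
      have Fs: "F \<in> so_odd n" using F by (simp add: root_space_def)
      have "\<rho> F *\<^sub>v v = 0\<^sub>v d" using highest[OF pos_roots_D_subset[OF \<alpha>] F] .
      moreover have "y k *\<^sub>v 0\<^sub>v d = 0\<^sub>v d" using mult_mat_zero_vec[of "y k" d d] k by simp
      ultimately show ?thesis using rep_commute[OF rep Fs _ v, of "so_unit n 0 k"] k br by simp
    qed
    have scale: "\<rho> X *\<^sub>v ?u = 0\<^sub>v d" if "X = c \<cdot>\<^sub>m F" "F \<in> so_odd n" "\<rho> F *\<^sub>v ?u = 0\<^sub>v d" for c F
      unfolding that(1) rep_smult[OF rep that(2)] smult_mat_vec[OF rep_carrier[OF rep that(2)] uc] that(3)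
      by (rule eq_vecI) auto
    from \<alpha> show ?thesis
    proof (cases rule: pos_roots_D_cases)
      case (1 i j)
      have ij: "i \<in> {1..n}" "j \<in> {1..n}" "i \<le> 2*n" "j \<le> 2*n" using 1 by auto
      have Xe: "X = X $$ (i, j) \<cdot>\<^sub>m so_unit n i j"
        using X 1 by (intro root_space_unit) (auto simp: dual_def)
      have "\<rho> (lie_bracket (so_unit n i j) (so_unit n 0 k)) *\<^sub>v v = 0\<^sub>v d"
        unfolding bracket_lower_short[OF ij(2,1) k]
        using 1 yj[of j] neg[of "so_unit n 0 j"] zero ij by auto
      then have "\<rho> (so_unit n i j) *\<^sub>v ?u = 0\<^sub>v d"
        using so_unit_root_space[OF ij(3,4)] 1 by (intro unit_kill) auto
      then show ?thesis using ij by (intro scale[OF Xe]) auto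
    next
      case (2 i j)
      have ij: "i \<in> {1..n}" "j \<in> {1..n}" "i \<noteq> j" "i \<le> 2*n" "n + j \<le> 2*n" using 2 by auto
      have Xe: "X = X $$ (i, n + j) \<cdot>\<^sub>m so_unit n i (n + j)"
        using X 2 by (intro root_space_unit) (auto simp: dual_def)
      have "\<rho> (lie_bracket (so_unit n i (n + j)) (so_unit n 0 k)) *\<^sub>v v = 0\<^sub>v d"
        unfolding bracket_sum_short[OF ij(1,2) k ij(3)]
        using short[OF ij(1)] short[OF ij(2)] neg[of "so_unit n i 0"] zero ij by auto
      then have "\<rho> (so_unit n i (n + j)) *\<^sub>v ?u = 0\<^sub>v d"
        using so_unit_root_space[OF ij(4,5)] 2 by (intro unit_kill) auto
      then show ?thesis using ij by (intro scale[OF Xe]) auto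
    qed
  qed
  have "hw_vector_D n (\<lambda>j. ?l j - of_nat (count (mset [k]) j)) d \<rho> ?u"
    unfolding hw_vector_D_def using yword_weight[of "[k]"] k uc kill by auto
  moreover have "conjugate ?u \<bullet> yword n \<rho> [k] v \<noteq> 0"
    using norm_short[OF U k] nv k by (simp add: fund_weight_def)
  ultimately show ?thesis using U hw k by (simp add: witness_def)
qed

section \<open>Sums of generators\<close>

text \<open>
  The coefficient of \<open>\<omega>\<^sub>k\<close> in \<open>l\<close>.
\<close>
definition simple_coord :: "nat \<Rightarrow> weight \<Rightarrow> nat \<Rightarrow> complex" where
  "simple_coord n l k = (if k < n then l k - l (Suc k) else 2 * l n)"

lemma simple_coord_add: "simple_coord n (l + l') k = simple_coord n l k + simple_coord n l' k"
  by (simp add: simple_coord_def algebra_simps)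

lemma simple_coord_fund:
  "k \<in> {1..n} \<Longrightarrow> j \<in> {1..n} \<Longrightarrow> simple_coord n (fund_weight n j) k = (if j = k then 1 else 0)"
  by (auto simp: simple_coord_def fund_weight_def)

lemma weight_determined:
  assumes supp: "\<And>i. i \<notin> {1..n} \<Longrightarrow> l i = 0" "\<And>i. i \<notin> {1..n} \<Longrightarrow> l' i = 0"
    and e: "\<And>k. k \<in> {1..n} \<Longrightarrow> simple_coord n l k = simple_coord n l' k"
  shows "l = l'"
proof
  fix i
  show "l i = l' i"
  proof (cases "i \<in> {1..n}")
    case True
    then have "i \<le> n" "1 \<le> i" by auto
    then show ?thesis
    proof (induction i rule: inc_induct)
      case base
      then show ?case using e[of n] by (simp add: simple_coord_def)
    next
      case (step i)
      then show ?case using e[of i] by (simp add: simple_coord_def)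
    qed
  qed (use supp in simp)
qed

abbreviation gsum :: "nat \<Rightarrow> nat multiset \<Rightarrow> signature" where
  "gsum n M \<equiv> (\<Sum>j\<in>#M. generator n j)"

lemma generator_weight: "fst (generator n j) = fund_weight n ((j + 1) div 2)"
  by (auto simp: generator_def elim!: evenE)

lemma generator_exponent: "snd (generator n j) \<alpha> = (if even j \<and> \<alpha> = eps (j div 2) then 1 else 0)"
  by (auto simp: generator_def)

lemma eps_eq_iff [simp]: "eps i = eps j \<longleftrightarrow> i = j"
  by (metis eps_apply zero_neq_one)

text \<open>
  Both generators with highest weight \<open>\<omega>\<^sub>k\<close> are counted, whereas the exponent at \<open>\<epsilon>\<^sub>k\<close> counts only the
  second one (\<open>gsum_exponent\<close>).  Together the two numbers determine the multiset.
\<close>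
lemma gsum_simple_coord:
  assumes "set_mset M \<subseteq> {1..2*n}" and k: "k \<in> {1..n}"
  shows "simple_coord n (fst (gsum n M)) k = of_nat (count M (2*k) + count M (2*k - 1))"
  using assms(1)
proof (induction M)
  case empty
  show ?case by (simp add: simple_coord_def)
next
  case (add j M)
  have j: "(j + 1) div 2 \<in> {1..n}" using add.prems by auto
  have "(j + 1) div 2 = k \<longleftrightarrow> j = 2*k \<or> j = 2*k - 1" using k by auto
  then have "simple_coord n (fst (generator n j)) k = (if j = 2*k \<or> j = 2*k - 1 then 1 else 0)"
    unfolding generator_weight simple_coord_fund[OF k j] by simp
  moreover have "fst (gsum n (add_mset j M)) = fst (generator n j) + fst (gsum n M)" by simp
  moreover have "simple_coord n (fst (gsum n M)) k = of_nat (count M (2*k) + count M (2*k - 1))"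
    using add by simp
  ultimately have e: "simple_coord n (fst (gsum n (add_mset j M))) k =
     (if j = 2*k \<or> j = 2*k - 1 then 1 else 0) + of_nat (count M (2*k) + count M (2*k - 1))"
    by (simp only: simple_coord_add)
  have "2*k \<noteq> 2*k - 1" using k by auto
  then show ?case unfolding e by auto
qed

lemma gsum_support: "set_mset M \<subseteq> {1..2*n} \<Longrightarrow> i \<notin> {1..n} \<Longrightarrow> fst (gsum n M) i = 0"
proof (induction M)
  case (add j M)
  then have "(j + 1) div 2 \<in> {1..n}" by auto
  then have "i \<notin> {1..(j + 1) div 2}" using add.prems by auto
  then show ?case using add by (simp add: generator_weight fund_weight_def)
qed simp

lemma gsum_exponent:
  assumes "set_mset M \<subseteq> {1..2*n}"
  shows "k \<in> {1..n} \<Longrightarrow> snd (gsum n M) (eps k) = count M (2*k)"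
    and "\<alpha> \<notin> eps ` {1..n} \<Longrightarrow> snd (gsum n M) \<alpha> = 0"
proof -
  show "k \<in> {1..n} \<Longrightarrow> snd (gsum n M) (eps k) = count M (2*k)"
    using assms by (induction M) (auto simp: generator_exponent elim!: evenE)
  show "\<alpha> \<notin> eps ` {1..n} \<Longrightarrow> snd (gsum n M) \<alpha> = 0"
    using assms by (induction M) (auto simp: generator_exponent elim!: evenE)
qed

lemma gsum_inj: "inj_on (gsum n) {M. set_mset M \<subseteq> {1..2*n}}"
proof (rule inj_onI)
  fix M M' assume M: "M \<in> {M. set_mset M \<subseteq> {1..2*n}}" and M': "M' \<in> {M. set_mset M \<subseteq> {1..2*n}}"
    and e: "gsum n M = gsum n M'"
  have e2: "count M (2*k) = count M' (2*k)" if k: "k \<in> {1..n}" for k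
    using gsum_exponent(1)[of M n k] gsum_exponent(1)[of M' n k] M M' e k by simp
  have e1: "count M (2*k - 1) = count M' (2*k - 1)" if k: "k \<in> {1..n}" for k
  proof -
    have "(of_nat (count M (2*k) + count M (2*k - 1)) :: complex) = of_nat (count M' (2*k) + count M' (2*k - 1))"
      using gsum_simple_coord[of M n k] gsum_simple_coord[of M' n k] M M' e k by simp
    then have "count M (2*k) + count M (2*k - 1) = count M' (2*k) + count M' (2*k - 1)" by (rule of_nat_eq_iff[THEN iffD1])
    then show ?thesis using e2[OF k] by simp
  qed
  show "M = M'"
  proof (rule multiset_eqI)
    fix j
    show "count M j = count M' j"
    proof (cases "j \<in> {1..2*n}")
      case True
      then have k: "(j + 1) div 2 \<in> {1..n}" by auto
      have "j = 2 * ((j + 1) div 2) \<or> j = 2 * ((j + 1) div 2) - 1" by presburger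
      then show ?thesis using e1[OF k] e2[OF k] by metis
    next
      case False
      then have "j \<notin># M" "j \<notin># M'" using M M' by auto
      then show ?thesis by (metis not_in_iff)
    qed
  qed
qed

lemma gsum_surj:
  assumes supp: "\<And>i. i \<notin> {1..n} \<Longrightarrow> l i = 0" and p: "\<And>\<alpha>. \<alpha> \<notin> eps ` {1..n} \<Longrightarrow> p \<alpha> = 0"
    and m: "\<And>k. k \<in> {1..n} \<Longrightarrow> simple_coord n l k = of_nat (m k)" and pm: "\<And>k. k \<in> {1..n} \<Longrightarrow> p (eps k) \<le> m k"
  shows "\<exists>M. set_mset M \<subseteq> {1..2*n} \<and> gsum n M = (l, p)"
proof -
  define f where "f j = (if j \<in> {1..2*n} then if even j then p (eps (j div 2)) else m ((j + 1) div 2) - p (eps ((j + 1) div 2)) else 0)" for j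
  have "finite {j. 0 < f j}" by (rule finite_subset[of _ "{1..2*n}"]) (auto simp: f_def)
  then have cM: "count (Abs_multiset f) = f" by (rule count_Abs_multiset)
  define M where "M = Abs_multiset f"
  have M: "set_mset M \<subseteq> {1..2*n}" by (auto simp: M_def set_mset_def cM f_def split: if_splits)
  have c: "count M (2*k) = p (eps k)" "count M (2*k - 1) = m k - p (eps k)" if k: "k \<in> {1..n}" for k
  proof -
    have "2*k \<in> {1..2*n}" "2*k - 1 \<in> {1..2*n}" "odd (2*k - 1)" "(2*k - 1 + 1) div 2 = k" using k by auto
    then show "count M (2*k) = p (eps k)" "count M (2*k - 1) = m k - p (eps k)"
      unfolding M_def cM f_def by simp_all
  qed
  have "fst (gsum n M) = l"
    by (rule weight_determined[of n]) (use gsum_support[OF M] supp m pm c gsum_simple_coord[OF M] in auto)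
  moreover have "snd (gsum n M) = p"
  proof
    fix \<alpha> show "snd (gsum n M) \<alpha> = p \<alpha>"
      using gsum_exponent[OF M] p c by (cases "\<alpha> \<in> eps ` {1..n}") auto
  qed
  ultimately show ?thesis using M by (intro exI[of _ M]) (auto simp: prod_eq_iff)
qed

section \<open>Dominant weights\<close>

lemma weight_form_eps: "k \<in> {1..n} \<Longrightarrow> weight_form n l (eps k) = l k"
proof -
  assume k: "k \<in> {1..n}"
  have "weight_form n l (eps k) = (\<Sum>i=1..n. if i = k then l k else 0)"
    unfolding weight_form_def by (rule sum.cong) (auto simp: eps_def)
  then show ?thesis using k by simp
qed

lemma weight_form_right:
  "weight_form n l (m + m') = weight_form n l m + weight_form n l m'"
  "weight_form n l (m - m') = weight_form n l m - weight_form n l m'"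
  by (simp_all add: weight_form_def algebra_simps sum.distrib sum_subtractf)

lemma pos_root_cases:
  assumes "\<alpha> \<in> set (pos_roots n)"
  obtains i j where "i \<in> {1..n}" "j \<in> {1..n}" "i < j" "\<alpha> = eps i - eps j"
  | i j where "i \<in> {1..n}" "j \<in> {1..n}" "i < j" "\<alpha> = eps i + eps j"
  | i where "i \<in> {1..n}" "\<alpha> = eps i"
proof -
  from assms have "(\<exists>i j. 1 \<le> i \<and> i < j \<and> j \<le> n \<and> (\<alpha> = eps i - eps j \<or> \<alpha> = eps i + eps j)) \<or> (\<exists>i. 1 \<le> i \<and> i \<le> n \<and> \<alpha> = eps i)"
    unfolding set_pos_roots pos_roots_D_def by fastforce
  then show thesis using that by (elim disjE exE conjE) (auto intro: that)
qed

lemma dominant_iff: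
  "dominant n l \<longleftrightarrow> (\<forall>i. i \<notin> {1..n} \<longrightarrow> l i = 0) \<and>
     (\<forall>i\<in>{1..n}. \<forall>j\<in>{1..n}. i < j \<longrightarrow> l i - l j \<in> \<nat> \<and> l i + l j \<in> \<nat>) \<and> (\<forall>i\<in>{1..n}. 2 * l i \<in> \<nat>)"
proof -
  have d: "2 * weight_form n l (eps i - eps j) / weight_form n (eps i - eps j) (eps i - eps j) = l i - l j"
    "2 * weight_form n l (eps i + eps j) / weight_form n (eps i + eps j) (eps i + eps j) = l i + l j"
    if "i \<in> {1..n}" "j \<in> {1..n}" "i < j" for i j
    using that by (simp_all only: weight_form_right weight_form_eps) (auto simp: eps_def)
  have s: "2 * weight_form n l (eps i) / weight_form n (eps i) (eps i) = 2 * l i" if "i \<in> {1..n}" for i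
    using that by (simp only: weight_form_eps) (simp add: eps_def)
  have r: "eps i - eps j \<in> set (pos_roots n)" "eps i + eps j \<in> set (pos_roots n)" if "i \<in> {1..n}" "j \<in> {1..n}" "i < j" for i j
  proof -
    have "1 \<le> i" "j \<le> n" using that by auto
    then show "eps i - eps j \<in> set (pos_roots n)" "eps i + eps j \<in> set (pos_roots n)"
      using that(3) unfolding set_pos_roots pos_roots_D_def by blast+
  qed
  have r': "eps i \<in> set (pos_roots n)" if "i \<in> {1..n}" for i using that by (simp add: set_pos_roots)
  show ?thesis unfolding dominant_def
  proof (intro conj_cong refl iffI)
    assume h: "\<forall>\<alpha>\<in>set (pos_roots n). 2 * weight_form n l \<alpha> / weight_form n \<alpha> \<alpha> \<in> \<nat>"
    then show "(\<forall>i\<in>{1..n}. \<forall>j\<in>{1..n}. i < j \<longrightarrow> l i - l j \<in> \<nat> \<and> l i + l j \<in> \<nat>) \<and> (\<forall>i\<in>{1..n}. 2 * l i \<in> \<nat>)"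
      using r r' d s by metis
  next
    assume h: "(\<forall>i\<in>{1..n}. \<forall>j\<in>{1..n}. i < j \<longrightarrow> l i - l j \<in> \<nat> \<and> l i + l j \<in> \<nat>) \<and> (\<forall>i\<in>{1..n}. 2 * l i \<in> \<nat>)"
    show "\<forall>\<alpha>\<in>set (pos_roots n). 2 * weight_form n l \<alpha> / weight_form n \<alpha> \<alpha> \<in> \<nat>"
    proof
      fix \<alpha> assume "\<alpha> \<in> set (pos_roots n)"
      then show "2 * weight_form n l \<alpha> / weight_form n \<alpha> \<alpha> \<in> \<nat>"
        by (cases rule: pos_root_cases) (use h d s in auto)
    qed
  qed
qed

lemma dominant_zero: "dominant n 0"
  by (auto simp: dominant_iff)

lemma dominant_add: 
  assumes "dominant n l" "dominant n l'" shows "dominant n (l + l')"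
proof -
  have "(l i + l' i) - (l j + l' j) = (l i - l j) + (l' i - l' j)" "(l i + l' i) + (l j + l' j) = (l i + l j) + (l' i + l' j)"
    "2 * (l i + l' i) = 2 * l i + 2 * l' i" for i j by auto
  then show ?thesis using assms unfolding dominant_iff plus_fun_apply by (metis Nats_add add.right_neutral)
qed

lemma dominant_fund: "k \<in> {1..n} \<Longrightarrow> dominant n (fund_weight n k)"
  by (auto simp: dominant_iff fund_weight_def)

lemma dominant_simple_coord:
  assumes "dominant n l" "k \<in> {1..n}"
  obtains m where "simple_coord n l k = of_nat m"
proof -
  have "simple_coord n l k \<in> \<nat>" using assms unfolding dominant_iff simple_coord_def by auto
  then show ?thesis using that by (metis Nats_cases)
qed

section \<open>The branching semigroup\<close>

lemma eps_not_D: "eps i \<notin> pos_roots_D n"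
proof
  assume "eps i \<in> pos_roots_D n"
  then obtain a b where ab: "a < b" "eps i = eps a - eps b \<or> eps i = eps a + eps b"
    unfolding pos_roots_D_def by blast
  then have "eps i a = 1" "eps i b = 1 \<or> eps i b = -1" by (elim disjE; simp add: eps_apply)+
  then show False using ab(1) by (auto simp: eps_def split: if_splits)
qed

lemma count_map_eps: "count (mset (map eps ws)) (eps k) = count (mset ws) k"
  by (induction ws) auto

text \<open>
  Adding a generator to the sum tensors the witness with one for that generator.
\<close>
lemma gsum_witness:
  assumes "set_mset M \<subseteq> {1..2*n}"
  shows "dominant n (fst (gsum n M)) \<and> (\<exists>ws d \<rho> v u. witness n (fst (gsum n M)) ws d \<rho> v u \<and>
     snd (gsum n M) = count (mset (map eps ws)))"
  using assms
proof (induction M)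
  case empty
  have "snd (gsum n {#}) = count (mset (map eps []))" by (auto simp: fun_eq_iff)
  moreover have "witness n (fst (gsum n {#})) [] 1 (\<lambda>X. 0\<^sub>m 1 1) (vec 1 (\<lambda>_. 1)) (vec 1 (\<lambda>_. 1))"
    using witness_zero[of n] by simp
  moreover have "dominant n (fst (gsum n {#}))" using dominant_zero by simp
  ultimately show ?case by blast
next
  case (add j M)
  let ?k = "(j + 1) div 2"
  have k: "?k \<in> {1..n}" using add.prems by auto
  obtain d \<rho> v where m: "unitary_rep n d \<rho>" "hw_vector n (fund_weight n ?k) d \<rho> v" "v \<noteq> 0\<^sub>v d"
    using fundamental_module[OF k] by blast
  have "\<exists>ws u. witness n (fund_weight n ?k) ws d \<rho> v u \<and> snd (generator n j) = count (mset (map eps ws))"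
  proof (cases "even j")
    case True
    then have "snd (generator n j) = count (mset (map eps [?k]))" by (auto simp: fun_eq_iff generator_exponent elim!: evenE)
    then show ?thesis using witness_short[OF m k] by blast
  next
    case False
    then have "snd (generator n j) = count (mset (map eps []))" by (auto simp: fun_eq_iff generator_exponent)
    then show ?thesis using witness_highest[OF m] by blast
  qed
  then obtain ws u where w: "witness n (fund_weight n ?k) ws d \<rho> v u" "snd (generator n j) = count (mset (map eps ws))" by blast
  obtain ws' d' \<rho>' v' u' where w': "witness n (fst (gsum n M)) ws' d' \<rho>' v' u'"
    "snd (gsum n M) = count (mset (map eps ws'))" using add by auto
  have "witness n (fst (gsum n (add_mset j M))) (ws @ ws') (d * d') (tensor_rep d d' \<rho> \<rho>') (vkron v v') (vkron u u')"
    using witness_tensor[OF w(1) w'(1)] by (simp add: generator_weight)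
  moreover have "snd (gsum n (add_mset j M)) = count (mset (map eps (ws @ ws')))"
    using w(2) w'(2) by (auto simp: fun_eq_iff)
  moreover have "dominant n (fst (gsum n (add_mset j M)))"
    using dominant_add[OF dominant_fund[OF k]] add by (simp add: generator_weight)
  ultimately show ?case by blast
qed

text \<open>
  The form \<open>\<langle>u, \<cdot>\<rangle>\<close> vanishes on all monomials but one, whose exponents are therefore its signature.
\<close>
lemma witness_branching:
  assumes e: "root_vectors n e" and dom: "dominant n l" and W0: "witness n l ws d\<^sub>0 \<rho>\<^sub>0 v\<^sub>0 u\<^sub>0"
  shows "(l, count (mset (map eps ws))) \<in> branching_semigroup n e"
proof -
  obtain d \<rho> v u where W: "witness n l ws d \<rho> v u" and irr: "irreducible_rep n d \<rho>"
    using irreducible_witness[OF W0] .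
  let ?p = "count (mset (map eps ws))" and ?w = "conjugate u"
  have U: "unitary_rep n d \<rho>" and hw: "hw_vector n l d \<rho> v" and ws: "set ws \<subseteq> {1..n}"
    and u: "hw_vector_D n (\<lambda>k. l k - of_nat (count (mset ws) k)) d \<rho> u"
    and nz: "?w \<bullet> yword n \<rho> ws v \<noteq> 0"
    using W by (auto simp: witness_def)
  interpret so_hw n d \<rho> l v using hw_vector_so_hw U hw by (simp add: unitary_rep_def)
  have an: "annihilates_D n d \<rho> ?w" by (rule hw_vector_D_annihilates[OF U u])
  have Yc: "yword n \<rho> ws v \<in> carrier_vec d" using ws v by (rule yword_carrier)
  have uc: "u \<in> carrier_vec d" using u by (simp add: hw_vector_D_def)
  have v0: "v \<noteq> 0\<^sub>v d" using nz yword_zero[OF ws] uc by auto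
  have w0: "?w \<noteq> 0\<^sub>v d" using nz Yc by auto
  have p0: "?p \<alpha> = 0" if "\<alpha> \<notin> eps ` {1..n}" for \<alpha>
  proof -
    have "\<alpha> \<notin># mset (map eps ws)" using that ws by auto
    then show ?thesis by (metis not_in_iff)
  qed
  have pD: "?p \<alpha> = 0" if "\<alpha> \<in> pos_roots_D n" for \<alpha>
    using that eps_not_D by (intro p0) auto
  have pe: "is_exponents n ?p" unfolding is_exponents_def using p0 by (auto simp: set_pos_roots)
  have mp: "mset (expword n ?p) = mset ws"
  proof (rule multiset_eqI)
    fix k show "count (mset (expword n ?p)) k = count (mset ws) k"
    proof (cases "k \<in> {1..n}")
      case True
      then show ?thesis unfolding count_expword count_map_eps by simp
    next
      case False
      then have "k \<notin># mset ws" using ws by auto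
      then have "count (mset ws) k = 0" by (metis not_in_iff)
      then show ?thesis unfolding count_expword if_not_P[OF False] by (rule sym)
    qed
  qed
  have "?w \<bullet> yword n \<rho> (expword n ?p) v = ?w \<bullet> yword n \<rho> ws v"
    using annihilates_mset[OF an v _ set_expword mp, of "[]"] by simp
  then have nzp: "?w \<bullet> monomial_vec n e \<rho> v ?p \<noteq> 0"
    using monomial_nonzero_iff[OF e v an pD] nz by simp
  have uniq: "q = ?p" if q: "is_exponents n q" "?w \<bullet> monomial_vec n e \<rho> v q \<noteq> 0" for q
  proof -
    have qD: "\<And>\<alpha>. \<alpha> \<in> pos_roots_D n \<Longrightarrow> q \<alpha> = 0" and "?w \<bullet> yword n \<rho> (expword n q) v \<noteq> 0"
      using monomial_nonzero[OF e v an q(2)] by blast+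
    then have mq: "mset (expword n q) = mset ws" using witness_mset[OF W set_expword] by blast
    show ?thesis
    proof
      fix \<alpha>
      show "q \<alpha> = ?p \<alpha>"
      proof (cases "\<alpha> \<in> eps ` {1..n}")
        case True
        then obtain k where k: "k \<in> {1..n}" "\<alpha> = eps k" by blast
        have "q (eps k) = count (mset ws) k" using count_expword[of n q k] k mq by simp
        then show ?thesis unfolding k(2) count_map_eps .
      next
        case False
        then have "q \<alpha> = 0" using qD q(1) unfolding is_exponents_def set_pos_roots by blast
        then show ?thesis using p0[OF False] by simp
      qed
    qed
  qed
  have "is_sign n e l \<rho> v ?w (l, ?p)"
    unfolding is_sign_def using pe nzp uniq by blast
  moreover have "highest_weight_module n l d \<rho> v"
    using irr hw v0 by (simp add: highest_weight_module_def hw_vector_def)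
  moreover have "?w \<in> invariant_forms n d \<rho>" using an by (simp add: invariant_forms_iff)
  ultimately show ?thesis unfolding branching_semigroup_def using dom w0 by blast
qed

text \<open>
  Monomials in which a root of \<open>D\<^sub>n\<close> occurs are excluded by \<open>monomial_nonzero\<close>, and the remaining exponents
  are bounded by the coefficients of the fundamental weights.
\<close>
lemma branching_bound:
  assumes e: "root_vectors n e" and s: "s \<in> branching_semigroup n e"
  shows "\<exists>M. set_mset M \<subseteq> {1..2*n} \<and> gsum n M = s"
proof -
  obtain l d \<rho> v w where dom: "dominant n l" and hwm: "highest_weight_module n l d \<rho> v"
    and w: "w \<in> invariant_forms n d \<rho>" and sg: "is_sign n e l \<rho> v w s"
    using s unfolding branching_semigroup_def by blast
  obtain p where p: "s = (l, p)" "is_exponents n p" and nz: "w \<bullet> monomial_vec n e \<rho> v p \<noteq> 0"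
    using sg unfolding is_sign_def by blast
  interpret so_hw n d \<rho> l v
    using hwm by unfold_locales (auto simp: highest_weight_module_def irreducible_rep_def)
  have an: "annihilates_D n d \<rho> w" using w by (simp add: invariant_forms_iff)
  have pD: "\<And>\<alpha>. \<alpha> \<in> pos_roots_D n \<Longrightarrow> p \<alpha> = 0" and nz': "w \<bullet> yword n \<rho> (expword n p) v \<noteq> 0"
    using monomial_nonzero[OF e v an nz] by blast+
  have "\<forall>k\<in>{1..n}. \<exists>m. simple_coord n l k = of_nat m" using dominant_simple_coord[OF dom] by metis
  then obtain m where m: "\<And>k. k \<in> {1..n} \<Longrightarrow> simple_coord n l k = of_nat (m k)" by metis
  have pm: "p (eps k) \<le> m k" if k: "k \<in> {1..n}" for k
    using exponent_bound[OF an set_expword k _ nz', of "m k"] m[OF k] k by (simp add: count_expword simple_coord_def)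
  have p0: "p \<alpha> = 0" if "\<alpha> \<notin> eps ` {1..n}" for \<alpha>
    using that pD p(2) unfolding is_exponents_def set_pos_roots by blast
  show ?thesis unfolding p(1)
    by (rule gsum_surj[OF _ p0 m pm]) (use dom in \<open>auto simp: dominant_def\<close>)
qed

theorem theorem2:
  fixes n :: nat and e :: "weight \<Rightarrow> complex mat"
  assumes "n \<ge> 3"
    and "root_vectors n e"
  shows "free_commutative_semigroup_on (branching_semigroup n e) {1..2 * n} (generator n)"
  unfolding free_commutative_semigroup_on_def bij_betw_def
proof
  show "inj_on (gsum n) {M. set_mset M \<subseteq> {1..2*n}}" by (rule gsum_inj)
  show "gsum n ` {M. set_mset M \<subseteq> {1..2*n}} = branching_semigroup n e"
  proof (intro equalityI subsetI)
    fix s assume "s \<in> branching_semigroup n e"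
    then show "s \<in> gsum n ` {M. set_mset M \<subseteq> {1..2*n}}" using branching_bound[OF assms(2)] by blast
  next
    fix s assume "s \<in> gsum n ` {M. set_mset M \<subseteq> {1..2*n}}"
    then obtain M where M: "set_mset M \<subseteq> {1..2*n}" "s = gsum n M" by blast
    then obtain ws d \<rho> v u where w: "dominant n (fst s)" "witness n (fst s) ws d \<rho> v u" "snd s = count (mset (map eps ws))"
      using gsum_witness by blast
    show "s \<in> branching_semigroup n e"
      using witness_branching[OF assms(2) w(1,2)] unfolding w(3)[symmetric] by simp
  qed
qed

end
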